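(* Let $\gamma>0$ and let $g(t)=\sqrt{\gamma}\,e^{-\gamma|t|}$, $t\in\mathbb{R}$. Consider the Gabor system $\mathcal{G}(g,a\mathbb{Z}\times b\mathbb{Z})$ with $a,b>0$ and $(ab)^{-1}=n\in\mathbb{N}$, and put $\eta_n=2\operatorname{arccosh}(n)$. There is an open interval $I_n\subset\left(\tfrac{\eta_n}{2},2\eta_n\right)$, depending on $n$, such that, for fixed $n$ and among all rectangular lattices $a\mathbb{Z}\times b\mathbb{Z}$ with $(ab)^{-1}=n$: (1) the frame condition number is minimal only for the lattice $(a_0/n)\mathbb{Z}\times(1/a_0)\mathbb{Z}$, where $$a_0\in\tfrac1\gamma I_n\subset\tfrac1\gamma\left(\tfrac{\eta_n}{2},2\eta_n\right);$$ (2) the sharp lower frame bound $A$ has a unique maximum, dependent on the oversampling rate $2\le n\in\mathbb{N}$ (for $n=1$ one has $A=0$), and the maximizing lattice $(a_+/n)\mathbb{Z}\times(1/a_+)\mathbb{Z}$ satisfies $a_+\in\tfrac1\gamma I_n$; (3) the sharp upper frame bound has a unique minimum, dependent on the oversampling rate $n\in\mathbb{N}$, and the minimizing lattice $(a^-/n)\mathbb{Z}\times(1/a^-)\mathbb{Z}$ satisfies $a^-\in\tfrac1\gamma I_n$.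
   Context: For $g\in L^2(\mathbb{R})$ and $\lambda=(x,\omega)\in\mathbb{R}^2$ put $\pi(\lambda)g(t) = g(t-x)e^{2\pi i\omega t}$. For a lattice $\Lambda\subset\mathbb{R}^2$ the Gabor system is $\mathcal{G}(g,\Lambda)=\{\pi(\lambda)g \mid \lambda\in\Lambda\}$. The sharp lower and upper frame bounds are the largest constant $A\geq 0$ and the smallest constant $B$ such that $A\|f\|_2^2 \le \sum_{\lambda\in\Lambda}|\langle f,\pi(\lambda)g\rangle|^2 \le B\|f\|_2^2$ for all $f\in L^2(\mathbb{R})$. The frame condition number is $B/A$. For a set $I\subset\mathbb{R}$, $\tfrac1\gamma I=\{x/\gamma \mid x\in I\}$; the symbol $\subset$ does not exclude equality; $\mathbb{N}=\{1,2,3,\dots\}$. Every pair $(a,b)$ of positive numbers with $(ab)^{-1}=n$ is of the form $(\eta/n,1/\eta)$ with a unique $\eta>0$. The number $n$ is called the (over)sampling rate.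
   Formalization: For n=1 the interval (η_1/2, 2η_1) is empty and A=0 for every lattice, so claim (1) and the location of a^- in (3) are asserted only for n≥2; for n=1 it is shown that A=0 and that the upper frame bound has a unique minimum. *)

theory Defs
  imports "HOL-Analysis.Analysis"
begin

text \<open>
  An element of \<open>L\<^sup>2(\<real>)\<close> is represented by a Borel measurable square-integrable function. Every
  class of almost everywhere equal Lebesgue measurable functions has such a representative, and
  all quantities below depend only on the class.
\<close>

definition L2 :: "(real \<Rightarrow> complex) set" where
  "L2 = {f. f \<in> borel_measurable lborel \<and> integrable lborel (\<lambda>t. (cmod (f t))\<^sup>2)}"

definition L2_norm_sq :: "(real \<Rightarrow> complex) \<Rightarrow> real" where
  "L2_norm_sq f = (LINT t|lborel. (cmod (f t))\<^sup>2)"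

definition L2_inner :: "(real \<Rightarrow> complex) \<Rightarrow> (real \<Rightarrow> complex) \<Rightarrow> complex" where
  "L2_inner f h = (LINT t|lborel. f t * cnj (h t))"

definition tf_shift :: "real \<times> real \<Rightarrow> (real \<Rightarrow> complex) \<Rightarrow> real \<Rightarrow> complex" where
  "tf_shift p g = (\<lambda>t. g (t - fst p) * exp (2 * of_real pi * \<i> * of_real (snd p) * of_real t))"

definition rect_lattice :: "real \<Rightarrow> real \<Rightarrow> (real \<times> real) set" where
  "rect_lattice a b = {(a * of_int k, b * of_int l) | k l. True}"

text \<open>
  The sum is taken in \<^typ>\<open>ennreal\<close>, where it always exists and is \<open>\<infinity>\<close> in the divergent case.
\<close>

definition gabor_sum :: "(real \<Rightarrow> complex) \<Rightarrow> (real \<times> real) set \<Rightarrow> (real \<Rightarrow> complex) \<Rightarrow> ennreal" where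
  "gabor_sum g \<Lambda> f = (\<Sum>\<^sub>\<infinity>p\<in>\<Lambda>. ennreal ((cmod (L2_inner f (tf_shift p g)))\<^sup>2))"

text \<open>
  The supremum and the infimum are attained, so they are the largest and the smallest admissible
  constant. The upper bound is \<open>\<infinity>\<close> if no finite constant is admissible.
\<close>

definition lower_frame_bound :: "(real \<Rightarrow> complex) \<Rightarrow> (real \<times> real) set \<Rightarrow> ennreal" where
  "lower_frame_bound g \<Lambda> = Sup {A. \<forall>f\<in>L2. A * ennreal (L2_norm_sq f) \<le> gabor_sum g \<Lambda> f}"

definition upper_frame_bound :: "(real \<Rightarrow> complex) \<Rightarrow> (real \<times> real) set \<Rightarrow> ennreal" where
  "upper_frame_bound g \<Lambda> = Inf {B. \<forall>f\<in>L2. gabor_sum g \<Lambda> f \<le> B * ennreal (L2_norm_sq f)}"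

text \<open>
  In \<^typ>\<open>ennreal\<close>, \<open>B / 0 = \<infinity>\<close> for \<open>B \<noteq> 0\<close>: systems that are not frames have infinite condition
  number.
\<close>

definition frame_condition_number :: "(real \<Rightarrow> complex) \<Rightarrow> (real \<times> real) set \<Rightarrow> ennreal" where
  "frame_condition_number g \<Lambda> = upper_frame_bound g \<Lambda> / lower_frame_bound g \<Lambda>"

definition two_sided_exp :: "real \<Rightarrow> real \<Rightarrow> complex" where
  "two_sided_exp \<gamma> = (\<lambda>t. of_real (sqrt \<gamma> * exp (- \<gamma> * \<bar>t\<bar>)))"

definition lattice_params :: "nat \<Rightarrow> (real \<times> real) set" where
  "lattice_params n = {(a, b). a > 0 \<and> b > 0 \<and> 1 / (a * b) = real n}"

definition eta :: "nat \<Rightarrow> real" where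
  "eta n = 2 * arcosh (real n)"

end

theory Submission
  imports Defs
begin

text \<open>
  Put \<open>t = \<gamma> a\<close>, \<open>p = n a = 1/b\<close> and \<open>x = n t = \<gamma> p\<close>. The sharp frame bounds are
  elementary functions of \<open>t\<close> alone:

    \<open>A = x (sinh x / sinh t - n) / (cosh x + 1)\<close>  and  \<open>B = x (sinh x cosh t / sinh t + n) / (cosh x - 1)\<close>.

  The modulations are summed first. Their step is \<open>1/p\<close>, so Parseval's identity on a period of length
  \<open>p\<close> (\<open>parseval_bounded\<close>) gives \<open>p\<close> times the integral over \<open>s\<close> in that period of a sum over \<open>k\<close>,
  which correlates the samples \<open>d m = f (s + p m)\<close> with those of the window shifted by \<open>a k\<close>
  (\<open>gabor_sum_bounded_support\<close>). Here the shape of the window enters: its samples \<open>exp (-|u + x k|)\<close>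
  are a combination of two neighbouring values of the fundamental solution \<open>K\<close> of the difference
  operator \<open>e j \<mapsto> cosh x * e j - (e (j + 1) + e (j - 1)) / 2\<close>. If \<open>d\<close>, up to reflection, is the image of
  \<open>e\<close> under this operator, then both the norm of \<open>d\<close> and the sum over \<open>k\<close> are quadratic forms in \<open>e\<close>
  that only involve \<open>E\<close>, the sum of the \<open>|e j|\<^sup>2\<close>, \<open>q\<close>, the sum of the real parts of
  \<open>e j * cnj (e (j + 1))\<close>, and \<open>\<kappa>\<close>, the sum of the \<open>|(e (j + 1) + e (j - 1)) / 2|\<^sup>2\<close>. The sum over \<open>k\<close>
  becomes \<open>\<gamma>\<close> times \<open>c (cosh x * E - q) + n (cosh x * q - E)\<close>, where \<open>c\<close> depends on the position of \<open>s\<close>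
  between the points \<open>a k\<close> only (\<open>local_frame_sum\<close>). From \<open>|q| \<le> E\<close> and \<open>2 q - E \<le> \<kappa> \<le> E\<close> both frame
  inequalities follow by algebra. They are sharp: long stretches of \<open>e j = (-1)^j\<close> and of \<open>e j = 1\<close>
  nearly give equality, if they are placed where \<open>c\<close> is smallest, respectively largest.

  What remains is calculus in \<open>t\<close>. The upper bound is convex in \<open>t\<close>, because \<open>t coth(\<alpha> t) coth(\<beta> t)\<close> is.
  The lower bound is log-concave, and the condition number \<open>B/A\<close> is log-convex, so each extremum
  exists and is unique as soon as the derivative changes sign. With \<open>\<rho> = arcosh n\<close> the sign change
  happens between \<open>x = \<rho>\<close> and \<open>x = 4 \<rho>\<close>, that is, between \<open>eta n / 2\<close> and \<open>2 * eta n\<close>: both logarithmic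
  derivatives are estimated at these two points, and the signs for \<open>B/A\<close> are differences of the
  others. So the whole interval can serve as \<open>I\<close> for \<open>n \<ge> 2\<close>. For \<open>n = 1\<close> the formula
  gives \<open>A = 0\<close>, and the minimum of \<open>B\<close> is located between \<open>t = 1\<close> and \<open>t = 4\<close>.
\<close>

section \<open>Trigonometric approximation on a period\<close>

abbreviation period_measure :: "real \<Rightarrow> real measure" where
  "period_measure p \<equiv> restrict_space lborel {0..<p}"

definition character :: "real \<Rightarrow> int \<Rightarrow> real \<Rightarrow> complex" where
  "character p l s = cis (2 * pi * of_int l * s / p)"

lemma character_0 [simp]: "character p 0 s = 1"
  by (simp add: character_def)

lemma norm_character [simp]: "cmod (character p l s) = 1"
  by (simp add: character_def)

lemma character_mult: "character p k s * character p l s = character p (k + l) s"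
  by (simp add: character_def cis_mult ring_distribs add_divide_distrib)

lemma cnj_character: "cnj (character p l s) = character p (- l) s"
  by (simp add: character_def cis_cnj)

lemma continuous_on_character [continuous_intros]: "continuous_on A (character p l)"
proof -
  have "continuous_on A (\<lambda>s. exp (\<i> * of_real (2 * pi * of_int l * s / p)))"
    by (cases "p = 0") (auto intro!: continuous_intros)
  then show ?thesis
    unfolding character_def cis_conv_exp by (simp add: fun_eq_iff)
qed

lemma character_measurable [measurable]: "character p l \<in> borel_measurable borel"
  by (intro borel_measurable_continuous_onI continuous_intros)

lemma finite_period_measure: "finite_measure (period_measure p)"
  by (rule finite_measureI) (cases "p \<ge> 0"; simp add: space_restrict_space emeasure_restrict_space)

lemma integrable_period_measure:
  fixes f :: "real \<Rightarrow> 'b :: {banach, second_countable_topology}"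
  assumes "f \<in> borel_measurable borel" "\<And>s. norm (f s) \<le> K"
  shows "integrable (period_measure p) f"
  by (rule finite_measure.integrable_const_bound[OF finite_period_measure, of _ K])
    (use assms in \<open>auto intro: measurable_restrict_space1\<close>)

lemma integral_character:
  assumes "p > 0"
  shows "(LINT s|period_measure p. character p l s) = (if l = 0 then of_real p else 0)"
proof (cases "l = 0")
  case True
  then show ?thesis
    using assms by (simp add: measure_restrict_space space_restrict_space scaleR_conv_of_real)
next
  case False
  define c where "c = 2 * pi * of_int l / p"
  have c: "c \<noteq> 0" using False assms by (simp add: c_def)
  define F where "F = (\<lambda>s::real. exp (\<i> * of_real (c * s)) / (\<i> * of_real c))"
  have ch: "character p l s = exp (\<i> * of_real (c * s))" for s
    by (simp add: character_def c_def cis_conv_exp mult_ac)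
  have "(LINT s|period_measure p. character p l s) = (LINT s|lborel. indicator {0..<p} s *\<^sub>R character p l s)"
    by (rule integral_restrict_space) auto
  also have "\<dots> = (LINT s|lborel. indicator {0..p} s *\<^sub>R character p l s)"
  proof (rule integral_cong_AE)
    show "AE s in lborel. indicator {0..<p} s *\<^sub>R character p l s = indicator {0..p} s *\<^sub>R character p l s"
      by (rule AE_mp[OF AE_lborel_singleton[of p]]) (auto simp: indicator_def)
  qed auto
  also have "\<dots> = F p - F 0"
  proof (rule integral_FTC_Icc)
    fix x assume "0 \<le> x" "x \<le> p"
    have "((\<lambda>z. exp (\<i> * of_real c * z) / (\<i> * of_real c)) has_field_derivative exp (\<i> * of_real c * of_real x)) (at (of_real x))"
      using c by (auto intro!: derivative_eq_intros)
    from has_vector_derivative_real_field[OF this]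
    show "(F has_vector_derivative character p l x) (at x within {0..p})"
      by (simp add: F_def ch mult_ac)
  qed (use assms in \<open>auto intro: continuous_intros\<close>)
  also have "F p = F 0"
    using assms ch[of p]  by (simp add: F_def c_def character_def) (simp add: cis_conv_exp[symmetric] mult_ac)
  finally show ?thesis using False by simp
qed

text \<open>
  The inductive form makes closure under products, which the Stone--Weierstrass argument needs, a
  matter of two short inductions.
\<close>

inductive trig_poly :: "real \<Rightarrow> (real \<Rightarrow> complex) \<Rightarrow> bool" for p where
  "trig_poly p (\<lambda>s. c * character p l s)"
| "trig_poly p f \<Longrightarrow> trig_poly p g \<Longrightarrow> trig_poly p (\<lambda>s. f s + g s)"

lemma trig_poly_expansion:
  assumes "trig_poly p f"
  shows "\<exists>L a. finite L \<and> f = (\<lambda>s. \<Sum>l\<in>L. a l * character p l s)"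
  using assms
proof induction
  case (1 c l)
  show ?case by (rule exI[of _ "{l}"], rule exI[of _ "\<lambda>_. c"]) simp
next
  case (2 f g)
  then obtain L a L' a' where *: "finite L" "f = (\<lambda>s. \<Sum>l\<in>L. a l * character p l s)"
    "finite L'" "g = (\<lambda>s. \<Sum>l\<in>L'. a' l * character p l s)" by blast
  have "f s + g s = (\<Sum>l\<in>L \<union> L'. ((if l \<in> L then a l else 0) + (if l \<in> L' then a' l else 0)) * character p l s)" for s
  proof -
    have "f s = (\<Sum>l\<in>L \<union> L'. (if l \<in> L then a l else 0) * character p l s)"
      unfolding * by (rule sum.mono_neutral_cong_left) (use * in auto)
    moreover have "g s = (\<Sum>l\<in>L \<union> L'. (if l \<in> L' then a' l else 0) * character p l s)"
      unfolding * by (rule sum.mono_neutral_cong_left) (use * in auto)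
    ultimately show ?thesis by (simp add: sum.distrib ring_distribs)
  qed
  then show ?case using * by (intro exI[of _ "L \<union> L'"]) (auto simp: fun_eq_iff)
qed

lemma trig_poly_const: "trig_poly p (\<lambda>s. c)"
  using trig_poly.intros(1)[of p c 0] by simp

lemma trig_poly_mult_char: "trig_poly p f \<Longrightarrow> trig_poly p (\<lambda>s. c * character p l s * f s)"
proof (induction rule: trig_poly.induct)
  case (1 d k)
  have "(\<lambda>s. c * character p l s * (d * character p k s)) = (\<lambda>s. (c * d) * character p (l + k) s)"
    by (simp add: character_mult[symmetric] fun_eq_iff)
  then show ?case using trig_poly.intros(1) by metis
next
  case (2 f g)
  then show ?case by (simp add: distrib_left trig_poly.intros(2))
qed

lemma trig_poly_mult: "trig_poly p f \<Longrightarrow> trig_poly p g \<Longrightarrow> trig_poly p (\<lambda>s. f s * g s)"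
proof (induction rule: trig_poly.induct)
  case (1 d k)
  then show ?case by (rule trig_poly_mult_char)
next
  case (2 f g)
  then show ?case by (simp add: distrib_right trig_poly.intros(2))
qed

lemma trig_poly_real_polynomial:
  fixes h :: "complex \<Rightarrow> real"
  assumes "real_polynomial_function h"
  shows "trig_poly p (\<lambda>s. of_real (h (character p 1 s)))"
  using assms
proof (induction rule: real_polynomial_function.induct)
  case (linear f)
  define u v where "u = complex_of_real (f 1)" and "v = complex_of_real (f \<i>)"
  have lin: "f z = Re z * f 1 + Im z * f \<i>" for z
  proof -
    have "f z = f (Re z *\<^sub>R 1 + Im z *\<^sub>R \<i>)"
      by (rule arg_cong[of _ _ f]) (simp add: complex_eq_iff)
    then show ?thesis using linear
      by (simp add: linear_add linear_scale bounded_linear.linear)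
  qed
  have re: "complex_of_real (Re z) = (z + cnj z) / 2" for z
    by (simp add: complex_eq_iff)
  have im: "complex_of_real (Im z) = (z - cnj z) / (2 * \<i>)" for z
    by (simp add: complex_eq_iff Re_divide Im_divide)
  have "(\<lambda>s. of_real (f (character p 1 s))) =
    (\<lambda>s. (u / 2 + v / (2 * \<i>)) * character p 1 s + (u / 2 - v / (2 * \<i>)) * character p (-1) s)"
    by (rule ext) (subst lin, simp add: re im u_def v_def cnj_character field_simps)
  then show ?case by (auto intro!: trig_poly.intros)
next
  case (const c)
  then show ?case by (rule trig_poly_const)
next
  case (add f g)
  then show ?case by (simp add: trig_poly.intros(2))
next
  case (mult f g)
  then show ?case by (simp add: trig_poly_mult)
qed

text \<open>
  On the unit circle every real polynomial in \<open>Re z\<close> and \<open>Im z\<close> is a trigonometric polynomial, because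
  \<open>cnj z\<close> is the character of index \<open>-1\<close> there. So the Stone--Weierstrass theorem for polynomial
  functions on the circle applies.
\<close>

lemma trig_poly_dense_continuous:
  assumes "continuous_on (sphere 0 1) G" "e > 0"
  shows "\<exists>f. trig_poly p f \<and> (\<forall>s. cmod (G (character p 1 s) - f s) < e)"
proof -
  obtain h where h: "polynomial_function h" "\<And>z. z \<in> sphere 0 1 \<Longrightarrow> norm (G z - h z) < e"
    using Stone_Weierstrass_polynomial_function[OF compact_sphere assms] by metis
  have "real_polynomial_function (\<lambda>z. Re (h z))" "real_polynomial_function (\<lambda>z. Im (h z))"
    using h(1) bounded_linear_Re bounded_linear_Im unfolding polynomial_function_def o_def by blast+
  note tp = this[THEN trig_poly_real_polynomial[of _ p]]
  have "(\<lambda>s. h (character p 1 s)) =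
    (\<lambda>s. of_real (Re (h (character p 1 s))) + \<i> * of_real (Im (h (character p 1 s))))"
    by (rule ext) (rule complex_eq)
  then have "trig_poly p (\<lambda>s. h (character p 1 s))"
    using trig_poly.intros(2)[OF tp(1) trig_poly_mult[OF trig_poly_const[of p \<i>] tp(2)]] by simp
  then show ?thesis using h(2) by (intro exI conjI) auto
qed

lemma trig_poly_bounded: "trig_poly p f \<Longrightarrow> \<exists>K. \<forall>s. cmod (f s) \<le> K"
proof (induction rule: trig_poly.induct)
  case (1 c l)
  then show ?case by (intro exI[of _ "cmod c"]) (simp add: norm_mult)
next
  case (2 f g)
  then obtain K K' where "\<And>s. cmod (f s) \<le> K" "\<And>s. cmod (g s) \<le> K'" by blast
  then show ?case by (intro exI[of _ "K + K'"]) (blast intro: norm_triangle_mono)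
qed

lemma trig_poly_measurable: "trig_poly p f \<Longrightarrow> f \<in> borel_measurable borel"
  by (induction rule: trig_poly.induct) auto

lemma Arg2pi_character:
  assumes "p > 0" "s \<in> {0..<p}"
  shows "p * Arg2pi (character p 1 s) / (2 * pi) = s"
proof -
  have "Arg2pi (character p 1 s) = 2 * pi * s / p"
    by (rule Arg2pi_unique[of 1]) (use assms in \<open>auto simp: character_def cis_conv_exp field_simps\<close>)
  then show ?thesis using assms by simp
qed

lemma integrable_norm_square_period:
  assumes "f \<in> borel_measurable borel" "\<And>s. cmod (f s) \<le> K"
  shows "integrable (period_measure p) (\<lambda>s. (cmod (f s))\<^sup>2)"
  by (rule integrable_period_measure[of _ "K\<^sup>2"]) (use assms in \<open>auto intro: power_mono\<close>)

text \<open>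
  A measurable function is an almost everywhere limit of continuous functions. Clamping these to a
  disc and multiplying by a cutoff that vanishes where the period closes up makes them bounded
  continuous functions on the circle; dominated convergence turns the pointwise limit into one in the
  mean square, and \<open>trig_poly_dense_continuous\<close> does the rest.
\<close>

lemma trig_poly_dense:
  assumes p: "p > 0" and P: "P \<in> borel_measurable borel" "\<And>s. cmod (P s) \<le> K" and e: "e > 0"
  shows "\<exists>f. trig_poly p f \<and> (LINT s|period_measure p. (cmod (P s - f s))\<^sup>2) < e"
proof -
  define K' where "K' = max K 1"
  have K': "K' > 0" "\<And>s. cmod (P s) \<le> K'" using P(2) by (auto simp: K'_def le_max_iff_disj)
  have "P \<in> borel_measurable lebesgue"
    using P(1) by (simp add: measurable_completion)
  then have "P measurable_on UNIV"
    by (simp add: measurable_on_iff_borel_measurable)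
  then obtain N g where N: "negligible N" and g: "\<And>n. continuous_on UNIV (g n)"
      "\<And>x. x \<notin> N \<Longrightarrow> (\<lambda>n. g n x) \<longlonglongrightarrow> P x"
    unfolding measurable_on_def by auto
  \<comment> \<open>the radial retraction onto the disc of radius \<open>K'\<close>; it does not move the values of \<open>P\<close>\<close>
  define clamp where "clamp = (\<lambda>w::complex. (K' / max K' (cmod w)) *\<^sub>R w)"
  have cclamp: "continuous_on A clamp" for A
    unfolding clamp_def using K'(1) by (intro continuous_intros) auto
  have clamp_le: "cmod (clamp w) \<le> K'" for w
    using K'(1) by (simp add: clamp_def field_simps)
  have clamp_id: "cmod w \<le> K' \<Longrightarrow> clamp w = w" for w
    using K'(1) by (simp add: clamp_def)
  define cut where "cut = (\<lambda>(n::nat) (z::complex). min 1 (real n * cmod (z - 1)))"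
  \<comment> \<open>\<open>H n\<close> lives on the circle, \<open>h n\<close> is the same function of the parameter \<open>s\<close>\<close>
  define H where "H = (\<lambda>n z. cut n z *\<^sub>R clamp (g n (p * Arg2pi z / (2 * pi))))"
  define h where "h = (\<lambda>n s. cut n (character p 1 s) *\<^sub>R clamp (g n s))"
  have Hh: "H n (character p 1 s) = h n s" if "s \<in> {0..<p}" for n s
    using Arg2pi_character[OF p that] by (simp add: H_def h_def)
  have ccut: "continuous_on A (cut n)" for A n
    unfolding cut_def by (intro continuous_intros)
  have cut_le: "0 \<le> cut n z" "cut n z \<le> 1" for n z by (auto simp: cut_def)
  have ch: "continuous_on UNIV (h n)" for n
    unfolding h_def
    by (intro continuous_intros continuous_on_compose2[OF ccut[of UNIV]] continuous_on_compose2[OF cclamp[of UNIV]] g(1)) auto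
  then have mh[measurable]: "h n \<in> borel_measurable borel" for n
    by (simp add: borel_measurable_continuous_onI)
  have H_le: "cmod (H n z) \<le> cut n z * K'" for n z
    unfolding H_def using clamp_le cut_le by (auto intro!: mult_mono)
  have h_le: "cmod (h n s) \<le> K'" for n s
  proof -
    have "cmod (h n s) \<le> 1 * K'"
      unfolding h_def norm_scaleR using clamp_le cut_le by (intro mult_mono) auto
    then show ?thesis by simp
  qed
  have cH: "continuous_on (sphere 0 1) (H n)" for n
    unfolding continuous_on_eq_continuous_within
  proof
    fix z :: complex assume z: "z \<in> sphere 0 1"
    show "continuous (at z within sphere 0 1) (H n)"
    proof (cases "z = 1")
      case True
      have "(cut n \<longlongrightarrow> cut n 1) (at 1)"
        using ccut[of UNIV n] by (simp add: continuous_on_def)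
      then have "((\<lambda>z. cut n z * K') \<longlongrightarrow> cut n 1 * K') (at 1)"
        by (intro tendsto_intros)
      then have l: "((\<lambda>z. cut n z * K') \<longlongrightarrow> 0) (at 1)" by (simp add: cut_def)
      have "(H n \<longlongrightarrow> 0) (at 1)"
        by (rule tendsto_norm_zero_cancel, rule real_tendsto_sandwich[OF _ _ tendsto_const l])
          (use H_le in auto)
      moreover have "H n 1 = 0" by (simp add: H_def cut_def)
      ultimately have "continuous (at 1) (H n)" by (simp add: continuous_at)
      then show ?thesis using True continuous_at_imp_continuous_within by blast
    next
      case False
      have "z \<notin> \<real>\<^sub>\<ge>\<^sub>0" using False z by (auto simp: nonneg_Reals_def)
      then have "isCont Arg2pi z" by (rule continuous_at_Arg2pi)
      then have "isCont (\<lambda>z. p * Arg2pi z / (2 * pi)) z" by (intro continuous_intros) auto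
      moreover have "isCont (g n) x" for x
        using g(1)[of n] by (auto simp: continuous_on_eq_continuous_at)
      ultimately have "isCont (\<lambda>z. g n (p * Arg2pi z / (2 * pi))) z"
        by (rule isCont_o2)
      moreover have "isCont clamp w" for w
        using cclamp[of UNIV] by (auto simp: continuous_on_eq_continuous_at)
      ultimately have "isCont (\<lambda>z. clamp (g n (p * Arg2pi z / (2 * pi)))) z"
        by (rule isCont_o2)
      moreover have "isCont (cut n) z"
        using ccut[of UNIV n] by (auto simp: continuous_on_eq_continuous_at)
      ultimately have "isCont (H n) z"
        unfolding H_def by (intro continuous_intros)
      then show ?thesis by (rule continuous_at_imp_continuous_within)
    qed
  qed
  have "(\<lambda>n. LINT s|period_measure p. (cmod (P s - h n s))\<^sup>2) \<longlonglongrightarrow> (LINT s|period_measure p. 0)"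
  proof (rule integral_dominated_convergence[where w="\<lambda>_. (2 * K')\<^sup>2"])
    show "AE s in period_measure p. (\<lambda>n. (cmod (P s - h n s))\<^sup>2) \<longlonglongrightarrow> 0"
    proof -
      have "AE s in lebesgue. s \<notin> N \<union> {0}"
        using N by (intro AE_not_in) (simp add: negligible_iff_null_sets)
      then have ae: "AE s in lborel. s \<notin> N \<union> {0}" by (simp add: AE_completion_iff)
      have lim: "(\<lambda>n. (cmod (P s - h n s))\<^sup>2) \<longlonglongrightarrow> 0" if s: "s \<notin> N \<union> {0}" "s \<in> {0..<p}" for s
      proof -
        have "character p 1 s \<noteq> 1"
        proof
          assume "character p 1 s = 1"
          then have "Arg2pi (character p 1 s) = 0" by (simp add: Arg2pi_of_real[of 1, simplified])
          then show False using Arg2pi_character[OF p s(2)] s by simp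
        qed
        then have d: "cmod (character p 1 s - 1) > 0" by simp
        have "filterlim (\<lambda>n. cmod (character p 1 s - 1) * real n) at_top sequentially"
          by (rule filterlim_tendsto_pos_mult_at_top[OF tendsto_const d filterlim_real_sequentially])
        then have "eventually (\<lambda>n. 1 \<le> cmod (character p 1 s - 1) * real n) sequentially"
          by (simp add: filterlim_at_top)
        then have "eventually (\<lambda>n. cut n (character p 1 s) = 1) sequentially"
          by eventually_elim (simp add: cut_def mult.commute)
        then have 1: "(\<lambda>n. cut n (character p 1 s)) \<longlonglongrightarrow> 1" by (simp add: tendsto_eventually)
        have cl: "isCont clamp (P s)" using cclamp[of UNIV] by (auto simp: continuous_on_eq_continuous_at)
        have "(\<lambda>n. g n s) \<longlonglongrightarrow> P s" using g(2)[of s] s by blast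
        then have clg: "(\<lambda>n. clamp (g n s)) \<longlonglongrightarrow> clamp (P s)"
          by (rule isCont_tendsto_compose[OF cl])
        have "(\<lambda>n. h n s) \<longlonglongrightarrow> 1 *\<^sub>R P s"
          unfolding h_def using tendsto_scaleR[OF 1 clg] clamp_id[OF K'(2)] by simp
        then have "(\<lambda>n. (cmod (P s - h n s))\<^sup>2) \<longlonglongrightarrow> (cmod (P s - 1 *\<^sub>R P s))\<^sup>2"
          by (intro tendsto_intros)
        then show ?thesis by simp
      qed
      have "AE s in lborel. s \<in> {0..<p} \<longrightarrow> (\<lambda>n. (cmod (P s - h n s))\<^sup>2) \<longlonglongrightarrow> 0"
        using ae by (rule eventually_mono) (use lim in blast)
      then show ?thesis by (subst AE_restrict_space_iff) simp_all
    qed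
    show "AE s in period_measure p. norm ((cmod (P s - h n s))\<^sup>2) \<le> (2 * K')\<^sup>2" for n
    proof (rule AE_I2)
      fix s
      have "cmod (P s - h n s) \<le> K' + K'"
        using norm_triangle_ineq4[of "P s" "h n s"] K'(2)[of s] h_le[of n s] by linarith
      then have "(cmod (P s - h n s))\<^sup>2 \<le> (2 * K')\<^sup>2" by (intro power_mono) auto
      then show "norm ((cmod (P s - h n s))\<^sup>2) \<le> (2 * K')\<^sup>2" by simp
    qed
    show "integrable (period_measure p) (\<lambda>_. (2 * K')\<^sup>2)"
      by (rule integrable_period_measure) auto
    note [measurable] = P(1)
    show "(\<lambda>s. (cmod (P s - h n s))\<^sup>2) \<in> borel_measurable (period_measure p)" for n
      by (rule measurable_restrict_space1) measurable
  qed auto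
  then have "(\<lambda>n. LINT s|period_measure p. (cmod (P s - h n s))\<^sup>2) \<longlonglongrightarrow> 0" by simp
  from order_tendstoD(2)[OF this, of "e / 4"] e obtain n where
    n: "(LINT s|period_measure p. (cmod (P s - h n s))\<^sup>2) < e / 4"
    by (auto simp: eventually_sequentially)
  define d where "d = sqrt (e / (8 * p))"
  have d: "d > 0" "d\<^sup>2 = e / (8 * p)" using e p by (auto simp: d_def)
  obtain f where f: "trig_poly p f" "\<And>s. cmod (H n (character p 1 s) - f s) < d"
    using trig_poly_dense_continuous[OF cH d(1)] by metis
  obtain Kf where Kf: "\<And>s. cmod (f s) \<le> Kf" using trig_poly_bounded[OF f(1)] by blast
  note [measurable] = P(1) trig_poly_measurable[OF f(1)]
  have int1: "integrable (period_measure p) (\<lambda>s. (cmod (P s - h n s))\<^sup>2)"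
  proof (rule integrable_norm_square_period)
    show "cmod (P s - h n s) \<le> K' + K'" for s
      by (rule order_trans[OF norm_triangle_ineq4 add_mono[OF K'(2) h_le]])
  qed measurable
  have int2: "integrable (period_measure p) (\<lambda>s. (cmod (P s - f s))\<^sup>2)"
  proof (rule integrable_norm_square_period)
    show "cmod (P s - f s) \<le> K' + Kf" for s
      by (rule order_trans[OF norm_triangle_ineq4 add_mono[OF K'(2) Kf]])
  qed measurable
  have "(LINT s|period_measure p. (cmod (P s - f s))\<^sup>2) \<le> (LINT s|period_measure p. 2 * (cmod (P s - h n s))\<^sup>2 + 2 * d\<^sup>2)"
  proof (rule integral_mono)
    fix s assume "s \<in> space (period_measure p)"
    then have "cmod (h n s - f s) < d" using f(2)[of s] Hh[of s n] by (simp add: space_restrict_space)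
    then have "cmod (P s - f s) \<le> cmod (P s - h n s) + d"
      using norm_triangle_ineq[of "P s - h n s" "h n s - f s"] by simp
    then have "(cmod (P s - f s))\<^sup>2 \<le> (cmod (P s - h n s) + d)\<^sup>2" by (simp add: power_mono)
    also have "\<dots> \<le> 2 * (cmod (P s - h n s))\<^sup>2 + 2 * d\<^sup>2"
      using sum_squares_bound[of "cmod (P s - h n s)" d] by (simp add: power2_sum)
    finally show "(cmod (P s - f s))\<^sup>2 \<le> 2 * (cmod (P s - h n s))\<^sup>2 + 2 * d\<^sup>2" .
  qed (use int1 int2 integrable_period_measure[of "\<lambda>_. 2 * d\<^sup>2" "2 * d\<^sup>2"] in auto)
  also have "\<dots> = 2 * (LINT s|period_measure p. (cmod (P s - h n s))\<^sup>2) + 2 * d\<^sup>2 * p"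
    using int1 integrable_period_measure[of "\<lambda>_. 2 * d\<^sup>2" "2 * d\<^sup>2" p] p
    by (subst Bochner_Integration.integral_add) (auto simp: measure_restrict_space space_restrict_space)
  also have "\<dots> = 2 * (LINT s|period_measure p. (cmod (P s - h n s))\<^sup>2) + e / 4"
    using d(2) p by simp
  also have "\<dots> < e" using n e by linarith
  finally show ?thesis using f(1) by blast
qed

section \<open>Parseval's identity\<close>

lemma borel_measurable_cnj [measurable]:
  "f \<in> borel_measurable M \<Longrightarrow> (\<lambda>x. cnj (f x)) \<in> borel_measurable M"
  by (rule borel_measurable_continuous_on[of cnj]) (intro continuous_intros)

text \<open>
  Completing the square shows at once that the Fourier coefficients are the best choice, which is
  Bessel's inequality, and how much is lost by any other choice.
\<close>

lemma mean_square_deviation_trig: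
  assumes p: "p > 0" and P: "P \<in> borel_measurable borel" "\<And>s. cmod (P s) \<le> K" and L: "finite L"
  defines "c \<equiv> \<lambda>l. LINT s|period_measure p. P s * character p (- l) s"
  shows "(LINT s|period_measure p. (cmod (P s - (\<Sum>l\<in>L. a l * character p l s)))\<^sup>2) =
    (LINT s|period_measure p. (cmod (P s))\<^sup>2) - (\<Sum>l\<in>L. (cmod (c l))\<^sup>2) / p
      + p * (\<Sum>l\<in>L. (cmod (a l - c l / p))\<^sup>2)" (is "?lhs = ?rhs")
proof -
  let ?M = "period_measure p"
  note [measurable] = P(1)
  have intP: "integrable ?M (\<lambda>s. P s * cnj (P s))"
  proof (rule integrable_period_measure[of _ "K * K"])
    show "cmod (P s * cnj (P s)) \<le> K * K" for s
      unfolding norm_mult complex_mod_cnj using P(2)[of s] order_trans[OF norm_ge_zero P(2)[of 0]]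
      by (intro mult_mono) auto
    show "(\<lambda>s. P s * cnj (P s)) \<in> borel_measurable borel" by measurable
  qed
  have intc: "integrable ?M (\<lambda>s. P s * character p k s)" for k
    using integrable_period_measure[of "\<lambda>s. P s * character p k s" K] P by (auto simp: norm_mult)
  have intc': "integrable ?M (\<lambda>s. cnj (P s) * character p k s)" for k
    using integrable_period_measure[of "\<lambda>s. cnj (P s) * character p k s" K] P by (auto simp: norm_mult)
  have inte: "integrable ?M (character p k)" for k
    using integrable_period_measure[of "character p k" 1] by auto
  have cl: "(LINT s|?M. P s * character p (- l) s) = c l" for l
    by (simp add: c_def)
  have cc: "(LINT s|?M. cnj (P s) * character p l s) = cnj (c l)" for l
  proof -
    have "(LINT s|?M. cnj (P s) * character p l s) = (LINT s|?M. cnj (P s * character p (- l) s))"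
      by (simp add: cnj_character)
    also have "\<dots> = cnj (c l)" unfolding c_def by (rule integral_bounded_linear[OF bounded_linear_cnj intc])
    finally show ?thesis .
  qed
  have "complex_of_real ?lhs = (LINT s|?M. complex_of_real ((cmod (P s - (\<Sum>l\<in>L. a l * character p l s)))\<^sup>2))"
    by (rule integral_complex_of_real[symmetric])
  also have "\<dots> = (LINT s|?M. P s * cnj (P s) - (\<Sum>l\<in>L. cnj (a l) * (P s * character p (- l) s))
      - (\<Sum>l\<in>L. a l * (cnj (P s) * character p l s)) + (\<Sum>l\<in>L. \<Sum>k\<in>L. a l * cnj (a k) * character p (l - k) s))"
  proof (rule Bochner_Integration.integral_cong[OF refl])
    fix s
    have "(\<Sum>l\<in>L. a l * character p l s) * (\<Sum>k\<in>L. cnj (a k) * character p (- k) s) =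
      (\<Sum>l\<in>L. \<Sum>k\<in>L. a l * cnj (a k) * character p (l - k) s)"
      unfolding sum_product using character_mult[of p _ s "- k" for k]
      by (intro sum.cong refl) (simp add: mult_ac)
    then show "complex_of_real ((cmod (P s - (\<Sum>l\<in>L. a l * character p l s)))\<^sup>2) =
      P s * cnj (P s) - (\<Sum>l\<in>L. cnj (a l) * (P s * character p (- l) s))
      - (\<Sum>l\<in>L. a l * (cnj (P s) * character p l s)) + (\<Sum>l\<in>L. \<Sum>k\<in>L. a l * cnj (a k) * character p (l - k) s)"
      unfolding complex_norm_square
      by (simp add: cnj_character algebra_simps sum_distrib_left)
  qed
  also have "\<dots> = (LINT s|?M. P s * cnj (P s)) - (\<Sum>l\<in>L. cnj (a l) * c l) - (\<Sum>l\<in>L. a l * cnj (c l))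
      + (\<Sum>l\<in>L. \<Sum>k\<in>L. a l * cnj (a k) * (if l = k then of_real p else 0))"
    using intP intc intc' inte integral_character[OF p] cc cl
    by (simp add: integral_sum')
  also have "(\<Sum>l\<in>L. \<Sum>k\<in>L. a l * cnj (a k) * (if l = k then of_real p else 0)) = of_real p * (\<Sum>l\<in>L. a l * cnj (a l))"
    using L by (simp add: if_distrib[of "\<lambda>x. _ * x"] sum.delta sum_distrib_left mult_ac cong: if_cong)
  also have "(LINT s|?M. P s * cnj (P s)) = of_real (LINT s|?M. (cmod (P s))\<^sup>2)"
    unfolding integral_complex_of_real[symmetric] complex_norm_square ..
  also have "of_real (LINT s|?M. (cmod (P s))\<^sup>2) - (\<Sum>l\<in>L. cnj (a l) * c l) - (\<Sum>l\<in>L. a l * cnj (c l))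
      + of_real p * (\<Sum>l\<in>L. a l * cnj (a l)) = complex_of_real ?rhs"
  proof -
    have "p * (a l * cnj (a l)) - cnj (a l) * c l - a l * cnj (c l) =
      p * ((a l - c l / p) * cnj (a l - c l / p)) - c l * cnj (c l) / p" for l
    proof -
      have "complex_of_real p \<noteq> 0" using p by simp
      moreover have "P \<noteq> 0 \<Longrightarrow> P * (A * A') - A' * C - A * C' = P * ((A - C / P) * (A' - C' / P)) - C * C' / P"
        for P A A' C C' :: complex by (simp add: field_simps)
      ultimately show ?thesis by simp
    qed
    then have "(\<Sum>l\<in>L. p * (a l * cnj (a l)) - cnj (a l) * c l - a l * cnj (c l)) =
      (\<Sum>l\<in>L. p * ((a l - c l / p) * cnj (a l - c l / p)) - c l * cnj (c l) / p)"
      by (intro sum.cong refl)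
    then show ?thesis
      unfolding of_real_add of_real_diff of_real_mult of_real_divide of_real_sum complex_norm_square
        sum_subtractf sum_distrib_left[symmetric] sum_divide_distrib[symmetric]
      by (simp add: algebra_simps)
  qed
  finally show ?thesis by (simp only: of_real_eq_iff)
qed

text \<open>
  Bessel's inequality is one half. For the other half, a trigonometric polynomial that is close to
  \<open>P\<close> in the mean square leaves no room between the norm of \<open>P\<close> and its largest partial sums.
\<close>

theorem parseval_bounded:
  assumes p: "p > 0" and P: "P \<in> borel_measurable borel" "\<And>s. cmod (P s) \<le> K"
  defines "c \<equiv> \<lambda>l. LINT s|period_measure p. P s * character p (- l) s"
  shows "(\<Sum>\<^sub>\<infinity>l. ennreal ((cmod (c l))\<^sup>2)) = ennreal (p * (LINT s|period_measure p. (cmod (P s))\<^sup>2))"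
proof -
  let ?n = "LINT s|period_measure p. (cmod (P s))\<^sup>2"
  have dev: "(LINT s|period_measure p. (cmod (P s - (\<Sum>l\<in>L. a l * character p l s)))\<^sup>2) =
    ?n - (\<Sum>l\<in>L. (cmod (c l))\<^sup>2) / p + p * (\<Sum>l\<in>L. (cmod (a l - c l / p))\<^sup>2)" if "finite L" for L a
    unfolding c_def by (rule mean_square_deviation_trig[OF p P that])
  have "(\<Sum>\<^sub>\<infinity>l. ennreal ((cmod (c l))\<^sup>2)) = (SUP L\<in>{L. finite L \<and> L \<subseteq> UNIV}. \<Sum>l\<in>L. ennreal ((cmod (c l))\<^sup>2))"
    by (rule nonneg_infsum_complete) simp
  also have "\<dots> = ennreal (p * ?n)"
  proof (rule antisym)
    show "(SUP L\<in>{L. finite L \<and> L \<subseteq> UNIV}. \<Sum>l\<in>L. ennreal ((cmod (c l))\<^sup>2)) \<le> ennreal (p * ?n)"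
    proof (rule SUP_least)
      fix L :: "int set" assume "L \<in> {L. finite L \<and> L \<subseteq> UNIV}"
      then have L: "finite L" by simp
      have "0 \<le> (LINT s|period_measure p. (cmod (P s - (\<Sum>l\<in>L. c l / p * character p l s)))\<^sup>2)"
        by (rule integral_nonneg_AE) auto
      then have "0 \<le> ?n - (\<Sum>l\<in>L. (cmod (c l))\<^sup>2) / p"
        unfolding dev[OF L] by simp
      then have "(\<Sum>l\<in>L. (cmod (c l))\<^sup>2) \<le> p * ?n"
        using p by (simp add: field_simps)
      then show "(\<Sum>l\<in>L. ennreal ((cmod (c l))\<^sup>2)) \<le> ennreal (p * ?n)"
        by (simp add: ennreal_leI sum_ennreal)
    qed
    show "ennreal (p * ?n) \<le> (SUP L\<in>{L. finite L \<and> L \<subseteq> UNIV}. \<Sum>l\<in>L. ennreal ((cmod (c l))\<^sup>2))"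
    proof (rule ennreal_le_epsilon)
      fix e :: real assume e: "e > 0"
      then have "e / p > 0" using p by simp
      from trig_poly_dense[OF p P this] obtain f where
        f: "trig_poly p f" "(LINT s|period_measure p. (cmod (P s - f s))\<^sup>2) < e / p" by blast
      from trig_poly_expansion[OF f(1)] obtain L a where
        L: "finite L" and fe: "f = (\<lambda>s. \<Sum>l\<in>L. a l * character p l s)" by blast
      have "?n - (\<Sum>l\<in>L. (cmod (c l))\<^sup>2) / p < e / p - p * (\<Sum>l\<in>L. (cmod (a l - c l / p))\<^sup>2)"
        using f(2) unfolding fe dev[OF L] by simp
      also have "\<dots> \<le> e / p" using p by (simp add: sum_nonneg)
      finally have "?n \<le> ((\<Sum>l\<in>L. (cmod (c l))\<^sup>2) + e) / p"
        by (simp add: add_divide_distrib)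
      then have "p * ?n \<le> (\<Sum>l\<in>L. (cmod (c l))\<^sup>2) + e"
        using p by (simp add: pos_le_divide_eq mult.commute)
      then have "ennreal (p * ?n) \<le> (\<Sum>l\<in>L. ennreal ((cmod (c l))\<^sup>2)) + ennreal e"
        using e by (simp add: ennreal_leI sum_ennreal sum_nonneg flip: ennreal_plus)
      also have "\<dots> \<le> (SUP L\<in>{L. finite L \<and> L \<subseteq> UNIV}. \<Sum>l\<in>L. ennreal ((cmod (c l))\<^sup>2)) + ennreal e"
        by (intro add_right_mono SUP_upper) (use L in simp)
      finally show "ennreal (p * ?n) \<le> (SUP L\<in>{L. finite L \<and> L \<subseteq> UNIV}. \<Sum>l\<in>L. ennreal ((cmod (c l))\<^sup>2)) + ennreal e" .
    qed
  qed
  finally show ?thesis .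
qed

section \<open>Square-summable sequences and the exponential kernel\<close>

lemma infsum_ennreal_has_sum:
  assumes "(f has_sum x) A" "\<And>k. k \<in> A \<Longrightarrow> f k \<ge> 0"
  shows "(\<Sum>\<^sub>\<infinity>k\<in>A. ennreal (f k)) = ennreal x"
proof -
  have "f summable_on A" "infsum f A = x" using assms(1) by (auto simp: infsumI has_sum_imp_summable)
  then have "ennreal x = (SUP F\<in>{F. finite F \<and> F \<subseteq> A}. ennreal (sum f F))"
    using infsum_nonneg_is_SUPREMUM_ennreal[of f A] assms(2) by simp
  also have "\<dots> = (SUP F\<in>{F. finite F \<and> F \<subseteq> A}. (\<Sum>k\<in>F. ennreal (f k)))"
    by (intro SUP_cong refl) (use assms(2) in \<open>auto simp: sum_ennreal subset_iff\<close>)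
  also have "\<dots> = (\<Sum>\<^sub>\<infinity>k\<in>A. ennreal (f k))"
    by (subst nonneg_infsum_complete) auto
  finally show ?thesis ..
qed

lemma has_sum_int_shift:
  fixes f :: "int \<Rightarrow> 'a::{comm_monoid_add,topological_space}"
  shows "((\<lambda>j. f (j + k)) has_sum x) UNIV \<longleftrightarrow> (f has_sum x) UNIV"
proof -
  have "bij (\<lambda>j::int. j + k)" by (rule bij_plus_right)
  from has_sum_reindex_bij_betw[OF this, of f x] show ?thesis by simp
qed

text \<open>
  The numbers \<open>seq_energy\<close>, \<open>seq_corr\<close> and \<open>seq_mean_energy\<close> determine every quadratic form in \<open>e\<close> that
  is needed. In terms of the Fourier series of \<open>e\<close> they are its mean square with the weights \<open>1\<close>,
  \<open>cos \<theta>\<close> and \<open>cos\<^sup>2 \<theta>\<close>.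
\<close>

definition seq_energy :: "(int \<Rightarrow> complex) \<Rightarrow> real" where
  "seq_energy e = (\<Sum>\<^sub>\<infinity>j. (cmod (e j))\<^sup>2)"

definition seq_corr :: "(int \<Rightarrow> complex) \<Rightarrow> real" where
  "seq_corr e = (\<Sum>\<^sub>\<infinity>j. Re (e j * cnj (e (j + 1))))"

definition seq_mean_energy :: "(int \<Rightarrow> complex) \<Rightarrow> real" where
  "seq_mean_energy e = (\<Sum>\<^sub>\<infinity>j. (cmod ((e (j + 1) + e (j - 1)) / 2))\<^sup>2)"

lemma cmod_add_square: "(cmod (u + v))\<^sup>2 = (cmod u)\<^sup>2 + (cmod v)\<^sup>2 + 2 * Re (u * cnj v)"
  unfolding cmod_power2 by (simp add: power2_eq_square algebra_simps)

lemma abs_Re_mult_cnj_le: "\<bar>Re (u * cnj v)\<bar> \<le> ((cmod u)\<^sup>2 + (cmod v)\<^sup>2) / 2"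
proof -
  have "\<bar>Re (u * cnj v)\<bar> \<le> cmod u * cmod v"
    using abs_Re_le_cmod[of "u * cnj v"] by (simp add: norm_mult)
  also have "\<dots> \<le> ((cmod u)\<^sup>2 + (cmod v)\<^sup>2) / 2" using sum_squares_bound[of "cmod u" "cmod v"] by simp
  finally show ?thesis .
qed

context
  fixes e :: "int \<Rightarrow> complex"
  assumes sq: "(\<lambda>j. (cmod (e j))\<^sup>2) summable_on UNIV"
begin

lemma seq_energy_has_sum: "((\<lambda>j. (cmod (e (j + k)))\<^sup>2) has_sum seq_energy e) UNIV"
  using has_sum_int_shift[of "\<lambda>j. (cmod (e j))\<^sup>2" k] has_sum_infsum[OF sq] by (simp add: seq_energy_def)

lemma seq_corr_has_sum: "((\<lambda>j. Re (e j * cnj (e (j + 1)))) has_sum seq_corr e) UNIV"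
proof -
  have "(\<lambda>j. ((cmod (e (j + 0)))\<^sup>2 + (cmod (e (j + 1)))\<^sup>2) / 2) summable_on UNIV"
    using has_sum_cmult_right[OF has_sum_add[OF seq_energy_has_sum[of 0] seq_energy_has_sum[of 1]], of "1/2"]
    by (auto simp: has_sum_imp_summable)
  then have "(\<lambda>j. Re (e j * cnj (e (j + 1)))) summable_on UNIV"
    by (intro abs_summable_summable[of "\<lambda>j. Re (e j * cnj (e (j + 1)))"] summable_on_comparison_test[where g="\<lambda>j. norm (Re (e j * cnj (e (j + 1))))"])
      (use abs_Re_mult_cnj_le in auto)
  then show ?thesis by (simp add: seq_corr_def)
qed

lemma seq_mean_has_sum: "((\<lambda>j. (cmod ((e (j + 1) + e (j - 1)) / 2))\<^sup>2) has_sum seq_mean_energy e) UNIV"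
  and seq_mean_le: "seq_mean_energy e \<le> seq_energy e"
proof -
  have *: "((\<lambda>j. ((cmod (e (j + 1)))\<^sup>2 + (cmod (e (j + (-1))))\<^sup>2) / 2) has_sum (seq_energy e)) UNIV"
    using has_sum_cmult_right[OF has_sum_add[OF seq_energy_has_sum[of 1] seq_energy_has_sum[of "-1"]], of "1/2"]
    by simp
  have le: "(cmod ((u + v) / 2))\<^sup>2 \<le> ((cmod u)\<^sup>2 + (cmod v)\<^sup>2) / 2" for u v
  proof -
    have "(cmod ((u + v) / 2))\<^sup>2 = ((cmod u)\<^sup>2 + (cmod v)\<^sup>2 + 2 * Re (u * cnj v)) / 4"
      by (simp only: norm_divide power_divide cmod_add_square) simp
    moreover have "Re (u * cnj v) \<le> ((cmod u)\<^sup>2 + (cmod v)\<^sup>2) / 2"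
      using abs_Re_mult_cnj_le by (rule order_trans[OF abs_ge_self])
    moreover have "w \<le> A / 2 \<Longrightarrow> (A + 2 * w) / 4 \<le> A / 2" for A w :: real by simp
    ultimately show ?thesis by presburger
  qed
  have "(\<lambda>j. (cmod ((e (j + 1) + e (j - 1)) / 2))\<^sup>2) summable_on UNIV"
    by (rule summable_on_comparison_test[OF has_sum_imp_summable[OF *]]) (use le in auto)
  then show **: "((\<lambda>j. (cmod ((e (j + 1) + e (j - 1)) / 2))\<^sup>2) has_sum seq_mean_energy e) UNIV"
    by (simp add: seq_mean_energy_def)
  show "seq_mean_energy e \<le> seq_energy e"
    by (rule has_sum_mono[OF ** *]) (use le in auto)
qed

lemma seq_two_term_has_sum:
  "((\<lambda>j. (cmod (of_real \<alpha> * e j + of_real \<beta> * e (j + 1)))\<^sup>2) has_sum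
     (\<alpha>\<^sup>2 + \<beta>\<^sup>2) * seq_energy e + 2 * \<alpha> * \<beta> * seq_corr e) UNIV"
proof -
  have "((\<lambda>j. (\<alpha>\<^sup>2 * (cmod (e (j + 0)))\<^sup>2 + \<beta>\<^sup>2 * (cmod (e (j + 1)))\<^sup>2) + 2 * \<alpha> * \<beta> * Re (e j * cnj (e (j + 1))))
     has_sum (\<alpha>\<^sup>2 * seq_energy e + \<beta>\<^sup>2 * seq_energy e) + 2 * \<alpha> * \<beta> * seq_corr e) UNIV"
    by (intro has_sum_add has_sum_cmult_right seq_energy_has_sum seq_corr_has_sum)
  moreover have "(cmod (of_real \<alpha> * e j + of_real \<beta> * e (j + 1)))\<^sup>2 =
    (\<alpha>\<^sup>2 * (cmod (e (j + 0)))\<^sup>2 + \<beta>\<^sup>2 * (cmod (e (j + 1)))\<^sup>2) + 2 * \<alpha> * \<beta> * Re (e j * cnj (e (j + 1)))" for j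
    unfolding cmod_add_square by (simp add: norm_mult power_mult_distrib algebra_simps)
  ultimately show ?thesis by (simp add: distrib_right)
qed

lemma abs_seq_corr_le: "\<bar>seq_corr e\<bar> \<le> seq_energy e"
  using has_sum_nonneg[OF seq_two_term_has_sum[of 1 1]] has_sum_nonneg[OF seq_two_term_has_sum[of 1 "-1"]]
  by auto

lemma seq_difference_has_sum:
  "((\<lambda>j. (cmod (of_real c * e j - (e (j + 1) + e (j - 1)) / 2))\<^sup>2) has_sum
     c\<^sup>2 * seq_energy e - 2 * c * seq_corr e + seq_mean_energy e) UNIV"
proof -
  have "((\<lambda>j. Re (e (j - 1) * cnj (e (j - 1 + 1)))) has_sum seq_corr e) UNIV"
    using seq_corr_has_sum has_sum_int_shift[of "\<lambda>j. Re (e j * cnj (e (j + 1)))" "-1"] by simp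
  then have "((\<lambda>j. c\<^sup>2 * (cmod (e (j + 0)))\<^sup>2 + (- c) * (Re (e j * cnj (e (j + 1))) + Re (e (j - 1) * cnj (e (j - 1 + 1)))) +
       (cmod ((e (j + 1) + e (j - 1)) / 2))\<^sup>2) has_sum
     c\<^sup>2 * seq_energy e + (- c) * (seq_corr e + seq_corr e) + seq_mean_energy e) UNIV"
    by (intro has_sum_add has_sum_cmult_right seq_energy_has_sum seq_corr_has_sum seq_mean_has_sum)
  moreover have "(cmod (of_real c * e j - (e (j + 1) + e (j - 1)) / 2))\<^sup>2 =
    c\<^sup>2 * (cmod (e (j + 0)))\<^sup>2 + (- c) * (Re (e j * cnj (e (j + 1))) + Re (e (j - 1) * cnj (e (j - 1 + 1)))) +
       (cmod ((e (j + 1) + e (j - 1)) / 2))\<^sup>2" for j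
    using cmod_add_square[of "of_real c * e j" "- ((e (j + 1) + e (j - 1)) / 2)"]
    by (simp add: norm_mult power_mult_distrib algebra_simps) (simp add: field_simps norm_minus_commute)
  ultimately have "((\<lambda>j. (cmod (of_real c * e j - (e (j + 1) + e (j - 1)) / 2))\<^sup>2) has_sum
     c\<^sup>2 * seq_energy e + (- c) * (seq_corr e + seq_corr e) + seq_mean_energy e) UNIV"
    by (simp only:)
  then show ?thesis by (simp add: algebra_simps)
qed

text \<open>
  The mean-square size of \<open>e j - (e (j + 1) + e (j - 1)) / 2\<close> is nonnegative.
\<close>

lemma seq_corr_mean: "2 * seq_corr e - seq_energy e \<le> seq_mean_energy e"
  using has_sum_nonneg[OF seq_difference_has_sum[of 1]] by auto

end

text \<open>
  The summable fundamental solution of \<open>e j \<mapsto> cosh x * e j - (e (j + 1) + e (j - 1)) / 2\<close>, see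
  \<open>green_equation\<close>.
\<close>

definition green :: "real \<Rightarrow> int \<Rightarrow> real" where
  "green x k = exp (- x * \<bar>of_int k\<bar>) / sinh x"

text \<open>
  The kink of \<open>exp (-|z|)\<close> lies at a grid point \<open>x k\<close>. So this function solves \<open>y'' = y\<close> on each interval from
  \<open>x k\<close> to \<open>x (k + 1)\<close>, and there it is the combination of \<open>sinh (x - u)\<close> and \<open>sinh u\<close> with the right
  values at the end points.
\<close>

lemma exp_eq_green:
  assumes "x > 0" "0 \<le> u" "u \<le> x"
  shows "exp (- \<bar>u + x * of_int k\<bar>) = sinh (x - u) * green x k + sinh u * green x (k + 1)"
proof (cases "k \<ge> 0")
  case True
  have "sinh (x - u) + exp (- x) * sinh u = sinh x * exp (- u)"
    unfolding cosh_minus_sinh[symmetric] sinh_diff by (simp add: algebra_simps)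
  then have "sinh x * (exp (- u) * exp (- x * of_int k)) = (sinh (x - u) + exp (- x) * sinh u) * exp (- x * of_int k)"
    by simp
  moreover have "exp (- \<bar>u + x * of_int k\<bar>) = exp (- u) * exp (- x * of_int k)"
    using True assms by (simp flip: exp_add)
  moreover have "exp (- x * \<bar>of_int (k + 1)\<bar>) = exp (- x) * exp (- x * of_int k)"
    using True by (simp flip: exp_add add: algebra_simps)
  ultimately show ?thesis using assms True
    by (simp add: green_def field_simps)
next
  case False
  then have "real_of_int k \<le> -1" by linarith
  then have "x * of_int k \<le> x * (-1)" using assms(1) by (intro mult_left_mono) auto
  then have neg: "u + x * of_int k \<le> 0" using assms by simp
  have "sinh (x - u) + exp x * sinh u = sinh x * exp u"
    unfolding cosh_plus_sinh[symmetric] sinh_diff by (simp add: algebra_simps)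
  then have "sinh x * (exp u * exp (x * of_int k)) = (sinh (x - u) + exp x * sinh u) * exp (x * of_int k)"
    by simp
  moreover have "exp (- \<bar>u + x * of_int k\<bar>) = exp u * exp (x * of_int k)"
    using neg by (simp flip: exp_add)
  moreover have "exp (- x * \<bar>of_int (k + 1)\<bar>) = exp x * exp (x * of_int k)"
    using False by (simp flip: exp_add add: algebra_simps)
  moreover have "exp (- x * \<bar>of_int k\<bar>) = exp (x * of_int k)" using False by simp
  ultimately show ?thesis using assms
    by (simp add: green_def field_simps)
qed

lemma green_equation:
  assumes "x > 0"
  shows "cosh x * green x k - (green x (k + 1) + green x (k - 1)) / 2 = (if k = 0 then 1 else 0)"
proof -
  have cx: "cosh x = (exp x + exp (- x)) / 2" and sx: "sinh x = (exp x - exp (- x)) / 2"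
    by (simp_all add: cosh_field_def sinh_field_def)
  consider "k = 0" | "k \<ge> 1" | "k \<le> -1" by linarith
  then show ?thesis
  proof cases
    case 1
    then show ?thesis using assms cx sx by (simp add: green_def field_simps)
  next
    case 2
    have E: "exp (- x * \<bar>of_int (k + 1)\<bar>) = exp (- x) * exp (- x * of_int k)"
      "exp (- x * \<bar>of_int (k - 1)\<bar>) = exp x * exp (- x * of_int k)"
      "exp (- x * \<bar>of_int k\<bar>) = exp (- x * of_int k)"
      using 2 by (simp_all flip: exp_add add: algebra_simps)
    have "2 * cosh x * exp (- x * \<bar>of_int k\<bar>) = exp (- x * \<bar>of_int (k + 1)\<bar>) + exp (- x * \<bar>of_int (k - 1)\<bar>)"
      unfolding cx E by (simp add: distrib_right)
    then show ?thesis using assms unfolding green_def by (simp only: field_simps) (use 2 in \<open>simp add: add_divide_distrib\<close>)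
  next
    case 3
    have E: "exp (- x * \<bar>of_int (k + 1)\<bar>) = exp x * exp (x * of_int k)"
      "exp (- x * \<bar>of_int (k - 1)\<bar>) = exp (- x) * exp (x * of_int k)"
      "exp (- x * \<bar>of_int k\<bar>) = exp (x * of_int k)"
      using 3 by (simp_all flip: exp_add add: algebra_simps)
    have "2 * cosh x * exp (- x * \<bar>of_int k\<bar>) = exp (- x * \<bar>of_int (k + 1)\<bar>) + exp (- x * \<bar>of_int (k - 1)\<bar>)"
      unfolding cx E by (simp add: distrib_right)
    then show ?thesis using assms unfolding green_def by (simp only: field_simps) (use 3 in \<open>simp add: add_divide_distrib\<close>)
  qed
qed

lemma green_square_summable:
  assumes "x > 0"
  shows "(\<lambda>k. (green x (k + m))\<^sup>2) summable_on UNIV"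
proof -
  define r where "r = exp (- 2 * x)"
  have r: "0 < r" "r < 1" using assms by (auto simp: r_def)
  have sq: "(green x k)\<^sup>2 = inverse ((sinh x)\<^sup>2) * r ^ nat \<bar>k\<bar>" for k
    by (simp add: green_def r_def power_divide field_simps power2_eq_square of_nat_nat
        flip: exp_of_nat_mult exp_add)
  have "(\<lambda>n. r ^ n) summable_on (UNIV :: nat set)"
    using r by (intro norm_summable_imp_summable_on) (simp add: summable_geometric)
  then have "((\<lambda>k::int. r ^ nat \<bar>k\<bar>) \<circ> int) summable_on UNIV"
    "((\<lambda>k::int. r ^ nat \<bar>k\<bar>) \<circ> (\<lambda>n. - int n)) summable_on UNIV"
    by (simp_all add: o_def)
  then have "(\<lambda>k::int. r ^ nat \<bar>k\<bar>) summable_on range int" "(\<lambda>k::int. r ^ nat \<bar>k\<bar>) summable_on range (\<lambda>n. - int n)"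
    by (subst summable_on_reindex; simp add: inj_on_def)+
  then have "(\<lambda>k::int. r ^ nat \<bar>k\<bar>) summable_on (range int \<union> range (\<lambda>n. - int n))"
    by (rule summable_on_union)
  moreover have "range int \<union> range (\<lambda>n. - int n) = UNIV"
    by (auto simp: image_iff) (metis int_cases2)
  ultimately have "(\<lambda>k. (green x k)\<^sup>2) summable_on UNIV"
    unfolding sq by (auto intro: summable_on_cmult_right)
  then show ?thesis
    using has_sum_int_shift[of "\<lambda>k. (green x k)\<^sup>2" m] unfolding summable_on_def by blast
qed

text \<open>
  Multiplication with \<open>2 sinh t\<close> makes the sum telescope.
\<close>

lemma sum_cosh_arithmetic:
  fixes z t :: real and n :: nat
  shows "sinh t * (\<Sum>r<n. cosh (z + (real n - 1 - 2 * real r) * t)) = sinh (real n * t) * cosh z"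
proof -
  have "2 * sinh t * cosh (z + (real n - 1 - 2 * real r) * t) =
    sinh (z + (real n - 2 * real r) * t) - sinh (z + (real n - 2 * real (Suc r)) * t)" for r
  proof -
    let ?w = "z + (real n - 1 - 2 * real r) * t"
    have "2 * sinh t * cosh ?w = sinh (?w + t) - sinh (?w - t)"
      unfolding sinh_add sinh_diff by (simp del: of_nat_Suc)
    moreover have "?w + t = z + (real n - 2 * real r) * t" "?w - t = z + (real n - 2 * real (Suc r)) * t"
      by (simp_all add: algebra_simps)
    ultimately show ?thesis by (simp only:)
  qed
  then have "2 * sinh t * (\<Sum>r<n. cosh (z + (real n - 1 - 2 * real r) * t)) =
    (\<Sum>r<n. sinh (z + (real n - 2 * real r) * t) - sinh (z + (real n - 2 * real (Suc r)) * t))"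
    unfolding sum_distrib_left by (intro sum.cong refl)
  also have "\<dots> = sinh (z + real n * t) - sinh (z - real n * t)"
    by (subst sum_lessThan_telescope') (simp add: algebra_simps)
  also have "\<dots> = 2 * sinh (real n * t) * cosh z"
    by (simp add: sinh_add sinh_diff)
  finally show ?thesis by simp
qed

lemma sinh_sq_add: "(sinh u)\<^sup>2 + (sinh w)\<^sup>2 = cosh (u + w) * cosh (u - w) - (1::real)"
proof -
  have "cosh (u + w) * cosh (u - w) = (cosh u)\<^sup>2 * (cosh w)\<^sup>2 - (sinh u)\<^sup>2 * (sinh w)\<^sup>2"
    by (simp add: cosh_add cosh_diff power2_eq_square algebra_simps)
  then show ?thesis by (simp add: cosh_square_eq algebra_simps)
qed

lemma sinh_mult_sinh: "2 * sinh u * sinh w = cosh (u + w) - cosh (u - w)" for u w :: real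
  by (simp add: cosh_add cosh_diff)

text \<open>
  The shifts \<open>a k\<close> are finer than the period \<open>p = n a\<close>; splitting \<open>k\<close> by its residue modulo \<open>n\<close>
  leaves \<open>n\<close> sums with shifts by multiples of the period. The offset \<open>q\<close> is chosen later in such a way
  that all the points of evaluation lie in one period.
\<close>

lemma has_sum_int_residues:
  fixes f :: "int \<Rightarrow> 'a::topological_comm_monoid_add"
  assumes n: "n > 0" and g: "\<And>r. r < n \<Longrightarrow> ((\<lambda>j. f (q - (int r + int n * j))) has_sum g r) UNIV"
  shows "(f has_sum (\<Sum>r<n. g r)) UNIV"
proof -
  define F where "F = (\<lambda>r k. if (q - k) mod int n = int r then f k else 0)"
  have F: "(F r has_sum g r) UNIV" if r: "r < n" for r
  proof -
    let ?h = "\<lambda>j. q - (int r + int n * j)"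
    have "inj ?h" using n by (auto simp: inj_on_def)
    then have "(f has_sum g r) (range ?h)"
      using g[OF r] by (subst has_sum_reindex) (auto simp: o_def)
    moreover have "k \<in> range ?h \<longleftrightarrow> (q - k) mod int n = int r" for k
    proof
      assume "(q - k) mod int n = int r"
      then have "k = ?h ((q - k) div int n)"
        using mult_div_mod_eq[of "int n" "q - k"] by linarith
      then show "k \<in> range ?h" by blast
    qed (use r in auto)
    ultimately show ?thesis
      by (subst has_sum_cong_neutral[of "range ?h" UNIV f]) (auto simp: F_def)
  qed
  have "((\<lambda>k. \<Sum>r<m. F r k) has_sum (\<Sum>r<m. g r)) UNIV" if "m \<le> n" for m
    using that by (induction m) (auto intro!: has_sum_add F)
  then have "((\<lambda>k. \<Sum>r<n. F r k) has_sum (\<Sum>r<n. g r)) UNIV" by simp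
  moreover have "(\<Sum>r<n. F r k) = f k" for k
  proof -
    define r0 where "r0 = nat ((q - k) mod int n)"
    have r0: "r0 < n" "(q - k) mod int n = int r0" using n by (auto simp: r0_def nat_less_iff)
    have "(\<Sum>r<n. F r k) = (\<Sum>r<n. if r = r0 then f k else 0)"
      by (intro sum.cong refl) (auto simp: F_def r0(2))
    then show ?thesis using r0(1) by simp
  qed
  ultimately show ?thesis by simp
qed

text \<open>
  The inverse of the difference operator, applied to the finite sequence \<open>d\<close>. The sign \<open>m + j\<close> instead of
  \<open>j - m\<close> reflects the index; it is the form in which the samples of the window arise.
\<close>

definition green_conv :: "real \<Rightarrow> int set \<Rightarrow> (int \<Rightarrow> complex) \<Rightarrow> int \<Rightarrow> complex" where
  "green_conv x S d j = (\<Sum>m\<in>S. d m * of_real (green x (m + j)))"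

lemma green_conv_square_summable:
  assumes "x > 0" "finite S"
  shows "(\<lambda>j. (cmod (green_conv x S d j))\<^sup>2) summable_on UNIV"
proof -
  have "(\<lambda>j. (\<Sum>m\<in>S. (cmod (d m))\<^sup>2) * (\<Sum>m\<in>S. (green x (j + m))\<^sup>2)) summable_on UNIV"
  proof (rule summable_on_cmult_right)
    show "(\<lambda>j. \<Sum>m\<in>S. (green x (j + m))\<^sup>2) summable_on UNIV"
      using assms(2) by (induction rule: finite_induct) (auto intro!: summable_on_add green_square_summable assms(1))
  qed
  then show ?thesis
  proof (rule summable_on_comparison_test)
    fix j
    have "cmod (green_conv x S d j) \<le> (\<Sum>m\<in>S. cmod (d m) * \<bar>green x (j + m)\<bar>)"
      unfolding green_conv_def by (rule order_trans[OF norm_sum]) (simp add: norm_mult add.commute)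
    then have "(cmod (green_conv x S d j))\<^sup>2 \<le> (\<Sum>m\<in>S. cmod (d m) * \<bar>green x (j + m)\<bar>)\<^sup>2"
      by (simp add: power_mono)
    also have "\<dots> \<le> (\<Sum>m\<in>S. (cmod (d m))\<^sup>2) * (\<Sum>m\<in>S. (green x (j + m))\<^sup>2)"
      using Cauchy_Schwarz_ineq_sum[of "\<lambda>m. cmod (d m)" "\<lambda>m. \<bar>green x (j + m)\<bar>" S] by simp
    finally show "(cmod (green_conv x S d j))\<^sup>2 \<le> (\<Sum>m\<in>S. (cmod (d m))\<^sup>2) * (\<Sum>m\<in>S. (green x (j + m))\<^sup>2)" .
  qed auto
qed

lemma green_conv_equation:
  assumes "x > 0" "finite S" "\<And>m. m \<notin> S \<Longrightarrow> d m = 0"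
  shows "of_real (cosh x) * green_conv x S d j - (green_conv x S d (j + 1) + green_conv x S d (j - 1)) / 2 = d (- j)"
proof -
  have "of_real (cosh x) * green_conv x S d j - (green_conv x S d (j + 1) + green_conv x S d (j - 1)) / 2 =
    (\<Sum>m\<in>S. d m * of_real (cosh x * green x (m + j) - (green x ((m + j) + 1) + green x ((m + j) - 1)) / 2))"
    unfolding green_conv_def
    by (simp add: sum_distrib_left sum_divide_distrib sum.distrib[symmetric] sum_subtractf[symmetric] algebra_simps add_divide_distrib)
  also have "\<dots> = (\<Sum>m\<in>S. if m = - j then d m else 0)"
    unfolding green_equation[OF assms(1)] by (intro sum.cong refl) (auto simp: add_eq_0_iff2)
  also have "\<dots> = d (- j)" using assms(2,3) by (simp add: sum.delta)
  finally show ?thesis .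
qed

lemma green_conv_norm:
  assumes "x > 0" "finite S" "\<And>m. m \<notin> S \<Longrightarrow> d m = 0"
  defines "e \<equiv> green_conv x S d"
  shows "(\<Sum>m\<in>S. (cmod (d m))\<^sup>2) = (cosh x)\<^sup>2 * seq_energy e - 2 * cosh x * seq_corr e + seq_mean_energy e"
proof -
  have eq: "of_real (cosh x) * green_conv x S d j - (green_conv x S d (j + 1) + green_conv x S d (j - 1)) / 2 = d (- j)" for j
    by (rule green_conv_equation) (use assms in auto)
  have "((\<lambda>j. (cmod (d (- j)))\<^sup>2) has_sum
     (cosh x)\<^sup>2 * seq_energy e - 2 * cosh x * seq_corr e + seq_mean_energy e) UNIV"
    using seq_difference_has_sum[OF green_conv_square_summable[OF assms(1,2), of d], of "cosh x"]
    unfolding eq e_def .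
  then have "((\<lambda>j. (cmod (d j))\<^sup>2) has_sum
     (cosh x)\<^sup>2 * seq_energy e - 2 * cosh x * seq_corr e + seq_mean_energy e) UNIV"
    using has_sum_reindex_bij_betw[OF bij_uminus, of "\<lambda>j. (cmod (d j))\<^sup>2"] by simp
  moreover have "((\<lambda>j. (cmod (d j))\<^sup>2) has_sum (\<Sum>m\<in>S. (cmod (d m))\<^sup>2)) UNIV"
    by (rule has_sum_finite_neutralI) (use assms in auto)
  ultimately show ?thesis by (rule has_sum_unique[symmetric])
qed

text \<open>
  The factor by which the sum over the shifts depends on the position \<open>y\<close> in a cell of length \<open>t\<close>. It
  is symmetric about \<open>y = t / 2\<close>, where it is smallest.
\<close>

definition local_gain :: "nat \<Rightarrow> real \<Rightarrow> real \<Rightarrow> real" where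
  "local_gain n t y = sinh (real n * t) * cosh (t - 2 * y) / sinh t"

text \<open>
  For each residue class the samples of the window reduce, by \<open>exp_eq_green\<close>, to two neighbouring values
  of \<open>e\<close>, with coefficients \<open>sinh (x - u)\<close> and \<open>sinh u\<close>. Summation over the classes only leaves
  \<open>sinh\<^sup>2 (x - u) + sinh\<^sup>2 u\<close> and \<open>2 sinh (x - u) sinh u\<close>, and both are affine in \<open>cosh (x - 2 u)\<close>.
\<close>

theorem local_frame_sum:
  fixes d :: "int \<Rightarrow> complex"
  assumes n: "n \<ge> 1" and t: "t > 0" and S: "finite S" and y: "0 \<le> y" "y \<le> t"
  defines "x \<equiv> real n * t" and "c \<equiv> local_gain n t y"
  defines "e \<equiv> green_conv x S d"
  shows "((\<lambda>k. (cmod (\<Sum>m\<in>S. d m * of_real (exp (- \<bar>y + t * of_int q + x * of_int m - t * of_int k\<bar>))))\<^sup>2) has_sum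
    c * (cosh x * seq_energy e - seq_corr e) + real n * (cosh x * seq_corr e - seq_energy e)) UNIV"
proof -
  have x: "x > 0" using n t by (simp add: x_def)
  have sq: "(\<lambda>j. (cmod (e j))\<^sup>2) summable_on UNIV"
    unfolding e_def by (rule green_conv_square_summable[OF x S])
  define u where "u = (\<lambda>r. y + real r * t)"
  define v where "v = (\<lambda>k. \<Sum>m\<in>S. d m * of_real (exp (- \<bar>y + t * of_int q + x * of_int m - t * of_int k\<bar>)))"
  have u: "0 \<le> u r" "u r \<le> x" if "r < n" for r
  proof -
    show "0 \<le> u r" using y t by (simp add: u_def)
    have "(real r + 1) * t \<le> real n * t" using that t by (intro mult_right_mono) auto
    then show "u r \<le> x" using y by (simp add: u_def x_def algebra_simps)
  qed
  have v: "v (q - (int r + int n * j)) = of_real (sinh (x - u r)) * e j + of_real (sinh (u r)) * e (j + 1)" if "r < n" for r j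
  proof -
    have "exp (- \<bar>y + t * of_int q + x * of_int m - t * of_int (q - (int r + int n * j))\<bar>) =
      sinh (x - u r) * green x (m + j) + sinh (u r) * green x (m + (j + 1))" for m
    proof -
      have "y + t * of_int q + x * of_int m - t * of_int (q - (int r + int n * j)) = u r + x * of_int (m + j)"
        by (simp add: u_def x_def algebra_simps)
      then show ?thesis using exp_eq_green[OF x u[OF that], of "m + j"] by (simp add: add.assoc)
    qed
    then show ?thesis
      unfolding v_def e_def green_conv_def
      by (simp add: sum_distrib_left sum.distrib[symmetric] algebra_simps)
  qed
  have "((\<lambda>k. (cmod (v k))\<^sup>2) has_sum
    (\<Sum>r<n. ((sinh (x - u r))\<^sup>2 + (sinh (u r))\<^sup>2) * seq_energy e + 2 * sinh (x - u r) * sinh (u r) * seq_corr e)) UNIV"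
  proof (rule has_sum_int_residues)
    show "((\<lambda>j. (cmod (v (q - (int r + int n * j))))\<^sup>2) has_sum
        ((sinh (x - u r))\<^sup>2 + (sinh (u r))\<^sup>2) * seq_energy e + 2 * sinh (x - u r) * sinh (u r) * seq_corr e) UNIV"
      if "r < n" for r
      unfolding v[OF that] by (rule seq_two_term_has_sum[OF sq])
  qed (use n in simp)
  also have "(\<Sum>r<n. ((sinh (x - u r))\<^sup>2 + (sinh (u r))\<^sup>2) * seq_energy e + 2 * sinh (x - u r) * sinh (u r) * seq_corr e) =
    (\<Sum>r<n. cosh (x - 2 * u r)) * (cosh x * seq_energy e - seq_corr e) + real n * (cosh x * seq_corr e - seq_energy e)"
  proof -
    have "((sinh (x - u r))\<^sup>2 + (sinh (u r))\<^sup>2) * seq_energy e + 2 * sinh (x - u r) * sinh (u r) * seq_corr e =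
      cosh (x - 2 * u r) * (cosh x * seq_energy e - seq_corr e) + (cosh x * seq_corr e - seq_energy e)" for r
      unfolding sinh_sq_add sinh_mult_sinh by (simp add: algebra_simps)
    then show ?thesis by (simp add: sum.distrib sum_distrib_right)
  qed
  also have "(\<Sum>r<n. cosh (x - 2 * u r)) = c"
  proof -
    have "(\<Sum>r<n. cosh (x - 2 * u r)) = (\<Sum>r<n. cosh ((t - 2 * y) + (real n - 1 - 2 * real r) * t))"
      by (intro sum.cong refl arg_cong[where f=cosh]) (simp add: u_def x_def algebra_simps)
    then show ?thesis
      using sum_cosh_arithmetic[where t=t and n=n and z="t - 2 * y"] t
      by (simp add: c_def local_gain_def field_simps)
  qed
  finally show ?thesis unfolding v_def .
qed

section \<open>Comparison of the quadratic forms and extremal sequences\<close>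

text \<open>
  The values \<open>lower_const\<close> and \<open>upper_const\<close> are the sharp frame bounds divided by \<open>x = n t\<close>.
\<close>

definition lower_const :: "nat \<Rightarrow> real \<Rightarrow> real" where
  "lower_const n t = (sinh (real n * t) / sinh t - real n) / (cosh (real n * t) + 1)"

definition upper_const :: "nat \<Rightarrow> real \<Rightarrow> real" where
  "upper_const n t = (sinh (real n * t) * cosh t / sinh t + real n) / (cosh (real n * t) - 1)"

lemma sinh_multiple_ge:
  assumes "t > 0"
  shows "real n * sinh t \<le> sinh (real n * t)"
proof (induction n)
  case (Suc n)
  have "real (Suc n) * sinh t \<le> sinh (real n * t) * 1 + 1 * sinh t"
    using Suc by (simp add: algebra_simps)
  also have "\<dots> \<le> sinh (real n * t) * cosh t + cosh (real n * t) * sinh t"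
    using assms by (intro add_mono mult_left_mono mult_right_mono cosh_real_ge_1) auto
  also have "\<dots> = sinh (real (Suc n) * t)"
  proof -
    have "real (Suc n) * t = real n * t + t" by (simp add: algebra_simps)
    then show ?thesis by (simp only: sinh_add)
  qed
  finally show ?case .
qed simp

lemma lower_const_nonneg: "t > 0 \<Longrightarrow> 0 \<le> lower_const n t"
  unfolding lower_const_def using sinh_multiple_ge[of t n]
  by (intro divide_nonneg_pos) (auto simp: field_simps add_pos_pos)

lemma local_gain_bounds:
  assumes "t > 0" "0 \<le> y" "y \<le> t"
  shows "sinh (real n * t) / sinh t \<le> local_gain n t y"
    and "local_gain n t y \<le> sinh (real n * t) * cosh t / sinh t"
proof -
  have s: "0 \<le> sinh (real n * t)" "0 < sinh t" using assms by auto
  show "sinh (real n * t) / sinh t \<le> local_gain n t y"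
    unfolding local_gain_def using s mult_left_mono[OF cosh_real_ge_1[of "t - 2 * y"] s(1)]
    by (intro divide_right_mono) auto
  have "cosh (t - 2 * y) = cosh \<bar>t - 2 * y\<bar>" by simp
  also have "\<dots> \<le> cosh t" using assms by (subst cosh_real_nonneg_le_iff) auto
  finally show "local_gain n t y \<le> sinh (real n * t) * cosh t / sinh t"
    unfolding local_gain_def using s by (intro divide_right_mono mult_left_mono) auto
qed

text \<open>
  After \<open>\<kappa>\<close> is replaced by \<open>E\<close> and \<open>c\<close> by \<open>c0\<close>, both sides are linear in \<open>E\<close> and \<open>q\<close>. They agree for \<open>q = - E\<close>, so that
  their difference is a multiple of \<open>E + q\<close>. Here \<open>h\<close> stands for \<open>cosh x\<close>.
\<close>

lemma lower_form_inequality: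
  fixes h c c0 E q \<kappa> n :: real
  assumes h: "h > 1" and c: "c0 \<le> c" "n \<le> c0" "0 \<le> n" and q: "\<bar>q\<bar> \<le> E" and \<kappa>: "\<kappa> \<le> E"
  shows "(c0 - n) / (h + 1) * (h\<^sup>2 * E - 2 * h * q + \<kappa>) \<le> c * (h * E - q) + n * (h * q - E)"
proof -
  have hE: "0 \<le> h * E - q"
  proof -
    have "0 \<le> (h - 1) * E" using h q by simp
    then show ?thesis using q by (simp add: algebra_simps)
  qed
  have "(c0 - n) / (h + 1) * (h\<^sup>2 * E - 2 * h * q + \<kappa>) \<le> (c0 - n) / (h + 1) * (h\<^sup>2 * E - 2 * h * q + E)"
    using h c \<kappa> by (intro mult_left_mono) auto
  also have "\<dots> \<le> c0 * (h * E - q) + n * (h * q - E)"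
  proof -
    have "0 \<le> (E + q) * ((h - 1) * (c0 + n * h))" using h c q by (intro mult_nonneg_nonneg) auto
    also have "\<dots> = (c0 * (h * E - q) + n * (h * q - E)) * (h + 1) - (c0 - n) * (h\<^sup>2 * E - 2 * h * q + E)"
      by (simp add: algebra_simps power2_eq_square)
    finally have "(c0 - n) * (h\<^sup>2 * E - 2 * h * q + E) \<le> (c0 * (h * E - q) + n * (h * q - E)) * (h + 1)"
      by simp
    then show ?thesis using h by (simp add: pos_divide_le_eq)
  qed
  also have "\<dots> \<le> c * (h * E - q) + n * (h * q - E)"
    using hE c by (intro add_right_mono mult_right_mono) auto
  finally show ?thesis .
qed

text \<open>
  After \<open>\<kappa>\<close> is replaced by \<open>2 q - E\<close> and \<open>c\<close> by \<open>c1\<close>, both sides are linear in \<open>E\<close> and \<open>q\<close>. They agree for \<open>q = E\<close>, so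
  that their difference is a multiple of \<open>E - q\<close>. Here \<open>h\<close> stands for \<open>cosh x\<close>.
\<close>

lemma upper_form_inequality:
  fixes h c c1 E q \<kappa> n :: real
  assumes h: "h > 1" and c: "c \<le> c1" "0 \<le> c1" "0 \<le> n" and q: "\<bar>q\<bar> \<le> E" and \<kappa>: "2 * q - E \<le> \<kappa>"
  shows "c * (h * E - q) + n * (h * q - E) \<le> (c1 + n) / (h - 1) * (h\<^sup>2 * E - 2 * h * q + \<kappa>)"
proof -
  have hE: "0 \<le> h * E - q"
  proof -
    have "0 \<le> (h - 1) * E" using h q by simp
    then show ?thesis using q by (simp add: algebra_simps)
  qed
  have "c * (h * E - q) + n * (h * q - E) \<le> c1 * (h * E - q) + n * (h * q - E)"
    using hE c by (intro add_right_mono mult_right_mono) auto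
  also have "\<dots> \<le> (c1 + n) * ((h + 1) * E - 2 * q)"
  proof -
    have "0 \<le> (c1 + 2 * n + n * h) * (E - q)" using h c q by (intro mult_nonneg_nonneg) auto
    also have "\<dots> = (c1 + n) * ((h + 1) * E - 2 * q) - (c1 * (h * E - q) + n * (h * q - E))"
      by (simp add: algebra_simps)
    finally show ?thesis by simp
  qed
  also have "\<dots> = (c1 + n) / (h - 1) * (h\<^sup>2 * E - 2 * h * q + (2 * q - E))"
  proof -
    have "h\<^sup>2 * E - 2 * h * q + (2 * q - E) = (h - 1) * ((h + 1) * E - 2 * q)"
      by (simp add: algebra_simps power2_eq_square)
    then show ?thesis using h by simp
  qed
  also have "\<dots> \<le> (c1 + n) / (h - 1) * (h\<^sup>2 * E - 2 * h * q + \<kappa>)"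
    using h c \<kappa> by (intro mult_left_mono) auto
  finally show ?thesis .
qed

text \<open>
  A square-summable solution of the homogeneous equation vanishes: the difference operator is bounded
  below by \<open>cosh x - 1 > 0\<close>.
\<close>

lemma green_conv_unique:
  assumes x: "x > 0" and S: "finite S" "\<And>m. m \<notin> S \<Longrightarrow> d m = 0"
    and sq: "(\<lambda>j. (cmod (e j))\<^sup>2) summable_on UNIV"
    and d: "\<And>j. of_real (cosh x) * e j - (e (j + 1) + e (j - 1)) / 2 = d (- j)"
  shows "green_conv x S d = e"
proof -
  define f where "f = (\<lambda>j. green_conv x S d j - e j)"
  have eq: "of_real (cosh x) * green_conv x S d j - (green_conv x S d (j + 1) + green_conv x S d (j - 1)) / 2 = d (- j)" for j
    by (rule green_conv_equation) (use x S in auto)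
  have f0: "of_real (cosh x) * f j - (f (j + 1) + f (j - 1)) / 2 = 0" for j
    using eq[of j] d[of j] by (simp add: f_def algebra_simps diff_divide_distrib add_divide_distrib)
  have sqf: "(\<lambda>j. (cmod (f j))\<^sup>2) summable_on UNIV"
  proof (rule summable_on_comparison_test)
    show "(\<lambda>j. 2 * ((cmod (green_conv x S d j))\<^sup>2 + (cmod (e j))\<^sup>2)) summable_on UNIV"
      by (intro summable_on_cmult_right summable_on_add green_conv_square_summable x S sq)
    fix j
    have "(cmod (f j))\<^sup>2 \<le> (cmod (green_conv x S d j) + cmod (e j))\<^sup>2"
      unfolding f_def by (intro power_mono norm_triangle_ineq4) auto
    also have "\<dots> \<le> 2 * ((cmod (green_conv x S d j))\<^sup>2 + (cmod (e j))\<^sup>2)"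
      using sum_squares_bound[of "cmod (green_conv x S d j)" "cmod (e j)"] by (simp add: power2_sum)
    finally show "(cmod (f j))\<^sup>2 \<le> 2 * ((cmod (green_conv x S d j))\<^sup>2 + (cmod (e j))\<^sup>2)" .
  qed auto
  have h: "cosh x > 1" using x cosh_real_strict_mono[of 0 x] by simp
  have "((\<lambda>j::int. 0::real) has_sum (cosh x)\<^sup>2 * seq_energy f - 2 * cosh x * seq_corr f + seq_mean_energy f) UNIV"
    using seq_difference_has_sum[OF sqf, of "cosh x"] unfolding f0 by simp
  then have "(cosh x)\<^sup>2 * seq_energy f - 2 * cosh x * seq_corr f + seq_mean_energy f = 0"
    by (rule has_sum_unique) (rule has_sum_0_simp)
  with seq_corr_mean[OF sqf]
  have "((cosh x)\<^sup>2 - 1) * seq_energy f - 2 * (cosh x - 1) * seq_corr f \<le> 0"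
    by (simp add: algebra_simps)
  moreover have "2 * (cosh x - 1) * seq_corr f \<le> 2 * (cosh x - 1) * seq_energy f"
    using abs_seq_corr_le[OF sqf] h by (intro mult_left_mono) auto
  ultimately have "(cosh x - 1)\<^sup>2 * seq_energy f \<le> 0"
    by (simp add: algebra_simps power2_eq_square)
  then have "seq_energy f \<le> 0" using h x by (simp add: mult_le_0_iff)
  have "f j = 0" for j
  proof -
    have "(cmod (f j))\<^sup>2 \<le> seq_energy f"
    proof (rule has_sum_mono')
      show "((\<lambda>j. (cmod (f j))\<^sup>2) has_sum (cmod (f j))\<^sup>2) {j}" by (simp add: has_sum_finiteI)
      show "((\<lambda>j. (cmod (f j))\<^sup>2) has_sum seq_energy f) UNIV" using seq_energy_has_sum[OF sqf, of 0] by simp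
    qed auto
    then have "(cmod (f j))\<^sup>2 \<le> 0" using \<open>seq_energy f \<le> 0\<close> by linarith
    then show ?thesis by simp
  qed
  then show ?thesis by (auto simp: f_def)
qed

text \<open>
  The extremal sequences would be \<open>1\<close> and \<open>(-1)^j\<close>, which are not summable; their restrictions to
  \<open>N\<close> consecutive indices come close. It is \<open>e\<close> that is prescribed, and \<open>d\<close> is computed from it.
\<close>

lemma near_extremal_sequence:
  assumes x: "x > 0" and N: "N \<ge> 1" and \<sigma>: "\<sigma> = 1 \<or> \<sigma> = -1"
  shows "\<exists>S d. finite S \<and> (\<forall>m. m \<notin> S \<longrightarrow> d m = 0) \<and> seq_energy (green_conv x S d) = real N \<and>
    seq_corr (green_conv x S d) = \<sigma> * (real N - 1)"
proof -
  define e :: "int \<Rightarrow> complex" where "e = (\<lambda>j. if j \<in> {0..<int N} then of_real \<sigma> ^ nat j else 0)"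
  define d where "d = (\<lambda>m. of_real (cosh x) * e (- m) - (e (- m + 1) + e (- m - 1)) / 2)"
  define S where "S = {- int N..1}"
  have d0: "d m = 0" if "m \<notin> S" for m
    using that by (auto simp: d_def e_def S_def)
  have sg: "\<sigma> * \<sigma> = 1" "\<bar>\<sigma>\<bar> = 1" using \<sigma> by auto
  have "((\<lambda>j. (cmod (e j))\<^sup>2) has_sum real N) UNIV"
    by (rule has_sum_finite_neutralI[where B="{0..<int N}"])
      (auto simp: e_def norm_power sg)
  then have E: "(\<lambda>j. (cmod (e j))\<^sup>2) summable_on UNIV" "seq_energy e = real N"
    by (auto simp: seq_energy_def infsumI has_sum_imp_summable)
  have "((\<lambda>j. Re (e j * cnj (e (j + 1)))) has_sum \<sigma> * (real N - 1)) UNIV"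
  proof (rule has_sum_finite_neutralI[where B="{0..<int N - 1}"])
    have "Re (e j * cnj (e (j + 1))) = \<sigma>" if "j \<in> {0..<int N - 1}" for j
    proof -
      have "nat (j + 1) = Suc (nat j)" using that by auto
      moreover have "\<sigma> ^ k * \<sigma> ^ k = 1" for k
        by (simp add: power_mult_distrib[symmetric] sg)
      ultimately show ?thesis using that by (simp add: e_def sg)
    qed
    then show "\<sigma> * (real N - 1) = (\<Sum>j = 0..<int N - 1. Re (e j * cnj (e (j + 1))))"
      using N by (simp add: of_nat_diff)
  qed (auto simp: e_def)
  then have q: "seq_corr e = \<sigma> * (real N - 1)" by (simp add: seq_corr_def infsumI)
  have "green_conv x S d = e"
    by (rule green_conv_unique[OF x _ d0 E(1)]) (simp_all add: S_def d_def add.commute)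
  then show ?thesis using d0 E q by (intro exI[of _ S] exI[of _ d]) (auto simp: S_def)
qed

section \<open>The Gabor sum of a bounded function with bounded support\<close>

lemma infsum_countable_ennreal:
  fixes g :: "'i \<Rightarrow> ennreal" and h :: "nat \<Rightarrow> 'i"
  assumes "bij h"
  shows "(\<Sum>\<^sub>\<infinity>k. g k) = (\<Sum>i. g (h i))"
proof -
  have "(\<Sum>\<^sub>\<infinity>k. g k) = (\<Sum>\<^sub>\<infinity>i. g (h i))"
    by (rule infsum_reindex_bij_betw[OF assms, symmetric])
  also have "\<dots> = (\<Sum>i. g (h i))"
    by (rule sums_unique, rule has_sum_imp_sums, rule has_sum_infsum, rule nonneg_summable_on_complete) simp
  finally show ?thesis .
qed

lemma infsum_cmult_nn_integral_swap:
  fixes f :: "int \<Rightarrow> 'a \<Rightarrow> ennreal"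
  assumes [measurable]: "\<And>k. f k \<in> borel_measurable M"
  shows "(\<Sum>\<^sub>\<infinity>k. c * (\<integral>\<^sup>+x. f k x \<partial>M)) = c * (\<integral>\<^sup>+x. (\<Sum>\<^sub>\<infinity>k. f k x) \<partial>M)"
  unfolding infsum_countable_ennreal[OF bij_int_decode] ennreal_suminf_cmult
  by (subst nn_integral_suminf) simp_all

text \<open>
  As integrals over counting measures the sums are open to Tonelli's theorem and to Fatou's lemma.
\<close>

lemma infsum_count_space:
  fixes g :: "'i::countable \<Rightarrow> ennreal"
  assumes "infinite (UNIV :: 'i set)"
  shows "(\<Sum>\<^sub>\<infinity>k. g k) = (\<integral>\<^sup>+k. g k \<partial>count_space UNIV)"
proof -
  have h: "bij (from_nat_into (UNIV :: 'i set))"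
    by (rule bij_betw_from_nat_into) (use assms in auto)
  show ?thesis
    unfolding infsum_countable_ennreal[OF h] nn_integral_bij_count_space[OF h, symmetric]
    by (rule nn_integral_count_space_nat[symmetric])
qed

lemma infsum_int_prod_ennreal:
  fixes f :: "int \<Rightarrow> int \<Rightarrow> ennreal"
  shows "(\<Sum>\<^sub>\<infinity>(k, l)\<in>UNIV. f k l) = (\<Sum>\<^sub>\<infinity>k. \<Sum>\<^sub>\<infinity>l. f k l)"
proof -
  have "infinite (UNIV :: (int \<times> int) set)"
    using infinite_UNIV_int by (simp add: finite_prod)
  then show ?thesis
    using nn_integral_fst_count_space[of "\<lambda>(k, l). f k l"]
    by (simp add: infsum_count_space infinite_UNIV_int)
qed

lemma periodic_cell:
  fixes t :: real
  assumes "p > 0"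
  shows "t \<in> {p * of_int m..<p * of_int m + p} \<longleftrightarrow> m = \<lfloor>t / p\<rfloor>"
  using assms floor_eq_iff[of "t / p" m] by (auto simp: field_simps)

text \<open>
  The assumption on \<open>S\<close> says that \<open>h\<close> vanishes on all but finitely many cells of length \<open>p\<close>, so that the sum
  of the translates is finite.
\<close>

lemma integral_periodization:
  fixes h :: "real \<Rightarrow> 'b::{banach, second_countable_topology}"
  assumes p: "p > 0" and h: "h \<in> borel_measurable borel" "\<And>t. norm (h t) \<le> K"
    and S: "finite S" "\<And>m s. m \<notin> S \<Longrightarrow> s \<in> {0..<p} \<Longrightarrow> h (s + p * of_int m) = 0"
  shows "integrable lborel h"
    and "(LINT t|lborel. h t) = (LINT s|period_measure p. (\<Sum>m\<in>S. h (s + p * of_int m)))"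
proof -
  note [measurable] = h(1)
  let ?I = "\<lambda>m. {p * of_int m..<p * of_int m + p} :: real set"
  have split: "h t = (\<Sum>m\<in>S. indicator (?I m) t *\<^sub>R h t)" for t
  proof -
    define m0 where "m0 = \<lfloor>t / p\<rfloor>"
    have m0: "t \<in> ?I m0" using periodic_cell[OF p, of t m0] by (simp add: m0_def)
    have "(\<Sum>m\<in>S. indicator (?I m) t *\<^sub>R h t) = (\<Sum>m\<in>S. if m = m0 then h t else 0)"
      using periodic_cell[OF p, of t] by (intro sum.cong refl) (auto simp: m0_def indicator_def)
    moreover have "h t = 0" if "m0 \<notin> S"
      using S(2)[OF that, of "t - p * of_int m0"] m0 by simp
    ultimately show ?thesis using S(1) by simp
  qed
  have int: "integrable lborel (\<lambda>t. indicator (?I m) t *\<^sub>R h t)" for m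
  proof (rule Bochner_Integration.integrable_bound)
    show "integrable lborel (\<lambda>t. indicator (?I m) t *\<^sub>R K)"
      using p by (intro integrable_scaleR_left) simp
    show "AE t in lborel. norm (indicator (?I m) t *\<^sub>R h t) \<le> norm (indicator (?I m) t *\<^sub>R K)"
      using h(2) order_trans[OF h(2) abs_ge_self] by (auto simp: indicator_def)
  qed simp
  have hs: "h = (\<lambda>t. \<Sum>m\<in>S. indicator (?I m) t *\<^sub>R h t)" using split by blast
  show "integrable lborel h" by (subst hs) (use int in simp)
  have cell: "(LINT t|lborel. indicator (?I m) t *\<^sub>R h t) = (LINT s|period_measure p. h (s + p * of_int m))" for m
  proof -
    have "(LINT t|lborel. indicator (?I m) t *\<^sub>R h t) =
      (LINT s|lborel. indicator (?I m) (p * of_int m + 1 * s) *\<^sub>R h (p * of_int m + 1 * s))"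
      by (subst lborel_integral_real_affine[of 1 _ "p * of_int m"]) simp_all
    also have "\<dots> = (LINT s|lborel. indicator {0..<p} s *\<^sub>R h (s + p * of_int m))"
      by (intro Bochner_Integration.integral_cong refl) (auto simp: indicator_def add.commute)
    also have "\<dots> = (LINT s|period_measure p. h (s + p * of_int m))"
      by (rule integral_restrict_space[symmetric]) simp
    finally show ?thesis .
  qed
  have intp: "integrable (period_measure p) (\<lambda>s. h (s + p * of_int m))" for m
    by (rule integrable_period_measure[of _ K]) (use h(2) in auto)
  have "(LINT t|lborel. h t) = (\<Sum>m\<in>S. LINT t|lborel. indicator (?I m) t *\<^sub>R h t)"
    by (subst hs) (use int in \<open>simp add: Bochner_Integration.integral_sum\<close>)
  also have "\<dots> = (LINT s|period_measure p. (\<Sum>m\<in>S. h (s + p * of_int m)))"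
    unfolding cell using intp by (subst Bochner_Integration.integral_sum) auto
  finally show "(LINT t|lborel. h t) = (LINT s|period_measure p. (\<Sum>m\<in>S. h (s + p * of_int m)))" .
qed

lemma bounded_support_cells:
  fixes p R :: real
  assumes p: "p > 0" and f: "\<And>t. \<bar>t\<bar> > R \<Longrightarrow> f t = 0"
  shows "\<exists>S. finite S \<and> (\<forall>m s. m \<notin> S \<longrightarrow> s \<in> {0..<p} \<longrightarrow> f (s + p * of_int m) = (0::complex))"
proof (intro exI conjI allI impI)
  define B where "B = \<lceil>\<bar>R\<bar> / p\<rceil> + 1"
  show "finite {-B..B}" by simp
  fix m s assume m: "m \<notin> {-B..B}" and s: "s \<in> {0..<p}"
  have B: "\<bar>R\<bar> \<le> p * (of_int B - 1)" 
  proof -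
    have "\<bar>R\<bar> / p \<le> of_int B - 1" by (simp add: B_def)
    then show ?thesis using p by (simp add: pos_divide_le_eq mult.commute)
  qed
  consider "m > B" | "m + 1 \<le> - B" using m by fastforce
  then show "f (s + p * of_int m) = 0"
  proof cases
    case 1
    then have *: "p * of_int B < p * of_int m" using p by simp
    have "\<bar>R\<bar> + p \<le> p * of_int B" using B by (simp add: right_diff_distrib)
    then have "\<bar>R\<bar> < s + p * of_int m" using * s p by (simp only: atLeastLessThan_iff) linarith
    then show ?thesis by (intro f) linarith
  next
    case 2
    then have "real_of_int (m + 1) \<le> of_int (- B)" by (subst of_int_le_iff)
    then have "p * (of_int m + 1) \<le> p * - of_int B" using p by (intro mult_left_mono) auto
    then show ?thesis using B p s by (intro f) (auto simp: algebra_simps)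
  qed
qed

definition local_form :: "nat \<Rightarrow> real \<Rightarrow> int set \<Rightarrow> (int \<Rightarrow> complex) \<Rightarrow> real \<Rightarrow> real" where
  "local_form n t S d y = (let x = real n * t; e = green_conv x S d in
     local_gain n t y * (cosh x * seq_energy e - seq_corr e) + real n * (cosh x * seq_corr e - seq_energy e))"

lemma gabor_sum_lattice:
  assumes "a > 0" "b > 0"
  shows "gabor_sum g (rect_lattice a b) f =
    (\<Sum>\<^sub>\<infinity>k. \<Sum>\<^sub>\<infinity>l. ennreal ((cmod (L2_inner f (tf_shift (a * of_int k, b * of_int l) g)))\<^sup>2))"
proof -
  let ?h = "\<lambda>(k, l). (a * of_int k, b * of_int l)"
  have "bij_betw ?h UNIV (rect_lattice a b)"
    unfolding bij_betw_def rect_lattice_def using assms by (auto simp: inj_on_def)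
  from infsum_reindex_bij_betw[OF this, of "\<lambda>p. ennreal ((cmod (L2_inner f (tf_shift p g)))\<^sup>2)"]
  have "gabor_sum g (rect_lattice a b) f =
    (\<Sum>\<^sub>\<infinity>(k, l)\<in>UNIV. ennreal ((cmod (L2_inner f (tf_shift (a * of_int k, b * of_int l) g)))\<^sup>2))"
    unfolding gabor_sum_def by (simp add: case_prod_unfold)
  then show ?thesis by (simp only: infsum_int_prod_ennreal)
qed

text \<open>
  Since the modulations have period \<open>p\<close>, each inner product is a Fourier coefficient of the
  periodization \<open>P k\<close> of \<open>f\<close> times the shifted window. Parseval's identity sums over the modulations, and \<open>local_frame_sum\<close> over the shifts,
  pointwise in \<open>s\<close>; the argument \<open>\<gamma> (s - a \<lfloor>s / a\<rfloor>)\<close> is the scaled position of \<open>s\<close> in its cell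
  of length \<open>a\<close>.
\<close>

theorem gabor_sum_bounded_support:
  assumes n: "n \<ge> 1" and a: "a > 0" and \<gamma>: "\<gamma> > 0"
    and f: "f \<in> borel_measurable borel" "\<And>t. cmod (f t) \<le> K"
  defines "p \<equiv> real n * a"
  assumes S: "finite S" "\<And>m s. m \<notin> S \<Longrightarrow> s \<in> {0..<p} \<Longrightarrow> f (s + p * of_int m) = 0"
  shows "gabor_sum (two_sided_exp \<gamma>) (rect_lattice a (1 / p)) f =
    ennreal p * (\<integral>\<^sup>+s. ennreal (\<gamma> * local_form n (\<gamma> * a) S (\<lambda>m. f (s + p * of_int m)) (\<gamma> * (s - a * \<lfloor>s / a\<rfloor>))) \<partial>period_measure p)"
proof -
  have p: "p > 0" using n a by (simp add: p_def)
  have K: "0 \<le> K" using order_trans[OF norm_ge_zero f(2)[of 0]] .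
  note [measurable] = f(1)
  define w where "w = (\<lambda>t. sqrt \<gamma> * exp (- \<gamma> * \<bar>t\<bar>))"
  have w[measurable]: "w \<in> borel_measurable borel" unfolding w_def by measurable
  have w_le: "\<bar>w t\<bar> \<le> sqrt \<gamma>" for t using \<gamma> by (simp add: w_def abs_mult)
  define P where "P = (\<lambda>k s. \<Sum>m\<in>S. f (s + p * of_int m) * of_real (w (s + p * of_int m - a * of_int k)))"
  have Pm[measurable]: "P k \<in> borel_measurable borel" for k unfolding P_def by measurable
  have P_le: "cmod (P k s) \<le> real (card S) * (K * sqrt \<gamma>)" for k s
    unfolding P_def
  proof (rule sum_norm_bound)
    show "cmod (f (s + p * of_int m) * of_real (w (s + p * of_int m - a * of_int k))) \<le> K * sqrt \<gamma>" for m
      unfolding norm_mult using f(2) w_le K by (intro mult_mono) auto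
  qed
  have inner: "L2_inner f (tf_shift (a * of_int k, 1 / p * of_int l) (two_sided_exp \<gamma>)) =
    (LINT s|period_measure p. P k s * character p (- l) s)" for k l
  proof -
    define h where "h = (\<lambda>t. f t * of_real (w (t - a * of_int k)) * character p (- l) t)"
    have [measurable]: "h \<in> borel_measurable borel" unfolding h_def by measurable
    have h_le: "cmod (h t) \<le> K * sqrt \<gamma>" for t
      unfolding h_def norm_mult norm_character using f(2) w_le K by (auto intro!: mult_mono)
    have "L2_inner f (tf_shift (a * of_int k, 1 / p * of_int l) (two_sided_exp \<gamma>)) = (LINT t|lborel. h t)"
      unfolding L2_inner_def tf_shift_def two_sided_exp_def h_def w_def character_def
      by (intro Bochner_Integration.integral_cong refl)
        (simp add: cis_conv_exp exp_cnj mult_ac)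
    also have "\<dots> = (LINT s|period_measure p. (\<Sum>m\<in>S. h (s + p * of_int m)))"
      by (rule integral_periodization[OF p _ h_le S(1)]) (use S(2) in \<open>auto simp: h_def\<close>)
    also have "\<dots> = (LINT s|period_measure p. P k s * character p (- l) s)"
    proof (intro Bochner_Integration.integral_cong refl)
      fix s
      have "character p (- l) (s + p * of_int m) = character p (- l) s" for m
      proof -
        have "character p (- l) (s + p * of_int m) = character p (- l) s * cis (2 * pi * of_int (- l * m))"
        proof -
          have "2 * pi * of_int (- l) * (s + p * of_int m) / p = 2 * pi * of_int (- l) * s / p + 2 * pi * of_int (- l * m)"
            using p by (simp add: field_simps)
          then show ?thesis by (simp only: character_def cis_mult)
        qed
        also have "cis (2 * pi * of_int (- l * m)) = 1" by (rule cis_multiple_2pi) simp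
        finally show ?thesis by simp
      qed
      then show "(\<Sum>m\<in>S. h (s + p * of_int m)) = P k s * character p (- l) s"
        by (simp add: h_def P_def sum_distrib_right)
    qed
    finally show ?thesis .
  qed
  have "(\<Sum>\<^sub>\<infinity>l. ennreal ((cmod (L2_inner f (tf_shift (a * of_int k, 1 / p * of_int l) (two_sided_exp \<gamma>))))\<^sup>2)) =
    ennreal p * (\<integral>\<^sup>+s. ennreal ((cmod (P k s))\<^sup>2) \<partial>period_measure p)" for k
  proof -
    have "integrable (period_measure p) (\<lambda>s. (cmod (P k s))\<^sup>2)"
      by (rule integrable_norm_square_period[OF Pm P_le])
    then show ?thesis
      unfolding inner parseval_bounded[OF p Pm P_le] using p
      by (subst nn_integral_eq_integral) (auto simp: ennreal_mult)
  qed
  then have "gabor_sum (two_sided_exp \<gamma>) (rect_lattice a (1 / p)) f =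
    (\<Sum>\<^sub>\<infinity>k. ennreal p * (\<integral>\<^sup>+s. ennreal ((cmod (P k s))\<^sup>2) \<partial>period_measure p))"
    using a p by (subst gabor_sum_lattice) auto
  also have "\<dots> = ennreal p * (\<integral>\<^sup>+s. (\<Sum>\<^sub>\<infinity>k. ennreal ((cmod (P k s))\<^sup>2)) \<partial>period_measure p)"
    by (rule infsum_cmult_nn_integral_swap) (rule measurable_restrict_space1, measurable)
  also have "(\<integral>\<^sup>+s. (\<Sum>\<^sub>\<infinity>k. ennreal ((cmod (P k s))\<^sup>2)) \<partial>period_measure p) =
    (\<integral>\<^sup>+s. ennreal (\<gamma> * local_form n (\<gamma> * a) S (\<lambda>m. f (s + p * of_int m)) (\<gamma> * (s - a * \<lfloor>s / a\<rfloor>))) \<partial>period_measure p)"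
  proof (rule nn_integral_cong)
    fix s
    define q where "q = \<lfloor>s / a\<rfloor>"
    define y where "y = \<gamma> * (s - a * of_int q)"
    have "s \<in> {a * of_int q..<a * of_int q + a}" using periodic_cell[OF a, of s q] by (simp add: q_def)
    then have y: "0 \<le> y" "y \<le> \<gamma> * a" using \<gamma> by (auto simp: y_def)
    define d where "d = (\<lambda>m. f (s + p * of_int m))"
    have t: "\<gamma> * a > 0" using a \<gamma> by simp
    note has = local_frame_sum[OF n t S(1) y, of d q]
    have Pk: "(cmod (P k s))\<^sup>2 = \<gamma> * (cmod (\<Sum>m\<in>S. d m * of_real (exp (- \<bar>y + \<gamma> * a * of_int q + real n * (\<gamma> * a) * of_int m - \<gamma> * a * of_int k\<bar>))))\<^sup>2" for k
    proof -
      have "w (s + p * of_int m - a * of_int k) =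
        sqrt \<gamma> * exp (- \<bar>y + \<gamma> * a * of_int q + real n * (\<gamma> * a) * of_int m - \<gamma> * a * of_int k\<bar>)" for m
      proof -
        have "\<gamma> * \<bar>s + p * of_int m - a * of_int k\<bar> = \<bar>\<gamma> * (s + p * of_int m - a * of_int k)\<bar>"
          using \<gamma> by (simp add: abs_mult)
        also have "\<gamma> * (s + p * of_int m - a * of_int k) =
          y + \<gamma> * a * of_int q + real n * (\<gamma> * a) * of_int m - \<gamma> * a * of_int k"
          by (simp add: y_def p_def algebra_simps)
        finally show ?thesis by (simp add: w_def)
      qed
      then have "P k s = of_real (sqrt \<gamma>) * (\<Sum>m\<in>S. d m * of_real (exp (- \<bar>y + \<gamma> * a * of_int q + real n * (\<gamma> * a) * of_int m - \<gamma> * a * of_int k\<bar>)))"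
        by (simp add: P_def d_def sum_distrib_left mult_ac)
      then show ?thesis using \<gamma> by (simp add: norm_mult power_mult_distrib)
    qed
    have "((\<lambda>k. (cmod (P k s))\<^sup>2) has_sum \<gamma> * local_form n (\<gamma> * a) S d y) UNIV"
      unfolding Pk local_form_def Let_def by (rule has_sum_cmult_right[OF has])
    then have "(\<Sum>\<^sub>\<infinity>k. ennreal ((cmod (P k s))\<^sup>2)) = ennreal (\<gamma> * local_form n (\<gamma> * a) S d y)"
      by (rule infsum_ennreal_has_sum) simp
    then show "(\<Sum>\<^sub>\<infinity>k. ennreal ((cmod (P k s))\<^sup>2)) =
      ennreal (\<gamma> * local_form n (\<gamma> * a) S (\<lambda>m. f (s + p * of_int m)) (\<gamma> * (s - a * \<lfloor>s / a\<rfloor>)))"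
      by (simp add: d_def y_def q_def)
  qed
  finally show ?thesis .
qed

section \<open>Frame inequalities on the whole space\<close>

lemma upper_const_nonneg: "t > 0 \<Longrightarrow> 0 \<le> upper_const n t"
  unfolding upper_const_def using cosh_real_ge_1[of "real n * t"]
  by (intro divide_nonneg_nonneg add_nonneg_nonneg) auto

lemma local_form_bounds:
  assumes n: "n \<ge> 1" and t: "t > 0" and S: "finite S" "\<And>m. m \<notin> S \<Longrightarrow> d m = 0" and y: "0 \<le> y" "y \<le> t"
  shows "lower_const n t * (\<Sum>m\<in>S. (cmod (d m))\<^sup>2) \<le> local_form n t S d y"
    and "local_form n t S d y \<le> upper_const n t * (\<Sum>m\<in>S. (cmod (d m))\<^sup>2)"
proof -
  define x where "x = real n * t"
  define e where "e = green_conv x S d"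
  have x: "x > 0" using n t by (simp add: x_def)
  have h: "cosh x > 1" using x cosh_real_strict_mono[of 0 x] by simp
  have sq: "(\<lambda>j. (cmod (e j))\<^sup>2) summable_on UNIV"
    unfolding e_def by (rule green_conv_square_summable[OF x S(1)])
  have norm: "(\<Sum>m\<in>S. (cmod (d m))\<^sup>2) = (cosh x)\<^sup>2 * seq_energy e - 2 * cosh x * seq_corr e + seq_mean_energy e"
    unfolding e_def by (rule green_conv_norm[OF x S])
  have s: "sinh t > 0" "sinh x \<ge> 0" using t x by auto
  have c0: "real n \<le> sinh x / sinh t"
    using sinh_multiple_ge[OF t, of n] s by (simp add: x_def pos_le_divide_eq)
  note gain = local_gain_bounds[OF t y, of n, folded x_def]
  show "lower_const n t * (\<Sum>m\<in>S. (cmod (d m))\<^sup>2) \<le> local_form n t S d y"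
    unfolding lower_const_def local_form_def Let_def x_def[symmetric] e_def[symmetric] norm
    by (rule lower_form_inequality[OF h gain(1) c0 _ abs_seq_corr_le[OF sq] seq_mean_le[OF sq]]) simp
  show "local_form n t S d y \<le> upper_const n t * (\<Sum>m\<in>S. (cmod (d m))\<^sup>2)"
    unfolding upper_const_def local_form_def Let_def x_def[symmetric] e_def[symmetric] norm
    by (rule upper_form_inequality[OF h gain(2) _ _ abs_seq_corr_le[OF sq] seq_corr_mean[OF sq]])
      (use s in simp_all)
qed

lemma gabor_frame_inequality_bounded_support:
  assumes n: "n \<ge> 1" and a: "a > 0" and \<gamma>: "\<gamma> > 0"
    and f: "f \<in> borel_measurable borel" "\<And>t. cmod (f t) \<le> K" "\<And>t. \<bar>t\<bar> > R \<Longrightarrow> f t = 0"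
  defines "x \<equiv> real n * (\<gamma> * a)"
  shows "ennreal (x * lower_const n (\<gamma> * a) * L2_norm_sq f) \<le> gabor_sum (two_sided_exp \<gamma>) (rect_lattice a (1 / (real n * a))) f"
    and "gabor_sum (two_sided_exp \<gamma>) (rect_lattice a (1 / (real n * a))) f \<le> ennreal (x * upper_const n (\<gamma> * a) * L2_norm_sq f)"
proof -
  define p where "p = real n * a"
  have p: "p > 0" using n a by (simp add: p_def)
  have t: "\<gamma> * a > 0" using a \<gamma> by simp
  note [measurable] = f(1)
  obtain S where S: "finite S" "\<And>m s. m \<notin> S \<Longrightarrow> s \<in> {0..<p} \<Longrightarrow> f (s + p * of_int m) = 0"
    using bounded_support_cells[of p R f, OF p f(3)] by blast
  define D where "D = (\<lambda>s. \<Sum>m\<in>S. (cmod (f (s + p * of_int m)))\<^sup>2)"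
  have D0: "D s \<ge> 0" for s by (simp add: D_def sum_nonneg)
  have [measurable]: "D \<in> borel_measurable borel" unfolding D_def by measurable
  have "L2_norm_sq f = (LINT s|period_measure p. D s)"
    unfolding L2_norm_sq_def D_def
    by (rule integral_periodization(2)[OF p _ _ S(1), of _ "K\<^sup>2"]) (use f(2) S(2) in \<open>auto intro: power_mono\<close>)
  moreover have "integrable (period_measure p) D"
    unfolding D_def
    by (intro Bochner_Integration.integrable_sum integrable_norm_square_period[of _ K]) (use f(2) in auto)
  ultimately have N: "(\<integral>\<^sup>+s. ennreal (D s) \<partial>period_measure p) = ennreal (L2_norm_sq f)"
    using D0 by (simp add: nn_integral_eq_integral)
  have N0: "L2_norm_sq f \<ge> 0" by (simp add: L2_norm_sq_def)
  let ?Q = "\<lambda>s. local_form n (\<gamma> * a) S (\<lambda>m. f (s + p * of_int m)) (\<gamma> * (s - a * \<lfloor>s / a\<rfloor>))"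
  have G: "gabor_sum (two_sided_exp \<gamma>) (rect_lattice a (1 / (real n * a))) f =
      ennreal p * (\<integral>\<^sup>+s. ennreal (\<gamma> * ?Q s) \<partial>period_measure p)"
    using gabor_sum_bounded_support[OF n a \<gamma> f(1,2) S(1)] S(2) by (simp add: p_def)
  have Q: "lower_const n (\<gamma> * a) * D s \<le> ?Q s" "?Q s \<le> upper_const n (\<gamma> * a) * D s"
    if "s \<in> space (period_measure p)" for s
  proof -
    have s: "s \<in> {0..<p}" using that by (simp add: space_restrict_space)
    have "s \<in> {a * of_int \<lfloor>s / a\<rfloor>..<a * of_int \<lfloor>s / a\<rfloor> + a}" using periodic_cell[OF a, of s "\<lfloor>s / a\<rfloor>"] by simp
    then have y: "0 \<le> \<gamma> * (s - a * \<lfloor>s / a\<rfloor>)" "\<gamma> * (s - a * \<lfloor>s / a\<rfloor>) \<le> \<gamma> * a"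
      using \<gamma> by auto
    show "lower_const n (\<gamma> * a) * D s \<le> ?Q s" "?Q s \<le> upper_const n (\<gamma> * a) * D s"
      unfolding D_def by (rule local_form_bounds[OF n t S(1) _ y]; use S(2)[OF _ s] in simp)+
  qed
  have l0: "0 \<le> lower_const n (\<gamma> * a)" using t by (rule lower_const_nonneg)
  have u0: "0 \<le> upper_const n (\<gamma> * a)" using t by (rule upper_const_nonneg)
  have c: "ennreal p * (\<integral>\<^sup>+s. ennreal (\<gamma> * (c * D s)) \<partial>period_measure p) = ennreal (x * c * L2_norm_sq f)" if "0 \<le> c" for c
  proof -
    have "(\<integral>\<^sup>+s. ennreal (\<gamma> * (c * D s)) \<partial>period_measure p) = (\<integral>\<^sup>+s. ennreal (\<gamma> * c) * ennreal (D s) \<partial>period_measure p)"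
      using \<gamma> that by (simp add: ennreal_mult'[symmetric] mult.assoc)
    also have "\<dots> = ennreal (\<gamma> * c) * ennreal (L2_norm_sq f)"
      by (subst nn_integral_cmult) (simp_all add: N measurable_restrict_space1)
    finally show ?thesis using p \<gamma> that N0
      by (simp add: ennreal_mult'[symmetric] x_def p_def mult_ac)
  qed
  show "ennreal (x * lower_const n (\<gamma> * a) * L2_norm_sq f) \<le> gabor_sum (two_sided_exp \<gamma>) (rect_lattice a (1 / (real n * a))) f"
    unfolding G c[OF l0, symmetric]
    by (intro mult_left_mono nn_integral_mono ennreal_leI Q) (use \<gamma> in auto)
  show "gabor_sum (two_sided_exp \<gamma>) (rect_lattice a (1 / (real n * a))) f \<le> ennreal (x * upper_const n (\<gamma> * a) * L2_norm_sq f)"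
    unfolding G c[OF u0, symmetric]
    by (intro mult_left_mono nn_integral_mono ennreal_leI Q) (use \<gamma> in auto)
qed

lemma L2_mult_integrable:
  assumes "f \<in> L2" "h \<in> L2"
  shows "integrable lborel (\<lambda>t. f t * cnj (h t))"
proof (rule Bochner_Integration.integrable_bound)
  show "integrable lborel (\<lambda>t. (cmod (f t))\<^sup>2 + (cmod (h t))\<^sup>2)" using assms by (simp add: L2_def)
  have [measurable]: "f \<in> borel_measurable lborel" "h \<in> borel_measurable lborel" using assms by (auto simp: L2_def)
  show "(\<lambda>t. f t * cnj (h t)) \<in> borel_measurable lborel" by measurable
  have "cmod u * cmod v \<le> (cmod u)\<^sup>2 + (cmod v)\<^sup>2" for u v
    using sum_squares_bound[of "cmod u" "cmod v"] mult_nonneg_nonneg[OF norm_ge_zero[of u] norm_ge_zero[of v]] by linarith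
  then show "AE t in lborel. norm (f t * cnj (h t)) \<le> norm ((cmod (f t))\<^sup>2 + (cmod (h t))\<^sup>2)"
    by (simp add: norm_mult)
qed

lemma integrable_exp_abs:
  assumes "c > 0"
  shows "integrable lborel (\<lambda>t::real. exp (- c * \<bar>t\<bar>))"
proof -
  have "(\<lambda>t::real. exp (- c * t)) integrable_on {0..}"
    using has_integral_exp_minus_to_infinity[OF assms, of 0] by (auto simp: integrable_on_def)
  then have "(\<lambda>t::real. exp (- c * t)) absolutely_integrable_on {0..}"
    by (intro nonnegative_absolutely_integrable_1) auto
  then have 1: "integrable lborel (\<lambda>t. indicator {0..} t *\<^sub>R exp (- c * t))"
    unfolding set_integrable_def by (subst (asm) integrable_completion) auto
  from lborel_integrable_real_affine[OF this, of "-1" 0]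
  have 2: "integrable lborel (\<lambda>t. indicator {0..} (- t) *\<^sub>R exp (- c * (- t)))" by simp
  show ?thesis
  proof (rule Bochner_Integration.integrable_bound[OF Bochner_Integration.integrable_add[OF 1 2]])
    show "AE t in lborel. norm (exp (- c * \<bar>t\<bar>)) \<le>
      norm (indicator {0..} t *\<^sub>R exp (- c * t) + indicator {0..} (- t) *\<^sub>R exp (- c * (- t)))"
      by (intro AE_I2) (auto simp: indicator_def)
  qed simp
qed

lemma two_sided_exp_L2:
  assumes "\<gamma> > 0"
  shows "two_sided_exp \<gamma> \<in> L2"
proof -
  have "(cmod (two_sided_exp \<gamma> t))\<^sup>2 = \<gamma> * exp (- (2 * \<gamma>) * \<bar>t\<bar>)" for t
    using assms by (simp add: two_sided_exp_def norm_mult power_mult_distrib abs_mult)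
      (simp add: power2_eq_square flip: exp_add)
  moreover have "two_sided_exp \<gamma> \<in> borel_measurable lborel" unfolding two_sided_exp_def by measurable
  ultimately show ?thesis using integrable_exp_abs[of "2 * \<gamma>"] assms by (simp add: L2_def)
qed

lemma tf_shift_L2:
  assumes "g \<in> L2"
  shows "tf_shift p g \<in> L2"
proof -
  have [measurable]: "g \<in> borel_measurable borel" using assms by (simp add: L2_def)
  have "cmod (tf_shift p g t) = cmod (g (- fst p + 1 * t))" for t
    by (simp add: tf_shift_def norm_mult norm_exp_eq_Re)
  moreover have "integrable lborel (\<lambda>t. (cmod (g (- fst p + 1 * t)))\<^sup>2)"
    by (rule lborel_integrable_real_affine[of "\<lambda>t. (cmod (g t))\<^sup>2"]) (use assms in \<open>auto simp: L2_def\<close>)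
  moreover have "tf_shift p g \<in> borel_measurable lborel" unfolding tf_shift_def by measurable
  ultimately show ?thesis by (simp add: L2_def)
qed

text \<open>
  Cutting off both the domain and the values yields functions to which
  \<open>gabor_frame_inequality_bounded_support\<close> applies.
\<close>

definition truncate_fun :: "nat \<Rightarrow> (real \<Rightarrow> complex) \<Rightarrow> real \<Rightarrow> complex" where
  "truncate_fun N f t = (if \<bar>t\<bar> \<le> real N \<and> cmod (f t) \<le> real N then f t else 0)"

lemma truncate_fun_eventually: "eventually (\<lambda>N. truncate_fun N f t = f t) sequentially"
proof -
  obtain M :: nat where "max \<bar>t\<bar> (cmod (f t)) \<le> real M" using real_arch_simple by blast
  then show ?thesis
    unfolding eventually_sequentially by (intro exI[of _ M]) (auto simp: truncate_fun_def)
qed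

lemma cmod_truncate_le: "cmod (truncate_fun N f t) \<le> cmod (f t)" "cmod (f t - truncate_fun N f t) \<le> cmod (f t)"
  by (auto simp: truncate_fun_def)

lemma truncate_fun_measurable [measurable]:
  assumes [measurable]: "f \<in> borel_measurable borel"
  shows "truncate_fun N f \<in> borel_measurable borel"
  unfolding truncate_fun_def by measurable

lemma L2_dominated:
  assumes "f \<in> L2" "h \<in> borel_measurable borel" "\<And>t. cmod (h t) \<le> cmod (f t)"
  shows "h \<in> L2"
proof -
  have [measurable]: "h \<in> borel_measurable lborel" using assms by simp
  have "integrable lborel (\<lambda>t. (cmod (h t))\<^sup>2)"
    by (rule Bochner_Integration.integrable_bound[of _ "\<lambda>t. (cmod (f t))\<^sup>2"])
      (use assms in \<open>auto simp: L2_def intro!: power_mono\<close>)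
  then show ?thesis using assms by (simp add: L2_def)
qed

lemma truncate_fun_limits:
  assumes f: "f \<in> L2"
  shows "(\<lambda>N. L2_norm_sq (truncate_fun N f)) \<longlonglongrightarrow> L2_norm_sq f"
    and "(\<lambda>N. L2_norm_sq (\<lambda>t. f t - truncate_fun N f t)) \<longlonglongrightarrow> 0"
    and "h \<in> L2 \<Longrightarrow> (\<lambda>N. L2_inner (truncate_fun N f) h) \<longlonglongrightarrow> L2_inner f h"
proof -
  have [measurable]: "f \<in> borel_measurable borel" using f by (simp add: L2_def)
  have int: "integrable lborel (\<lambda>t. (cmod (f t))\<^sup>2)" using f by (simp add: L2_def)
  have lim: "(\<lambda>N. F (truncate_fun N f t)) \<longlonglongrightarrow> F (f t)" for F :: "complex \<Rightarrow> 'c::topological_space" and t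
    using truncate_fun_eventually[of f t] by (intro tendsto_eventually) (auto elim: eventually_mono)
  show "(\<lambda>N. L2_norm_sq (truncate_fun N f)) \<longlonglongrightarrow> L2_norm_sq f"
    unfolding L2_norm_sq_def
    by (rule integral_dominated_convergence[where w="\<lambda>t. (cmod (f t))\<^sup>2"])
      (use int lim[of "\<lambda>z. (cmod z)\<^sup>2"] cmod_truncate_le in \<open>auto intro!: power_mono\<close>)
  have "(\<lambda>N. L2_norm_sq (\<lambda>t. f t - truncate_fun N f t)) \<longlonglongrightarrow> (LINT t|(lborel :: real measure). 0)"
    unfolding L2_norm_sq_def
  proof (rule integral_dominated_convergence[where w="\<lambda>t. (cmod (f t))\<^sup>2"])
    show "AE t in lborel. (\<lambda>N. (cmod (f t - truncate_fun N f t))\<^sup>2) \<longlonglongrightarrow> 0"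
      using lim[of "\<lambda>z. (cmod (f t - z))\<^sup>2" t for t] by simp
  qed (use int cmod_truncate_le in \<open>auto intro!: power_mono\<close>)
  then show "(\<lambda>N. L2_norm_sq (\<lambda>t. f t - truncate_fun N f t)) \<longlonglongrightarrow> 0" by simp
  show "(\<lambda>N. L2_inner (truncate_fun N f) h) \<longlonglongrightarrow> L2_inner f h" if h: "h \<in> L2"
  proof -
    have [measurable]: "h \<in> borel_measurable borel" using h by (simp add: L2_def)
    show ?thesis
      unfolding L2_inner_def
    proof (rule integral_dominated_convergence[where w="\<lambda>t. cmod (f t * cnj (h t))"])
      show "integrable lborel (\<lambda>t. cmod (f t * cnj (h t)))"
        by (rule integrable_norm[OF L2_mult_integrable[OF f h]])
      show "AE t in lborel. (\<lambda>N. truncate_fun N f t * cnj (h t)) \<longlonglongrightarrow> f t * cnj (h t)"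
        using lim[of "\<lambda>z. z * cnj (h t)" t for t] by simp
      show "AE t in lborel. norm (truncate_fun N f t * cnj (h t)) \<le> cmod (f t * cnj (h t))" for N
        using cmod_truncate_le by (auto simp: norm_mult intro!: mult_right_mono)
    qed auto
  qed
qed

lemma gabor_sum_count_space:
  assumes "a > 0" "b > 0"
  shows "gabor_sum g (rect_lattice a b) f = (\<integral>\<^sup>+k. ennreal ((cmod (L2_inner f
    (tf_shift (a * of_int (fst k), b * of_int (snd k)) g)))\<^sup>2) \<partial>count_space (UNIV :: (int \<times> int) set))"
proof -
  have "infinite (UNIV :: (int \<times> int) set)"
    using infinite_UNIV_int by (simp add: finite_prod)
  then show ?thesis
    using infsum_int_prod_ennreal[of "\<lambda>k l. ennreal ((cmod (L2_inner f (tf_shift (a * of_int k, b * of_int l) g)))\<^sup>2)"]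
    unfolding gabor_sum_lattice[OF assms] by (simp add: infsum_count_space case_prod_unfold)
qed

text \<open>
  Each coefficient converges, so this is Fatou's lemma for the counting measure.
\<close>

lemma gabor_sum_le_liminf:
  assumes "a > 0" "b > 0" "g \<in> L2" "f \<in> L2"
  shows "gabor_sum g (rect_lattice a b) f \<le> liminf (\<lambda>N. gabor_sum g (rect_lattice a b) (truncate_fun N f))"
proof -
  let ?c = "\<lambda>f (k :: int \<times> int). ennreal ((cmod (L2_inner f (tf_shift (a * of_int (fst k), b * of_int (snd k)) g)))\<^sup>2)"
  have "(\<lambda>N. ?c (truncate_fun N f) k) \<longlonglongrightarrow> ?c f k" for k
    by (intro tendsto_ennrealI tendsto_intros truncate_fun_limits(3) assms tf_shift_L2)
  then have "liminf (\<lambda>N. ?c (truncate_fun N f) k) = ?c f k" for k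
    by (intro lim_imp_Liminf) auto
  then have "gabor_sum g (rect_lattice a b) f = (\<integral>\<^sup>+k. liminf (\<lambda>N. ?c (truncate_fun N f) k) \<partial>count_space UNIV)"
    unfolding gabor_sum_count_space[OF assms(1,2)] by simp
  also have "\<dots> \<le> liminf (\<lambda>N. gabor_sum g (rect_lattice a b) (truncate_fun N f))"
    unfolding gabor_sum_count_space[OF assms(1,2)] by (rule nn_integral_liminf) simp
  finally show ?thesis .
qed

lemma square_add_le_weighted:
  fixes u v \<epsilon> :: real
  assumes "\<epsilon> > 0"
  shows "(u + v)\<^sup>2 \<le> (1 + \<epsilon>) * u\<^sup>2 + (1 + 1 / \<epsilon>) * v\<^sup>2"
proof -
  have "0 \<le> (\<epsilon> * u - v)\<^sup>2 / \<epsilon>" using assms by simp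
  also have "(\<epsilon> * u - v)\<^sup>2 / \<epsilon> = \<epsilon> * u\<^sup>2 + v\<^sup>2 / \<epsilon> - 2 * u * v"
    using assms by (simp add: power2_eq_square field_simps)
  finally show ?thesis by (simp add: power2_sum algebra_simps)
qed

lemma gabor_sum_triangle:
  assumes "a > 0" "b > 0" and g: "g \<in> L2" and f: "f \<in> L2" "h \<in> L2" and \<epsilon>: "\<epsilon> > 0"
  shows "gabor_sum g (rect_lattice a b) h \<le> ennreal (1 + \<epsilon>) * gabor_sum g (rect_lattice a b) f
     + ennreal (1 + 1 / \<epsilon>) * gabor_sum g (rect_lattice a b) (\<lambda>t. f t - h t)"
proof -
  have "ennreal ((cmod (L2_inner h \<phi>))\<^sup>2) \<le> ennreal (1 + \<epsilon>) * ennreal ((cmod (L2_inner f \<phi>))\<^sup>2)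
     + ennreal (1 + 1 / \<epsilon>) * ennreal ((cmod (L2_inner (\<lambda>t. f t - h t) \<phi>))\<^sup>2)" if "\<phi> \<in> L2" for \<phi>
  proof -
    have "L2_inner (\<lambda>t. f t - h t) \<phi> = L2_inner f \<phi> - L2_inner h \<phi>"
      unfolding L2_inner_def left_diff_distrib
      by (intro Bochner_Integration.integral_diff L2_mult_integrable f that)
    then have "cmod (L2_inner h \<phi>) \<le> cmod (L2_inner f \<phi>) + cmod (L2_inner (\<lambda>t. f t - h t) \<phi>)"
      using norm_triangle_ineq4[of "L2_inner f \<phi>" "L2_inner (\<lambda>t. f t - h t) \<phi>"] by simp
    then have "(cmod (L2_inner h \<phi>))\<^sup>2 \<le> (cmod (L2_inner f \<phi>) + cmod (L2_inner (\<lambda>t. f t - h t) \<phi>))\<^sup>2"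
      by (simp add: power_mono)
    also have "\<dots> \<le> (1 + \<epsilon>) * (cmod (L2_inner f \<phi>))\<^sup>2 + (1 + 1 / \<epsilon>) * (cmod (L2_inner (\<lambda>t. f t - h t) \<phi>))\<^sup>2"
      by (rule square_add_le_weighted[OF \<epsilon>])
    finally show ?thesis using \<epsilon>
      by (simp add: ennreal_mult'[symmetric] ennreal_leI flip: ennreal_plus)
  qed
  then show ?thesis
    unfolding gabor_sum_count_space[OF assms(1,2)] using tf_shift_L2[OF g]
    by (subst (1 2) nn_integral_cmult[symmetric], simp, simp, subst nn_integral_add[symmetric], simp, simp)
      (intro nn_integral_mono, simp)
qed

text \<open>
  The upper inequality passes to the limit by Fatou's lemma. For the lower one the sum for the
  truncation has to be bounded by the sum for \<open>f\<close>: the square root of the Gabor sum is a seminorm, here in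
  the form of a weighted inequality between squares, and the sum for the remainder is small by the
  upper inequality.
\<close>

theorem gabor_frame_inequality:
  assumes n: "n \<ge> 1" and a: "a > 0" and \<gamma>: "\<gamma> > 0" and f: "f \<in> L2"
  defines "x \<equiv> real n * (\<gamma> * a)"
  shows "ennreal (x * lower_const n (\<gamma> * a) * L2_norm_sq f) \<le> gabor_sum (two_sided_exp \<gamma>) (rect_lattice a (1 / (real n * a))) f"
    and "gabor_sum (two_sided_exp \<gamma>) (rect_lattice a (1 / (real n * a))) f \<le> ennreal (x * upper_const n (\<gamma> * a) * L2_norm_sq f)"
proof -
  let ?G = "gabor_sum (two_sided_exp \<gamma>) (rect_lattice a (1 / (real n * a)))"
  define A B where "A = x * lower_const n (\<gamma> * a)" and "B = x * upper_const n (\<gamma> * a)"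
  have b: "1 / (real n * a) > 0" using n a by simp
  have t: "\<gamma> * a > 0" using \<gamma> a by simp
  note g = two_sided_exp_L2[OF \<gamma>]
  have fm[measurable]: "f \<in> borel_measurable borel" using f by (simp add: L2_def)
  have tr: "truncate_fun N f \<in> L2" "(\<lambda>t. f t - truncate_fun N f t) \<in> L2" for N
    by (rule L2_dominated[OF f]; use cmod_truncate_le in simp)+
  have upper: "?G f \<le> ennreal (B * L2_norm_sq f)" if f: "f \<in> L2" for f
  proof -
    have [measurable]: "f \<in> borel_measurable borel" using f by (simp add: L2_def)
    have "?G f \<le> liminf (\<lambda>N. ?G (truncate_fun N f))" by (rule gabor_sum_le_liminf[OF a b g f])
    also have "\<dots> \<le> liminf (\<lambda>N. ennreal (B * L2_norm_sq (truncate_fun N f)))"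
    proof (intro Liminf_mono always_eventually allI)
      fix N
      show "?G (truncate_fun N f) \<le> ennreal (B * L2_norm_sq (truncate_fun N f))"
        unfolding B_def x_def
        by (rule gabor_frame_inequality_bounded_support(2)[OF n a \<gamma>, of _ "real N" "real N"])
          (auto simp: truncate_fun_def)
    qed
    also have "\<dots> = ennreal (B * L2_norm_sq f)"
      by (intro lim_imp_Liminf tendsto_ennrealI tendsto_intros truncate_fun_limits(1) f) simp
    finally show ?thesis .
  qed
  from upper[OF f] show "?G f \<le> ennreal (x * upper_const n (\<gamma> * a) * L2_norm_sq f)" by (simp add: B_def)
  obtain G where G: "?G f = ennreal G" "G \<ge> 0"
    using upper[OF f] by (cases "?G f") (auto simp: top_unique)
  have B0: "B \<ge> 0" unfolding B_def x_def using t a \<gamma> by (intro mult_nonneg_nonneg upper_const_nonneg) auto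
  have step: "A * L2_norm_sq f \<le> (1 + \<epsilon>) * G" if \<epsilon>: "\<epsilon> > 0" for \<epsilon>
  proof (rule LIMSEQ_le)
    show "(\<lambda>N. A * L2_norm_sq (truncate_fun N f)) \<longlonglongrightarrow> A * L2_norm_sq f"
      by (intro tendsto_intros truncate_fun_limits(1) f)
    have "(\<lambda>N. (1 + \<epsilon>) * G + (1 + 1 / \<epsilon>) * (B * L2_norm_sq (\<lambda>t. f t - truncate_fun N f t))) \<longlonglongrightarrow> (1 + \<epsilon>) * G + (1 + 1 / \<epsilon>) * (B * 0)"
      by (intro tendsto_intros truncate_fun_limits(2) f)
    then show "(\<lambda>N. (1 + \<epsilon>) * G + (1 + 1 / \<epsilon>) * (B * L2_norm_sq (\<lambda>t. f t - truncate_fun N f t))) \<longlonglongrightarrow> (1 + \<epsilon>) * G" by simp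
    have "A * L2_norm_sq (truncate_fun N f) \<le> (1 + \<epsilon>) * G + (1 + 1 / \<epsilon>) * (B * L2_norm_sq (\<lambda>t. f t - truncate_fun N f t))" for N
    proof -
      have N0: "L2_norm_sq (\<lambda>t. f t - truncate_fun N f t) \<ge> 0" by (simp add: L2_norm_sq_def)
      have "ennreal (A * L2_norm_sq (truncate_fun N f)) \<le> ?G (truncate_fun N f)"
        unfolding A_def x_def
        by (rule gabor_frame_inequality_bounded_support(1)[OF n a \<gamma>, of _ "real N" "real N"])
          (auto simp: truncate_fun_def)
      also have "\<dots> \<le> ennreal (1 + \<epsilon>) * ?G f + ennreal (1 + 1 / \<epsilon>) * ?G (\<lambda>t. f t - truncate_fun N f t)"
        by (rule gabor_sum_triangle[OF a b g f tr(1) \<epsilon>])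
      also have "\<dots> \<le> ennreal (1 + \<epsilon>) * ennreal G + ennreal (1 + 1 / \<epsilon>) * ennreal (B * L2_norm_sq (\<lambda>t. f t - truncate_fun N f t))"
        unfolding G(1) by (intro add_mono mult_left_mono upper tr order_refl) auto
      also have "\<dots> = ennreal ((1 + \<epsilon>) * G + (1 + 1 / \<epsilon>) * (B * L2_norm_sq (\<lambda>t. f t - truncate_fun N f t)))"
        using \<epsilon> G(2) B0 N0 by (simp add: ennreal_mult'[symmetric] flip: ennreal_plus)
      finally show ?thesis
        using \<epsilon> G(2) B0 N0 by (subst (asm) ennreal_le_iff) (auto intro!: add_nonneg_nonneg mult_nonneg_nonneg)
    qed
    then show "\<exists>M. \<forall>N\<ge>M. A * L2_norm_sq (truncate_fun N f) \<le> (1 + \<epsilon>) * G + (1 + 1 / \<epsilon>) * (B * L2_norm_sq (\<lambda>t. f t - truncate_fun N f t))"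
      by blast
  qed
  have "A * L2_norm_sq f \<le> G"
  proof (rule field_le_epsilon)
    fix e :: real assume e: "e > 0"
    \<comment> \<open>\<open>e / (G + 1)\<close> instead of \<open>e / G\<close>, since \<open>G\<close> may vanish\<close>
    have "A * L2_norm_sq f \<le> (1 + e / (G + 1)) * G" using e G(2) by (intro step) simp
    also have "\<dots> \<le> G + e" using e G(2) by (simp add: field_simps)
    finally show "A * L2_norm_sq f \<le> G + e" .
  qed
  then show "ennreal (x * lower_const n (\<gamma> * a) * L2_norm_sq f) \<le> ?G f"
    unfolding G(1) by (simp add: A_def ennreal_leI)
qed

section \<open>Sharpness of the frame bounds\<close>

text \<open>
  The test functions put the same sequence \<open>d\<close> over every point of a short interval, so that the Gabor
  sum is an average of \<open>local_form\<close> for this one sequence over the interval.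
\<close>

lemma gabor_sum_test_function:
  assumes n: "n \<ge> 1" and a: "a > 0" and \<gamma>: "\<gamma> > 0"
    and S: "finite S" "\<And>m. m \<notin> S \<Longrightarrow> d m = 0"
    and I: "0 \<le> s0" "\<delta> > 0" "s0 + \<delta> \<le> a"
  shows "\<exists>f\<in>L2. L2_norm_sq f = \<delta> * (\<Sum>m\<in>S. (cmod (d m))\<^sup>2) \<and>
    gabor_sum (two_sided_exp \<gamma>) (rect_lattice a (1 / (real n * a))) f =
      ennreal (real n * a) * (\<integral>\<^sup>+s\<in>{s0..<s0 + \<delta>}. ennreal (\<gamma> * local_form n (\<gamma> * a) S d (\<gamma> * s)) \<partial>lborel)"
proof -
  define p where "p = real n * a"
  have p: "p > 0" using n a by (simp add: p_def)
  have "1 * a \<le> real n * a" using n a by (intro mult_right_mono) auto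
  then have ap: "a \<le> p" by (simp add: p_def)
  have t: "\<gamma> * a > 0" using a \<gamma> by simp
  define I where "I = {s0..<s0 + \<delta>}"
  have Ip: "I \<subseteq> {0..<p}" using I ap by (auto simp: I_def)
  define f where "f = (\<lambda>t. d \<lfloor>t / p\<rfloor> * indicator I (t - p * of_int \<lfloor>t / p\<rfloor>))"
  have fm: "f \<in> borel_measurable borel"
  proof -
    have "(\<lambda>t::real. \<lfloor>t / p\<rfloor>) \<in> borel \<rightarrow>\<^sub>M count_space UNIV" by measurable
    from measurable_compose[OF this, of d borel] have [measurable]: "(\<lambda>t. d \<lfloor>t / p\<rfloor>) \<in> borel_measurable borel" by simp
    have [measurable]: "I \<in> sets borel" by (simp add: I_def)
    show ?thesis unfolding f_def by measurable
  qed
  note [measurable] = fm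
  have fs: "f (s + p * of_int m) = d m * indicator I s" if "s \<in> {0..<p}" for s m
  proof -
    have "s + p * of_int m \<in> {p * of_int m..<p * of_int m + p}" using that by simp
    then have "\<lfloor>(s + p * of_int m) / p\<rfloor> = m" by (rule periodic_cell[OF p, THEN iffD1, symmetric])
    then show ?thesis by (simp add: f_def)
  qed
  have f_le: "cmod (f t) \<le> (\<Sum>m\<in>S. cmod (d m))" for t
  proof -
    have "cmod (d m) \<le> (\<Sum>m\<in>S. cmod (d m))" for m
      using S member_le_sum[of m S "\<lambda>m. cmod (d m)"] by (cases "m \<in> S") (auto intro: sum_nonneg)
    moreover have "cmod (f t) \<le> cmod (d \<lfloor>t / p\<rfloor>)" by (simp add: f_def norm_mult indicator_def)
    ultimately show ?thesis by (rule order_trans[rotated])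
  qed
  have f0: "f (s + p * of_int m) = 0" if "m \<notin> S" "s \<in> {0..<p}" for m s
    using fs[OF that(2)] S(2)[OF that(1)] by simp
  have per: "integrable lborel (\<lambda>t. (cmod (f t))\<^sup>2)"
     "(LINT t|lborel. (cmod (f t))\<^sup>2) = (LINT s|period_measure p. (\<Sum>m\<in>S. (cmod (f (s + p * of_int m)))\<^sup>2))"
    by (rule integral_periodization[OF p _ _ S(1), of _ "(\<Sum>m\<in>S. cmod (d m))\<^sup>2"];
      use f_le f0 in \<open>auto intro: power_mono\<close>)+
  have "f \<in> L2" using per(1) by (simp add: L2_def)
  moreover have "L2_norm_sq f = \<delta> * (\<Sum>m\<in>S. (cmod (d m))\<^sup>2)"
  proof -
    have "L2_norm_sq f = (LINT s|period_measure p. (\<Sum>m\<in>S. (cmod (d m))\<^sup>2) * indicator I s)"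
      unfolding L2_norm_sq_def per(2)
      by (intro Bochner_Integration.integral_cong refl)
        (auto simp: space_restrict_space fs norm_mult power_mult_distrib sum_distrib_right indicator_def)
    also have "\<dots> = (LINT s|lborel. indicator {0..<p} s *\<^sub>R ((\<Sum>m\<in>S. (cmod (d m))\<^sup>2) * indicator I s))"
      by (rule integral_restrict_space) simp
    also have "\<dots> = (LINT s|lborel. (\<Sum>m\<in>S. (cmod (d m))\<^sup>2) * indicator I s)"
      using Ip by (intro Bochner_Integration.integral_cong refl) (auto simp: indicator_def)
    also have "\<dots> = \<delta> * (\<Sum>m\<in>S. (cmod (d m))\<^sup>2)"
      using I by (simp add: I_def)
    finally show ?thesis .
  qed
  moreover have "gabor_sum (two_sided_exp \<gamma>) (rect_lattice a (1 / (real n * a))) f =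
      ennreal (real n * a) * (\<integral>\<^sup>+s\<in>{s0..<s0 + \<delta>}. ennreal (\<gamma> * local_form n (\<gamma> * a) S d (\<gamma> * s)) \<partial>lborel)"
  proof -
    have zero: "local_form n (\<gamma> * a) S (\<lambda>m. 0) y = 0" if "0 \<le> y" "y \<le> \<gamma> * a" for y
      using local_form_bounds[OF n t S(1) _ that, of "\<lambda>_. 0"] by auto
    have "gabor_sum (two_sided_exp \<gamma>) (rect_lattice a (1 / p)) f =
      ennreal p * (\<integral>\<^sup>+s. ennreal (\<gamma> * local_form n (\<gamma> * a) S (\<lambda>m. f (s + p * of_int m)) (\<gamma> * (s - a * \<lfloor>s / a\<rfloor>))) \<partial>period_measure p)"
      unfolding p_def by (rule gabor_sum_bounded_support[OF n a \<gamma> fm f_le S(1)]) (use f0 in \<open>simp add: p_def\<close>)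
    also have "(\<integral>\<^sup>+s. ennreal (\<gamma> * local_form n (\<gamma> * a) S (\<lambda>m. f (s + p * of_int m)) (\<gamma> * (s - a * \<lfloor>s / a\<rfloor>))) \<partial>period_measure p) =
      (\<integral>\<^sup>+s. ennreal (\<gamma> * local_form n (\<gamma> * a) S d (\<gamma> * s)) * indicator I s \<partial>period_measure p)"
    proof (rule nn_integral_cong)
      fix s assume "s \<in> space (period_measure p)"
      then have s: "s \<in> {0..<p}" by (simp add: space_restrict_space)
      show "ennreal (\<gamma> * local_form n (\<gamma> * a) S (\<lambda>m. f (s + p * of_int m)) (\<gamma> * (s - a * \<lfloor>s / a\<rfloor>))) =
        ennreal (\<gamma> * local_form n (\<gamma> * a) S d (\<gamma> * s)) * indicator I s"
      proof (cases "s \<in> I")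
        case True
        then have "s \<in> {a * of_int 0..<a * of_int 0 + a}" using I by (auto simp: I_def)
        then have "\<lfloor>s / a\<rfloor> = 0" using periodic_cell[OF a, of s 0] by simp
        then show ?thesis using True fs[OF s] by simp
      next
        case False
        have "s \<in> {a * of_int \<lfloor>s / a\<rfloor>..<a * of_int \<lfloor>s / a\<rfloor> + a}" using periodic_cell[OF a, of s "\<lfloor>s / a\<rfloor>"] by simp
        then have y: "0 \<le> \<gamma> * (s - a * \<lfloor>s / a\<rfloor>)" "\<gamma> * (s - a * \<lfloor>s / a\<rfloor>) \<le> \<gamma> * a"
          using \<gamma> by auto
        show ?thesis using False zero[OF y] fs[OF s] by simp
      qed
    qed
    also have "\<dots> = (\<integral>\<^sup>+s. ennreal (\<gamma> * local_form n (\<gamma> * a) S d (\<gamma> * s)) * indicator I s * indicator {0..<p} s \<partial>lborel)"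
      by (rule nn_integral_restrict_space) simp
    also have "\<dots> = (\<integral>\<^sup>+s. ennreal (\<gamma> * local_form n (\<gamma> * a) S d (\<gamma> * s)) * indicator I s \<partial>lborel)"
      using Ip by (intro nn_integral_cong) (auto simp: indicator_def)
    finally show ?thesis by (simp add: I_def p_def)
  qed
  ultimately show ?thesis by blast
qed

text \<open>
  In both bounds for the norm of \<open>d\<close> the main term \<open>(cosh x - \<sigma>)\<^sup>2 N\<close> grows with \<open>N\<close>, and the error does
  not. For the lower estimate, \<open>\<kappa>\<close> is at least \<open>N - 2\<close>, since the sum of the
  \<open>|\<sigma> e j - (e (j + 1) + e (j - 1)) / 2|\<^sup>2\<close> is nonnegative.
\<close>

lemma near_extremal_data:
  assumes x: "x > 0" and N: "N \<ge> (1::nat)" and \<sigma>: "\<sigma> = 1 \<or> \<sigma> = -1"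
  shows "\<exists>S d. finite S \<and> (\<forall>m. m \<notin> S \<longrightarrow> d m = 0) \<and>
    seq_energy (green_conv x S d) = real N \<and> seq_corr (green_conv x S d) = \<sigma> * (real N - 1) \<and>
    (cosh x - \<sigma>)\<^sup>2 * real N - 2 * (cosh x + 1) \<le> (\<Sum>m\<in>S. (cmod (d m))\<^sup>2) \<and>
    (\<Sum>m\<in>S. (cmod (d m))\<^sup>2) \<le> (cosh x - \<sigma>)\<^sup>2 * real N + 2 * cosh x"
proof -
  from near_extremal_sequence[OF assms] obtain S d where
    S: "finite S" "\<And>m. m \<notin> S \<Longrightarrow> d m = 0" and E: "seq_energy (green_conv x S d) = real N"
    and q: "seq_corr (green_conv x S d) = \<sigma> * (real N - 1)" by blast
  let ?e = "green_conv x S d"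
  have sq: "(\<lambda>j. (cmod (?e j))\<^sup>2) summable_on UNIV" by (rule green_conv_square_summable[OF x S(1)])
  have norm: "(\<Sum>m\<in>S. (cmod (d m))\<^sup>2) = (cosh x)\<^sup>2 * seq_energy ?e - 2 * cosh x * seq_corr ?e + seq_mean_energy ?e"
    by (rule green_conv_norm[OF x S])
  have h: "cosh x \<ge> 1" by (rule cosh_real_ge_1)
  have up: "seq_mean_energy ?e \<le> real N" using seq_mean_le[OF sq] E by simp
  have "0 \<le> \<sigma>\<^sup>2 * seq_energy ?e - 2 * \<sigma> * seq_corr ?e + seq_mean_energy ?e"
    by (rule has_sum_nonneg[OF seq_difference_has_sum[OF sq]]) simp
  then have "real N - 2 \<le> seq_mean_energy ?e"
    using \<sigma> by (auto simp: E q)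
  with \<sigma> h up have
    "(cosh x - \<sigma>)\<^sup>2 * real N - 2 * (cosh x + 1) \<le> (\<Sum>m\<in>S. (cmod (d m))\<^sup>2)"
    "(\<Sum>m\<in>S. (cmod (d m))\<^sup>2) \<le> (cosh x - \<sigma>)\<^sup>2 * real N + 2 * cosh x"
    unfolding norm E q by (auto simp: power2_eq_square algebra_simps)
  then show ?thesis using S E q by blast
qed

text \<open>
  The test functions belong to alternating sequences \<open>e\<close> of length \<open>N\<close>, placed over an interval of
  length \<open>a / (2 N)\<close> next to the middle of a cell, where the gain is smallest. As \<open>N\<close> grows the interval
  shrinks to its end point, and the quotient of Gabor sum and norm tends to the asserted bound.
\<close>

theorem lower_frame_bound_two_sided_exp:
  assumes n: "n \<ge> 1" and a: "a > 0" and \<gamma>: "\<gamma> > 0"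
  defines "t \<equiv> \<gamma> * a"
  shows "lower_frame_bound (two_sided_exp \<gamma>) (rect_lattice a (1 / (real n * a))) = ennreal (real n * t * lower_const n t)"
proof -
  let ?G = "gabor_sum (two_sided_exp \<gamma>) (rect_lattice a (1 / (real n * a)))"
  define x where "x = real n * t"
  define h where "h = cosh x"
  define c0 where "c0 = sinh x / sinh t"
  have t: "t > 0" using a \<gamma> by (simp add: t_def)
  have x: "x > 0" using t n by (simp add: x_def)
  have h: "h \<ge> 1" by (simp add: h_def cosh_real_ge_1)
  have l0: "0 \<le> lower_const n t" by (rule lower_const_nonneg[OF t])
  have lc: "lower_const n t = (c0 - real n) / (h + 1)"
    by (simp add: lower_const_def c0_def h_def x_def)
  show ?thesis
    unfolding lower_frame_bound_def
  proof (rule Sup_eqI)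
    fix A assume "\<And>y. y \<in> {A. \<forall>f\<in>L2. A * ennreal (L2_norm_sq f) \<le> ?G f} \<Longrightarrow> y \<le> A"
    moreover have "ennreal (x * lower_const n t) * ennreal (L2_norm_sq f) \<le> ?G f" if "f \<in> L2" for f
      using gabor_frame_inequality(1)[OF n a \<gamma> that] x l0
      by (simp add: ennreal_mult'[symmetric] x_def t_def)
    ultimately show "ennreal (real n * t * lower_const n t) \<le> A" by (simp add: x_def)
  next
    fix A assume "A \<in> {A. \<forall>f\<in>L2. A * ennreal (L2_norm_sq f) \<le> ?G f}"
    then have A: "\<And>f. f \<in> L2 \<Longrightarrow> A * ennreal (L2_norm_sq f) \<le> ?G f" by blast
    define c where "c = (\<lambda>N::nat. local_gain n t (t / 2 + \<gamma> * (a / (2 * real N))))"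
    have key: "A * ennreal D \<le> ennreal (x * ((c N - real n) * (h + 1) * real N + real n * h))"
      if N: "N \<ge> 1" and D: "D \<le> (h + 1)\<^sup>2 * real N - 2 * (h + 1)" for N D
    proof -
      define \<delta> where "\<delta> = a / (2 * real N)"
      have "a * 1 \<le> a * real N" using N a by (intro mult_left_mono) auto
      then have \<delta>: "\<delta> > 0" "a / 2 + \<delta> \<le> a" using a N by (auto simp: \<delta>_def field_simps)
      obtain S d where S: "finite S" "\<And>m. m \<notin> S \<Longrightarrow> d m = 0" and E: "seq_energy (green_conv x S d) = real N"
        and q: "seq_corr (green_conv x S d) = (-1) * (real N - 1)"
        and D': "(cosh x - (-1))\<^sup>2 * real N - 2 * (cosh x + 1) \<le> (\<Sum>m\<in>S. (cmod (d m))\<^sup>2)"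
        using near_extremal_data[OF x N, of "-1"] by auto
      obtain f where f: "f \<in> L2" "L2_norm_sq f = \<delta> * (\<Sum>m\<in>S. (cmod (d m))\<^sup>2)"
        and G: "?G f = ennreal (real n * a) * (\<integral>\<^sup>+s\<in>{a / 2..<a / 2 + \<delta>}. ennreal (\<gamma> * local_form n (\<gamma> * a) S d (\<gamma> * s)) \<partial>lborel)"
        using gabor_sum_test_function[of n a \<gamma> S d "a / 2" \<delta>, OF n a \<gamma> S _ \<delta>] a by auto
      define L where "L = (c N - real n) * (h + 1) * real N + real n * h"
      have form: "local_form n t S d (\<gamma> * s) \<le> L" if s: "s \<in> {a / 2..<a / 2 + \<delta>}" for s
      proof -
        have "cosh (t - 2 * (\<gamma> * s)) = cosh (2 * (\<gamma> * s) - t)" using cosh_minus[of "t - 2 * (\<gamma> * s)"] by simp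
        also have "\<dots> \<le> cosh (2 * (t / 2 + \<gamma> * \<delta>) - t)"
        proof (subst cosh_real_nonneg_le_iff)
          have "\<gamma> * (a / 2) \<le> \<gamma> * s" "\<gamma> * s \<le> \<gamma> * (a / 2 + \<delta>)" using s \<gamma> by (intro mult_left_mono; simp)+
          then show "0 \<le> 2 * (\<gamma> * s) - t" "2 * (\<gamma> * s) - t \<le> 2 * (t / 2 + \<gamma> * \<delta>) - t"
            by (simp_all add: t_def algebra_simps)
          then show "0 \<le> 2 * (t / 2 + \<gamma> * \<delta>) - t" by linarith
        qed
        also have "\<dots> = cosh (t - 2 * (t / 2 + \<gamma> * \<delta>))" using cosh_minus[of "t - 2 * (t / 2 + \<gamma> * \<delta>)"] by simp
        finally have gain: "local_gain n t (\<gamma> * s) \<le> c N"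
          unfolding local_gain_def c_def \<delta>_def[symmetric] using x t
          by (intro divide_right_mono mult_left_mono) (auto simp: x_def)
        have g0: "0 \<le> local_gain n t (\<gamma> * s)" unfolding local_gain_def using x t by (simp add: x_def)
        \<comment> \<open>insert \<open>E = N\<close> and \<open>q = - (N - 1)\<close>\<close>
        have "local_form n t S d (\<gamma> * s) = local_gain n t (\<gamma> * s) * (h * real N + (real N - 1)) + real n * (- h * (real N - 1) - real N)"
          unfolding local_form_def Let_def x_def[symmetric] E q h_def by (simp add: algebra_simps)
        also have "\<dots> \<le> local_gain n t (\<gamma> * s) * ((h + 1) * real N) + real n * (- h * (real N - 1) - real N)"
          using g0 by (intro add_right_mono mult_left_mono) (auto simp: algebra_simps)
        also have "\<dots> \<le> c N * ((h + 1) * real N) + real n * (- h * (real N - 1) - real N)"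
          using gain h by (intro add_right_mono mult_right_mono) auto
        also have "\<dots> = L" by (simp add: L_def algebra_simps)
        finally show ?thesis .
      qed
      have "A * ennreal (\<delta> * D) \<le> A * ennreal (\<delta> * (\<Sum>m\<in>S. (cmod (d m))\<^sup>2))"
        using D D' \<delta> by (intro mult_left_mono ennreal_leI) (auto simp: h_def)
      also have "\<dots> \<le> ?G f" using A[OF f(1)] by (simp add: f(2))
      also have "\<dots> \<le> ennreal (real n * a) * (\<integral>\<^sup>+s. ennreal (\<gamma> * L) * indicator {a / 2..<a / 2 + \<delta>} s \<partial>lborel)"
        unfolding G using form \<gamma>
        by (intro mult_left_mono nn_integral_mono) (auto simp: indicator_def t_def intro!: ennreal_leI)
      also have "\<dots> = ennreal (real n * a) * (ennreal (\<gamma> * L) * ennreal \<delta>)"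
        using \<delta> by (simp add: nn_integral_cmult)
      also have "\<dots> = ennreal (x * L) * ennreal \<delta>"
        using n a \<gamma> \<delta> by (simp add: ennreal_mult'[symmetric] mult_ac x_def t_def flip: ennreal_mult'')
      also have "ennreal (\<delta> * D) = ennreal \<delta> * ennreal D" using \<delta> by (simp add: ennreal_mult')
      finally have "ennreal \<delta> * (A * ennreal D) \<le> ennreal \<delta> * ennreal (x * L)"
        by (simp only: mult_ac)
      then show ?thesis
        using \<delta> unfolding L_def by (subst (asm) ennreal_mult_le_mult_iff) auto
    qed
    have "A \<noteq> top"
    proof
      assume "A = top"
      then have "A * ennreal 1 = top" by simp
      \<comment> \<open>so large that the lower estimate for the norm of the test sequence is positive\<close>
      define N where "N = nat \<lceil>2 * (h + 1) + 1\<rceil>"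
      have N: "real N \<ge> 2 * (h + 1) + 1" unfolding N_def by linarith
      have "real N * 1 \<le> real N * (h + 1)\<^sup>2" using h by (intro mult_left_mono one_le_power) auto
      then have "1 \<le> (h + 1)\<^sup>2 * real N - 2 * (h + 1)" using N by (simp add: mult.commute)
      moreover have "N \<ge> 1" using N h by simp
      ultimately have "A * ennreal 1 \<le> ennreal (x * ((c N - real n) * (h + 1) * real N + real n * h))" by (rule key[rotated])
      with \<open>A * ennreal 1 = top\<close> show False by (simp add: top_unique)
    qed
    then obtain r where r: "A = ennreal r" "r \<ge> 0" by (cases A) auto
    have ineq: "r * ((h + 1)\<^sup>2 - 2 * (h + 1) / real N) \<le> x * (h + 1) * (c N - real n) + x * real n * h / real N"
      if N: "N \<ge> 1" for N
    proof -
      have N0: "real N > 0" using N by simp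
      have "\<gamma> * (a / (2 * real N)) \<le> \<gamma> * (a / 2)"
        using \<gamma> a N by (intro mult_left_mono divide_left_mono) auto
      then have "0 \<le> t / 2 + \<gamma> * (a / (2 * real N))" "t / 2 + \<gamma> * (a / (2 * real N)) \<le> t"
        using \<gamma> a t by (auto simp: t_def)
      note gain = local_gain_bounds(1)[OF t this, of n]
      have "real n \<le> sinh (real n * t) / sinh t"
        using sinh_multiple_ge[OF t, of n] t by (simp add: pos_le_divide_eq)
      also note gain
      finally have cn: "real n \<le> c N" unfolding c_def .
      define Y where "Y = x * ((c N - real n) * (h + 1) * real N + real n * h)"
      have Y: "Y \<ge> 0" unfolding Y_def using x h cn by (intro mult_nonneg_nonneg add_nonneg_nonneg) auto
      define D where "D = (h + 1)\<^sup>2 * real N - 2 * (h + 1)"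
      have "r * D \<le> Y"
      proof (cases "D \<ge> 0")
        case True
        then have "ennreal (r * D) \<le> ennreal Y"
          using key[OF N, of D] r by (simp add: ennreal_mult Y_def D_def)
        then show ?thesis using Y by (simp add: ennreal_le_iff)
      next
        case False
        then show ?thesis using Y r(2) by (meson mult_nonneg_nonpos order_trans linear)
      qed
      then have "r * D / real N \<le> Y / real N" using N0 by (intro divide_right_mono) auto
      also have "r * D / real N = r * ((h + 1)\<^sup>2 - 2 * (h + 1) / real N)"
        using N0 by (simp add: D_def field_simps)
      also have "Y / real N = x * (h + 1) * (c N - real n) + x * real n * h / real N"
        using N0 by (simp add: Y_def field_simps)
      finally show ?thesis .
    qed
    have "(\<lambda>N. local_gain n t (t / 2 + \<gamma> * ((a / 2) / real N))) \<longlonglongrightarrow> local_gain n t (t / 2 + \<gamma> * 0)"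
      unfolding local_gain_def by (intro tendsto_intros lim_const_over_n) (use t in auto)
    then have "c \<longlonglongrightarrow> c0" by (simp add: c_def c0_def local_gain_def x_def)
    then have "(\<lambda>N. x * (h + 1) * (c N - real n) + x * real n * h / real N) \<longlonglongrightarrow> x * (h + 1) * (c0 - real n) + 0"
      by (intro tendsto_intros lim_const_over_n)
    moreover have "(\<lambda>N. r * ((h + 1)\<^sup>2 - 2 * (h + 1) / real N)) \<longlonglongrightarrow> r * ((h + 1)\<^sup>2 - 0)"
      by (intro tendsto_intros lim_const_over_n)
    ultimately have "r * ((h + 1)\<^sup>2 - 0) \<le> x * (h + 1) * (c0 - real n) + 0"
      by (intro LIMSEQ_le) (use ineq in blast)+
    then have "(h + 1) * (r * (h + 1)) \<le> (h + 1) * (x * (c0 - real n))"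
      by (simp add: power2_eq_square mult_ac)
    then have "r * (h + 1) \<le> x * (c0 - real n)" using h by simp
    then have "r \<le> x * lower_const n t" using h by (simp add: lc pos_le_divide_eq)
    then show "A \<le> ennreal (real n * t * lower_const n t)"
      unfolding r(1) by (simp add: x_def ennreal_leI)
  qed
qed

text \<open>
  As for the lower bound, with constant instead of alternating sequences, over an interval at the
  boundary of a cell, where the gain is largest.
\<close>

theorem upper_frame_bound_two_sided_exp:
  assumes n: "n \<ge> 1" and a: "a > 0" and \<gamma>: "\<gamma> > 0"
  defines "t \<equiv> \<gamma> * a"
  shows "upper_frame_bound (two_sided_exp \<gamma>) (rect_lattice a (1 / (real n * a))) = ennreal (real n * t * upper_const n t)"
proof -
  let ?G = "gabor_sum (two_sided_exp \<gamma>) (rect_lattice a (1 / (real n * a)))"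
  define x where "x = real n * t"
  define h where "h = cosh x"
  define c1 where "c1 = sinh x * cosh t / sinh t"
  have t: "t > 0" using a \<gamma> by (simp add: t_def)
  have x: "x > 0" using t n by (simp add: x_def)
  have h: "h > 1" using x cosh_real_strict_mono[of 0 x] by (simp add: h_def)
  have u0: "0 \<le> upper_const n t" by (rule upper_const_nonneg[OF t])
  have uc: "upper_const n t = (c1 + real n) / (h - 1)"
    by (simp add: upper_const_def c1_def h_def x_def)
  show ?thesis
    unfolding upper_frame_bound_def
  proof (rule Inf_eqI)
    fix B assume "\<And>y. y \<in> {B. \<forall>f\<in>L2. ?G f \<le> B * ennreal (L2_norm_sq f)} \<Longrightarrow> B \<le> y"
    moreover have "?G f \<le> ennreal (x * upper_const n t) * ennreal (L2_norm_sq f)" if "f \<in> L2" for f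
      using gabor_frame_inequality(2)[OF n a \<gamma> that] x u0
      by (simp add: ennreal_mult'[symmetric] x_def t_def)
    ultimately show "B \<le> ennreal (real n * t * upper_const n t)" by (simp add: x_def)
  next
    fix B assume "B \<in> {B. \<forall>f\<in>L2. ?G f \<le> B * ennreal (L2_norm_sq f)}"
    then have B: "\<And>f. f \<in> L2 \<Longrightarrow> ?G f \<le> B * ennreal (L2_norm_sq f)" by blast
    define c where "c = (\<lambda>N::nat. local_gain n t (\<gamma> * (a / (2 * real N))))"
    have key: "ennreal (x * ((c N + real n) * (h - 1) * real N - real n * h)) \<le> B * ennreal ((h - 1)\<^sup>2 * real N + 2 * h)"
      if N: "N \<ge> 1" for N
    proof -
      define \<delta> where "\<delta> = a / (2 * real N)"
      have "a * 1 \<le> a * real N" using N a by (intro mult_left_mono) auto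
      then have \<delta>: "\<delta> > 0" "0 + \<delta> \<le> a / 2" using a N by (auto simp: \<delta>_def field_simps)
      obtain S d where S: "finite S" "\<And>m. m \<notin> S \<Longrightarrow> d m = 0" and E: "seq_energy (green_conv x S d) = real N"
        and q: "seq_corr (green_conv x S d) = 1 * (real N - 1)"
        and D': "(\<Sum>m\<in>S. (cmod (d m))\<^sup>2) \<le> (cosh x - 1)\<^sup>2 * real N + 2 * cosh x"
        using near_extremal_data[OF x N, of "1"] by auto
      have "0 + \<delta> \<le> a" using \<delta> a by simp
      then obtain f where f: "f \<in> L2" "L2_norm_sq f = \<delta> * (\<Sum>m\<in>S. (cmod (d m))\<^sup>2)"
        and G: "?G f = ennreal (real n * a) * (\<integral>\<^sup>+s\<in>{0..<0 + \<delta>}. ennreal (\<gamma> * local_form n (\<gamma> * a) S d (\<gamma> * s)) \<partial>lborel)"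
        using gabor_sum_test_function[of n a \<gamma> S d 0 \<delta>, OF n a \<gamma> S order_refl \<delta>(1)] by blast
      define L where "L = (c N + real n) * (h - 1) * real N - real n * h"
      have form: "L \<le> local_form n t S d (\<gamma> * s)" if s: "s \<in> {0..<\<delta>}" for s
      proof -
        have "cosh (t - 2 * (\<gamma> * \<delta>)) \<le> cosh (t - 2 * (\<gamma> * s))"
        proof (subst cosh_real_nonneg_le_iff)
          have "\<gamma> * s \<le> \<gamma> * \<delta>" "\<gamma> * \<delta> \<le> \<gamma> * (a / 2)" using s \<gamma> \<delta> by (intro mult_left_mono; simp)+
          then show "0 \<le> t - 2 * (\<gamma> * \<delta>)" "t - 2 * (\<gamma> * \<delta>) \<le> t - 2 * (\<gamma> * s)"
            by (simp_all add: t_def)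
          then show "0 \<le> t - 2 * (\<gamma> * s)" by linarith
        qed
        then have gain: "c N \<le> local_gain n t (\<gamma> * s)"
          unfolding local_gain_def c_def \<delta>_def[symmetric] using x t
          by (intro divide_right_mono mult_left_mono) (auto simp: x_def)
        have g0: "0 \<le> local_gain n t (\<gamma> * s)" unfolding local_gain_def using x t by (simp add: x_def)
        \<comment> \<open>the last line of this estimate inserts \<open>E = N\<close> and \<open>q = N - 1\<close>\<close>
        have "L = c N * ((h - 1) * real N) + real n * (h * (real N - 1) - real N)" by (simp add: L_def algebra_simps)
        also have "\<dots> \<le> local_gain n t (\<gamma> * s) * ((h - 1) * real N) + real n * (h * (real N - 1) - real N)"
          using gain h by (intro add_right_mono mult_right_mono) auto
        also have "\<dots> \<le> local_gain n t (\<gamma> * s) * (h * real N - (real N - 1)) + real n * (h * (real N - 1) - real N)"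
          using g0 by (intro add_right_mono mult_left_mono) (auto simp: algebra_simps)
        also have "\<dots> = local_form n t S d (\<gamma> * s)"
          unfolding local_form_def Let_def x_def[symmetric] E q h_def by (simp add: algebra_simps)
        finally show ?thesis .
      qed
      have "ennreal (x * L) * ennreal \<delta> = ennreal (real n * a) * (ennreal (\<gamma> * L) * ennreal \<delta>)"
        using n a \<gamma> \<delta> by (simp add: ennreal_mult'[symmetric] mult_ac x_def t_def flip: ennreal_mult'')
      also have "\<dots> = ennreal (real n * a) * (\<integral>\<^sup>+s. ennreal (\<gamma> * L) * indicator {0..<0 + \<delta>} s \<partial>lborel)"
        using \<delta> by (simp add: nn_integral_cmult)
      also have "\<dots> \<le> ?G f"
        unfolding G using form \<gamma>
        by (intro mult_left_mono nn_integral_mono) (auto simp: indicator_def t_def intro!: ennreal_leI)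
      also have "\<dots> \<le> B * ennreal (\<delta> * (\<Sum>m\<in>S. (cmod (d m))\<^sup>2))" using B[OF f(1)] by (simp add: f(2))
      also have "\<dots> \<le> B * ennreal (\<delta> * ((h - 1)\<^sup>2 * real N + 2 * h))"
        using D' \<delta> by (intro mult_left_mono ennreal_leI) (auto simp: h_def)
      also have "ennreal (\<delta> * ((h - 1)\<^sup>2 * real N + 2 * h)) = ennreal \<delta> * ennreal ((h - 1)\<^sup>2 * real N + 2 * h)"
        using \<delta> by (simp add: ennreal_mult')
      finally have "ennreal \<delta> * ennreal (x * L) \<le> ennreal \<delta> * (B * ennreal ((h - 1)\<^sup>2 * real N + 2 * h))"
        by (simp only: mult_ac)
      then show ?thesis
        using \<delta> unfolding L_def by (subst (asm) ennreal_mult_le_mult_iff) auto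
    qed
    show "ennreal (real n * t * upper_const n t) \<le> B"
    proof (cases B)
      case (real r)
      have ineq: "x * (h - 1) * (c N + real n) - x * real n * h / real N \<le> r * ((h - 1)\<^sup>2 + 2 * h / real N)"
        if N: "N \<ge> 1" for N
      proof -
        have N0: "real N > 0" using N by simp
        define Y where "Y = x * ((c N + real n) * (h - 1) * real N - real n * h)"
        define D where "D = (h - 1)\<^sup>2 * real N + 2 * h"
        have D: "D \<ge> 0" using h by (simp add: D_def)
        have "ennreal Y \<le> ennreal (r * D)"
          using key[OF N] real D by (simp add: ennreal_mult Y_def D_def)
        then have "Y \<le> r * D" using D real by (simp add: ennreal_le_iff)
        then have "Y / real N \<le> r * D / real N" using N0 by (intro divide_right_mono) auto
        moreover have "r * D / real N = r * ((h - 1)\<^sup>2 + 2 * h / real N)"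
          using N0 by (simp add: D_def field_simps)
        moreover have "Y / real N = x * (h - 1) * (c N + real n) - x * real n * h / real N"
          using N0 by (simp add: Y_def field_simps)
        ultimately show ?thesis by simp
      qed
      have "(\<lambda>N. local_gain n t (\<gamma> * ((a / 2) / real N))) \<longlonglongrightarrow> local_gain n t (\<gamma> * 0)"
        unfolding local_gain_def by (intro tendsto_intros lim_const_over_n) (use t in auto)
      then have "c \<longlonglongrightarrow> c1" by (simp add: c_def c1_def local_gain_def x_def)
      then have "(\<lambda>N. x * (h - 1) * (c N + real n) - x * real n * h / real N) \<longlonglongrightarrow> x * (h - 1) * (c1 + real n) - 0"
        by (intro tendsto_intros lim_const_over_n)
      moreover have "(\<lambda>N. r * ((h - 1)\<^sup>2 + 2 * h / real N)) \<longlonglongrightarrow> r * ((h - 1)\<^sup>2 + 0)"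
        by (intro tendsto_intros lim_const_over_n)
      ultimately have "x * (h - 1) * (c1 + real n) - 0 \<le> r * ((h - 1)\<^sup>2 + 0)"
        by (intro LIMSEQ_le) (use ineq in blast)+
      then have "(h - 1) * (x * (c1 + real n)) \<le> (h - 1) * (r * (h - 1))"
        by (simp add: power2_eq_square mult_ac)
      then have "x * (c1 + real n) \<le> r * (h - 1)" using h by simp
      then have "x * upper_const n t \<le> r" using h by (simp add: uc pos_divide_le_eq)
      then show ?thesis
        unfolding real by (simp add: x_def ennreal_leI)
    qed simp
  qed
qed

section \<open>Calculus of hyperbolic functions\<close>

lemma nonneg_if_deriv_nonneg:
  fixes f f' :: "real \<Rightarrow> real"
  assumes "\<And>x. 0 \<le> x \<Longrightarrow> (f has_real_derivative f' x) (at x)" "\<And>x. 0 \<le> x \<Longrightarrow> 0 \<le> f' x" "f 0 = 0" "0 \<le> t"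
  shows "0 \<le> f t"
  using DERIV_nonneg_imp_nondecreasing[of 0 t f] assms by force

lemma pos_if_deriv_pos:
  fixes f f' :: "real \<Rightarrow> real"
  assumes "\<And>x. 0 \<le> x \<Longrightarrow> (f has_real_derivative f' x) (at x)" "\<And>x. 0 < x \<Longrightarrow> 0 < f' x" "f 0 = 0" "0 < t"
  shows "0 < f t"
proof -
  have "f 0 < f t"
  proof (rule DERIV_pos_imp_increasing_open[OF assms(4)])
    show "\<exists>y. (f has_real_derivative y) (at x) \<and> 0 < y" if "0 < x" "x < t" for x
      using assms(1)[of x] assms(2)[of x] that by force
    show "continuous_on {0..t} f"
      by (intro continuous_at_imp_continuous_on ballI DERIV_isCont[OF assms(1)]) auto
  qed
  then show ?thesis using assms(3) by simp
qed

lemma strictly_convex_unique_min: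
  fixes f f' f'' :: "real \<Rightarrow> real"
  assumes D1: "\<And>x. x > 0 \<Longrightarrow> (f has_real_derivative f' x) (at x)"
    and D2: "\<And>x. x > 0 \<Longrightarrow> (f' has_real_derivative f'' x) (at x)"
    and pos: "\<And>x. x > 0 \<Longrightarrow> f'' x > 0"
    and lu: "0 < l" "l < u" "f' l < 0" "0 < f' u"
  shows "\<exists>x0\<in>{l<..<u}. \<forall>x>0. x \<noteq> x0 \<longrightarrow> f x0 < f x"
proof -
  have mono: "f' x < f' y" if "0 < x" "x < y" for x y
  proof (rule DERIV_pos_imp_increasing[OF that(2)])
    fix z assume "x \<le> z" "z \<le> y"
    then show "\<exists>d. (f' has_real_derivative d) (at z) \<and> 0 < d" using D2[of z] pos[of z] that by force
  qed
  have "\<exists>x\<ge>l. x \<le> u \<and> f' x = 0"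
  proof (rule IVT')
    show "continuous_on {l..u} f'"
      by (intro continuous_at_imp_continuous_on ballI DERIV_isCont[OF D2]) (use lu in auto)
  qed (use lu in auto)
  then obtain x0 where x0: "l \<le> x0" "x0 \<le> u" "f' x0 = 0" by blast
  then have in_lu: "x0 \<in> {l<..<u}" using lu by (auto simp: less_le)
  have "f x0 < f x" if x: "x > 0" "x \<noteq> x0" for x
  proof (cases "x < x0")
    case True
    have "f x > f x0"
    proof (rule DERIV_neg_imp_decreasing_open[OF True])
      show "\<exists>y. (f has_real_derivative y) (at z) \<and> y < 0" if "x < z" "z < x0" for z
        using D1[of z] mono[of z x0] x0 x that by force
      show "continuous_on {x..x0} f"
        by (intro continuous_at_imp_continuous_on ballI DERIV_isCont[OF D1]) (use x in auto)
    qed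
    then show ?thesis .
  next
    case False
    then have "x0 < x" using x by simp
    then show ?thesis
    proof (rule DERIV_pos_imp_increasing_open)
      show "\<exists>y. (f has_real_derivative y) (at z) \<and> 0 < y" if "x0 < z" "z < x" for z
        using D1[of z] mono[of x0 z] x0 lu that by force
      show "continuous_on {x0..x} f"
        by (intro continuous_at_imp_continuous_on ballI DERIV_isCont[OF D1]) (use x0 lu in auto)
    qed
  qed
  then show ?thesis using in_lu by blast
qed

lemma sinh_ge_self:
  assumes "0 \<le> t"
  shows "t \<le> sinh (t::real)"
proof -
  have "0 \<le> sinh t - t"
    by (rule nonneg_if_deriv_nonneg[where f'="\<lambda>t. cosh t - 1"])
      (use assms in \<open>auto intro!: derivative_eq_intros simp: cosh_real_ge_1\<close>)
  then show ?thesis by simp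
qed

lemma cosh_gt_1:
  assumes "t \<noteq> 0"
  shows "1 < cosh (t::real)"
  using cosh_real_strict_mono[of 0 "\<bar>t\<bar>"] assms by simp

lemma cosh_ge_quadratic:
  assumes "0 \<le> t"
  shows "1 + t\<^sup>2 / 2 \<le> cosh (t::real)"
proof -
  have "0 \<le> cosh t - 1 - t\<^sup>2 / 2"
    by (rule nonneg_if_deriv_nonneg[where f'="\<lambda>t. sinh t - t"])
      (use assms in \<open>auto intro!: derivative_eq_intros simp: sinh_ge_self\<close>)
  then show ?thesis by simp
qed

lemma sinh_ge_cubic:
  assumes "0 \<le> t"
  shows "t + t ^ 3 / 6 \<le> sinh (t::real)"
proof -
  have "0 \<le> sinh t - t - t ^ 3 / 6"
  proof (rule nonneg_if_deriv_nonneg[where f="\<lambda>t. sinh t - t - t ^ 3 / 6" and f'="\<lambda>t. cosh t - 1 - t\<^sup>2 / 2"])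
    show "0 \<le> cosh x - 1 - x\<^sup>2 / 2" if "0 \<le> x" for x :: real using cosh_ge_quadratic[OF that] by simp
    show "((\<lambda>t. sinh t - t - t ^ 3 / 6) has_real_derivative cosh x - 1 - x\<^sup>2 / 2) (at x)" for x :: real
      by (auto intro!: derivative_eq_intros)
  qed (use assms in auto)
  then show ?thesis by simp
qed

lemma cosh_sinh_ge_cubic: "0 \<le> t \<Longrightarrow> t ^ 3 / 3 \<le> t * cosh t - sinh (t::real)"
proof -
  assume t: "0 \<le> t"
  have "0 \<le> t * cosh t - sinh t - t ^ 3 / 3"
  proof (rule nonneg_if_deriv_nonneg[OF _ _ _ t, of _ "\<lambda>t. t * (sinh t - t)"])
    show "((\<lambda>t. t * cosh t - sinh t - t ^ 3 / 3) has_real_derivative x * (sinh x - x)) (at x)" for x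
      by (auto intro!: derivative_eq_intros simp: algebra_simps power2_eq_square)
  qed (auto simp: sinh_ge_self)
  then show ?thesis by simp
qed

lemma sinh_less_mult_cosh: "0 < t \<Longrightarrow> sinh t < t * cosh (t::real)"
  using cosh_sinh_ge_cubic[of t] zero_less_power[of t 3] by linarith

text \<open>
  The function \<open>t coth(\<alpha> t) coth(\<beta> t)\<close>. Its second derivative is written below as a sum of terms that
  are positive because \<open>sinh z < z cosh z\<close>.
\<close>

definition coth_product :: "real \<Rightarrow> real \<Rightarrow> real \<Rightarrow> real" where
  "coth_product \<alpha> \<beta> t = t * (cosh (\<alpha> * t) * cosh (\<beta> * t)) / (sinh (\<alpha> * t) * sinh (\<beta> * t))"

definition coth_product' :: "real \<Rightarrow> real \<Rightarrow> real \<Rightarrow> real" where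
  "coth_product' \<alpha> \<beta> t = (cosh (\<alpha> * t) * cosh (\<beta> * t)) / (sinh (\<alpha> * t) * sinh (\<beta> * t))
    - t * \<alpha> * cosh (\<beta> * t) / ((sinh (\<alpha> * t))\<^sup>2 * sinh (\<beta> * t))
    - t * \<beta> * cosh (\<alpha> * t) / (sinh (\<alpha> * t) * (sinh (\<beta> * t))\<^sup>2)"

definition coth_product'' :: "real \<Rightarrow> real \<Rightarrow> real \<Rightarrow> real" where
  "coth_product'' \<alpha> \<beta> t =
    2 * \<alpha> * cosh (\<beta> * t) * (\<alpha> * t * cosh (\<alpha> * t) - sinh (\<alpha> * t)) / (sinh (\<alpha> * t) ^ 3 * sinh (\<beta> * t))
    + 2 * \<beta> * cosh (\<alpha> * t) * (\<beta> * t * cosh (\<beta> * t) - sinh (\<beta> * t)) / (sinh (\<alpha> * t) * sinh (\<beta> * t) ^ 3)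
    + 2 * \<alpha> * \<beta> * t / ((sinh (\<alpha> * t))\<^sup>2 * (sinh (\<beta> * t))\<^sup>2)"

lemma coth_product_deriv:
  assumes "\<alpha> > 0" "\<beta> > 0" "t > 0"
  shows "(coth_product \<alpha> \<beta> has_real_derivative coth_product' \<alpha> \<beta> t) (at t)"
proof -
  define A B a b where "A = cosh (\<alpha> * t)" "B = cosh (\<beta> * t)" "a = sinh (\<alpha> * t)" "b = sinh (\<beta> * t)"
  have s: "a \<noteq> 0" "b \<noteq> 0" using assms by (auto simp: A_B_a_b_def)
  have dA: "((\<lambda>t. cosh (\<alpha> * t)) has_real_derivative \<alpha> * a) (at t)"
    and dB: "((\<lambda>t. cosh (\<beta> * t)) has_real_derivative \<beta> * b) (at t)"
    and da: "((\<lambda>t. sinh (\<alpha> * t)) has_real_derivative \<alpha> * A) (at t)"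
    and db: "((\<lambda>t. sinh (\<beta> * t)) has_real_derivative \<beta> * B) (at t)"
    unfolding A_B_a_b_def by (auto intro!: derivative_eq_intros)
  have sq: "a\<^sup>2 - A\<^sup>2 = -1" "b\<^sup>2 - B\<^sup>2 = -1" by (auto simp: A_B_a_b_def cosh_square_eq)
  have "(coth_product \<alpha> \<beta> has_real_derivative
    ((A * B + t * (\<alpha> * a * B + A * (\<beta> * b))) * (a * b) - t * (A * B) * (\<alpha> * A * b + a * (\<beta> * B))) / (a * b)\<^sup>2) (at t)"
    unfolding coth_product_def
    by (rule DERIV_cong[OF DERIV_divide[OF DERIV_mult[OF DERIV_ident DERIV_mult[OF dA dB]] DERIV_mult[OF da db]]]) (use s in \<open>simp_all add: A_B_a_b_def[symmetric] power2_eq_square algebra_simps\<close>)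
  also have "((A * B + t * (\<alpha> * a * B + A * (\<beta> * b))) * (a * b) - t * (A * B) * (\<alpha> * A * b + a * (\<beta> * B))) / (a * b)\<^sup>2
    = coth_product' \<alpha> \<beta> t"
  proof -
    have "(A * B + t * (\<alpha> * a * B + A * (\<beta> * b))) * (a * b) - t * (A * B) * (\<alpha> * A * b + a * (\<beta> * B)) =
      A * B * (a * b) + t * \<alpha> * B * b * (a\<^sup>2 - A\<^sup>2) + t * \<beta> * A * a * (b\<^sup>2 - B\<^sup>2)"
      by (simp add: algebra_simps power2_eq_square)
    also have "\<dots> = A * B * (a * b) - t * \<alpha> * B * b - t * \<beta> * A * a" by (simp add: sq)
    finally have num: "(A * B + t * (\<alpha> * a * B + A * (\<beta> * b))) * (a * b) - t * (A * B) * (\<alpha> * A * b + a * (\<beta> * B)) =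
      A * B * (a * b) - t * \<alpha> * B * b - t * \<beta> * A * a" .
    show ?thesis
      unfolding num coth_product'_def A_B_a_b_def[symmetric] using s
      by (simp add: field_simps power2_eq_square)
  qed
  finally show ?thesis .
qed

lemma coth_product_deriv2:
  assumes "\<alpha> > 0" "\<beta> > 0" "t > 0"
  shows "(coth_product' \<alpha> \<beta> has_real_derivative coth_product'' \<alpha> \<beta> t) (at t)"
proof -
  define A B a b where "A = cosh (\<alpha> * t)" "B = cosh (\<beta> * t)" "a = sinh (\<alpha> * t)" "b = sinh (\<beta> * t)"
  have s: "a \<noteq> 0" "b \<noteq> 0" using assms by (auto simp: A_B_a_b_def)
  have dA: "((\<lambda>t. cosh (\<alpha> * t)) has_real_derivative \<alpha> * a) (at t)"
    and dB: "((\<lambda>t. cosh (\<beta> * t)) has_real_derivative \<beta> * b) (at t)"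
    and da: "((\<lambda>t. sinh (\<alpha> * t)) has_real_derivative \<alpha> * A) (at t)"
    and db: "((\<lambda>t. sinh (\<beta> * t)) has_real_derivative \<beta> * B) (at t)"
    unfolding A_B_a_b_def by (auto intro!: derivative_eq_intros)
  have sq: "a\<^sup>2 - A\<^sup>2 = -1" "b\<^sup>2 - B\<^sup>2 = -1" by (auto simp: A_B_a_b_def cosh_square_eq)
  have 1: "((\<lambda>t. (cosh (\<alpha> * t) * cosh (\<beta> * t)) / (sinh (\<alpha> * t) * sinh (\<beta> * t))) has_real_derivative
     - \<alpha> * B / (a\<^sup>2 * b) - \<beta> * A / (a * b\<^sup>2)) (at t)"
  proof -
    have "((\<lambda>t. (cosh (\<alpha> * t) * cosh (\<beta> * t)) / (sinh (\<alpha> * t) * sinh (\<beta> * t))) has_real_derivative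
      ((\<alpha> * a * B + A * (\<beta> * b)) * (a * b) - A * B * (\<alpha> * A * b + a * (\<beta> * B))) / (a * b)\<^sup>2) (at t)"
      by (rule DERIV_cong[OF DERIV_divide[OF DERIV_mult[OF dA dB] DERIV_mult[OF da db]]]) (use s in \<open>simp_all add: A_B_a_b_def[symmetric] power2_eq_square algebra_simps\<close>)
    also have "(\<alpha> * a * B + A * (\<beta> * b)) * (a * b) - A * B * (\<alpha> * A * b + a * (\<beta> * B)) =
      \<alpha> * B * b * (a\<^sup>2 - A\<^sup>2) + \<beta> * A * a * (b\<^sup>2 - B\<^sup>2)"
      by (simp add: algebra_simps power2_eq_square)
    also have "\<dots> / (a * b)\<^sup>2 = - \<alpha> * B / (a\<^sup>2 * b) - \<beta> * A / (a * b\<^sup>2)"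
      unfolding sq using s by (simp add: field_simps power2_eq_square)
    finally show ?thesis .
  qed
  have 2: "((\<lambda>t. t * \<alpha> * cosh (\<beta> * t) / ((sinh (\<alpha> * t))\<^sup>2 * sinh (\<beta> * t))) has_real_derivative
     \<alpha> * B / (a\<^sup>2 * b) - t * \<alpha> * \<beta> / (a\<^sup>2 * b\<^sup>2) - 2 * t * \<alpha>\<^sup>2 * A * B / (a ^ 3 * b)) (at t)"
  proof -
    have "((\<lambda>t. t * \<alpha> * cosh (\<beta> * t) / ((sinh (\<alpha> * t))\<^sup>2 * sinh (\<beta> * t))) has_real_derivative
      ((\<alpha> * B + t * \<alpha> * (\<beta> * b)) * (a\<^sup>2 * b) - t * \<alpha> * B * (2 * a * (\<alpha> * A) * b + a\<^sup>2 * (\<beta> * B))) / (a\<^sup>2 * b)\<^sup>2) (at t)"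
      by (rule DERIV_cong[OF DERIV_divide[OF DERIV_mult[OF DERIV_mult[OF DERIV_ident DERIV_const] dB] DERIV_mult[OF DERIV_power[OF da] db]]]) (use s in \<open>simp_all add: A_B_a_b_def[symmetric] power2_eq_square algebra_simps\<close>)
    also have "(\<alpha> * B + t * \<alpha> * (\<beta> * b)) * (a\<^sup>2 * b) - t * \<alpha> * B * (2 * a * (\<alpha> * A) * b + a\<^sup>2 * (\<beta> * B)) =
      \<alpha> * B * (a\<^sup>2 * b) + t * \<alpha> * \<beta> * a\<^sup>2 * (b\<^sup>2 - B\<^sup>2) - 2 * t * \<alpha>\<^sup>2 * A * B * a * b"
      by (simp add: algebra_simps power2_eq_square)
    also have "\<dots> / (a\<^sup>2 * b)\<^sup>2 = \<alpha> * B / (a\<^sup>2 * b) - t * \<alpha> * \<beta> / (a\<^sup>2 * b\<^sup>2) - 2 * t * \<alpha>\<^sup>2 * A * B / (a ^ 3 * b)"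
      unfolding sq using s by (simp add: field_simps power2_eq_square power3_eq_cube)
    finally show ?thesis .
  qed
  have 3: "((\<lambda>t. t * \<beta> * cosh (\<alpha> * t) / (sinh (\<alpha> * t) * (sinh (\<beta> * t))\<^sup>2)) has_real_derivative
     \<beta> * A / (a * b\<^sup>2) - t * \<alpha> * \<beta> / (a\<^sup>2 * b\<^sup>2) - 2 * t * \<beta>\<^sup>2 * A * B / (a * b ^ 3)) (at t)"
  proof -
    have "((\<lambda>t. t * \<beta> * cosh (\<alpha> * t) / (sinh (\<alpha> * t) * (sinh (\<beta> * t))\<^sup>2)) has_real_derivative
      ((\<beta> * A + t * \<beta> * (\<alpha> * a)) * (a * b\<^sup>2) - t * \<beta> * A * (2 * b * (\<beta> * B) * a + b\<^sup>2 * (\<alpha> * A))) / (a * b\<^sup>2)\<^sup>2) (at t)"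
      by (rule DERIV_cong[OF DERIV_divide[OF DERIV_mult[OF DERIV_mult[OF DERIV_ident DERIV_const] dA] DERIV_mult[OF da DERIV_power[OF db]]]]) (use s in \<open>simp_all add: A_B_a_b_def[symmetric] power2_eq_square algebra_simps\<close>)
    also have "(\<beta> * A + t * \<beta> * (\<alpha> * a)) * (a * b\<^sup>2) - t * \<beta> * A * (2 * b * (\<beta> * B) * a + b\<^sup>2 * (\<alpha> * A)) =
      \<beta> * A * (a * b\<^sup>2) + t * \<alpha> * \<beta> * b\<^sup>2 * (a\<^sup>2 - A\<^sup>2) - 2 * t * \<beta>\<^sup>2 * A * B * a * b"
      by (simp add: algebra_simps power2_eq_square)
    also have "\<dots> / (a * b\<^sup>2)\<^sup>2 = \<beta> * A / (a * b\<^sup>2) - t * \<alpha> * \<beta> / (a\<^sup>2 * b\<^sup>2) - 2 * t * \<beta>\<^sup>2 * A * B / (a * b ^ 3)"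
      unfolding sq using s by (simp add: field_simps power2_eq_square power3_eq_cube)
    finally show ?thesis .
  qed
  have "(coth_product' \<alpha> \<beta> has_real_derivative
    (- \<alpha> * B / (a\<^sup>2 * b) - \<beta> * A / (a * b\<^sup>2))
    - (\<alpha> * B / (a\<^sup>2 * b) - t * \<alpha> * \<beta> / (a\<^sup>2 * b\<^sup>2) - 2 * t * \<alpha>\<^sup>2 * A * B / (a ^ 3 * b))
    - (\<beta> * A / (a * b\<^sup>2) - t * \<alpha> * \<beta> / (a\<^sup>2 * b\<^sup>2) - 2 * t * \<beta>\<^sup>2 * A * B / (a * b ^ 3))) (at t)"
    unfolding coth_product'_def by (intro DERIV_diff 1 2 3)
  also have "(- \<alpha> * B / (a\<^sup>2 * b) - \<beta> * A / (a * b\<^sup>2))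
    - (\<alpha> * B / (a\<^sup>2 * b) - t * \<alpha> * \<beta> / (a\<^sup>2 * b\<^sup>2) - 2 * t * \<alpha>\<^sup>2 * A * B / (a ^ 3 * b))
    - (\<beta> * A / (a * b\<^sup>2) - t * \<alpha> * \<beta> / (a\<^sup>2 * b\<^sup>2) - 2 * t * \<beta>\<^sup>2 * A * B / (a * b ^ 3)) = coth_product'' \<alpha> \<beta> t"
    unfolding coth_product''_def A_B_a_b_def[symmetric] using s
    by (simp add: field_simps power2_eq_square power3_eq_cube)
  finally show ?thesis .
qed

lemma coth_product_deriv2_pos:
  assumes "\<alpha> > 0" "\<beta> > 0" "t > 0"
  shows "coth_product'' \<alpha> \<beta> t > 0"
proof -
  have "\<alpha> * t * cosh (\<alpha> * t) - sinh (\<alpha> * t) > 0" "\<beta> * t * cosh (\<beta> * t) - sinh (\<beta> * t) > 0"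
    using assms sinh_less_mult_cosh[of "\<alpha> * t"] sinh_less_mult_cosh[of "\<beta> * t"] by auto
  then show ?thesis
    unfolding coth_product''_def using assms
    by (intro add_pos_pos divide_pos_pos mult_pos_pos zero_less_power) auto
qed

section \<open>Logarithmic derivatives of the frame bounds\<close>

text \<open>
  This is \<open>tanh (n t) \<le> n tanh t\<close> without denominators.
\<close>

lemma tanh_scaling:
  fixes n t :: real
  assumes "n \<ge> 1" "t \<ge> 0"
  shows "cosh t * sinh (n * t) \<le> n * cosh (n * t) * sinh t"
proof -
  have "0 \<le> n * cosh (n * t) * sinh t - cosh t * sinh (n * t)"
  proof (rule nonneg_if_deriv_nonneg[where f="\<lambda>t. n * cosh (n * t) * sinh t - cosh t * sinh (n * t)"
        and f'="\<lambda>t. (n\<^sup>2 - 1) * (sinh (n * t) * sinh t)"])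
    show "((\<lambda>t. n * cosh (n * t) * sinh t - cosh t * sinh (n * t)) has_real_derivative
      (n\<^sup>2 - 1) * (sinh (n * x) * sinh x)) (at x)" for x
      by (auto intro!: derivative_eq_intros simp: algebra_simps power2_eq_square)
    show "0 \<le> (n\<^sup>2 - 1) * (sinh (n * x) * sinh x)" if "0 \<le> x" for x
      using assms that by (intro mult_nonneg_nonneg) auto
  qed (use assms in auto)
  then show ?thesis by simp
qed

text \<open>
  Up to elementary factors \<open>num_lower\<close> and \<open>num_upper\<close> are the numerators of the lower and of the upper
  frame bound. Their derivatives are \<open>num_lower'\<close> and \<open>num_upper'\<close>.
\<close>

definition num_lower :: "real \<Rightarrow> real \<Rightarrow> real" where
  "num_lower n t = sinh (n * t) - n * sinh t"

definition num_upper :: "real \<Rightarrow> real \<Rightarrow> real" where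
  "num_upper n t = sinh (n * t) * cosh t + n * sinh t"

lemma num_lower_pos:
  assumes "n > 1" "t > 0"
  shows "num_lower n t > 0"
proof (rule pos_if_deriv_pos[where f="num_lower n" and f'="\<lambda>t. n * (cosh (n * t) - cosh t)"])
  show "(num_lower n has_real_derivative n * (cosh (n * x) - cosh x)) (at x)" for x
    unfolding num_lower_def by (auto intro!: derivative_eq_intros simp: algebra_simps)
  show "0 < n * (cosh (n * x) - cosh x)" if "0 < x" for x
    using assms that cosh_real_strict_mono[of x "n * x"] by simp
qed (use assms in \<open>auto simp: num_lower_def\<close>)

lemma num_upper_pos: "n \<ge> 1 \<Longrightarrow> t > 0 \<Longrightarrow> num_upper n t > 0"
  unfolding num_upper_def by (intro add_pos_pos mult_pos_pos) auto

text \<open>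
  With \<open>M = num_lower n\<close> this is \<open>(M')\<^sup>2 - M M''\<close>, so its sign says that \<open>M\<close> is log-concave.
\<close>

definition turan_gap :: "real \<Rightarrow> real \<Rightarrow> real" where
  "turan_gap n t = n * ((1 + n\<^sup>2) * (sinh t * sinh (n * t)) - 2 * n * (cosh (n * t) * cosh t - 1))"

lemma turan_gap_nonneg:
  assumes "n \<ge> 1" "t \<ge> 0"
  shows "0 \<le> turan_gap n t"
proof -
  have "0 \<le> (1 + n\<^sup>2) * (sinh t * sinh (n * t)) - 2 * n * (cosh (n * t) * cosh t - 1)"
  proof (rule nonneg_if_deriv_nonneg[where f="\<lambda>t. (1 + n\<^sup>2) * (sinh t * sinh (n * t)) - 2 * n * (cosh (n * t) * cosh t - 1)"
        and f'="\<lambda>t. (n\<^sup>2 - 1) * (n * cosh (n * t) * sinh t - cosh t * sinh (n * t))"])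
    show "((\<lambda>t. (1 + n\<^sup>2) * (sinh t * sinh (n * t)) - 2 * n * (cosh (n * t) * cosh t - 1)) has_real_derivative
      (n\<^sup>2 - 1) * (n * cosh (n * x) * sinh x - cosh x * sinh (n * x))) (at x)" for x
      by (auto intro!: derivative_eq_intros simp: algebra_simps power2_eq_square)
    show "0 \<le> (n\<^sup>2 - 1) * (n * cosh (n * x) * sinh x - cosh x * sinh (n * x))" if "0 \<le> x" for x
      using assms tanh_scaling[OF assms(1) that] by (intro mult_nonneg_nonneg) auto
  qed (use assms in auto)
  then show ?thesis using assms by (simp add: turan_gap_def)
qed

definition num_lower' :: "real \<Rightarrow> real \<Rightarrow> real" where
  "num_lower' n t = n * (cosh (n * t) - cosh t)"

definition num_upper' :: "real \<Rightarrow> real \<Rightarrow> real" where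
  "num_upper' n t = n * cosh (n * t) * cosh t + sinh (n * t) * sinh t + n * cosh t"

lemma num_lower_deriv: "(num_lower n has_real_derivative num_lower' n t) (at t)"
  unfolding num_lower_def num_lower'_def by (auto intro!: derivative_eq_intros simp: algebra_simps)

lemma num_upper_deriv: "(num_upper n has_real_derivative num_upper' n t) (at t)"
  unfolding num_upper_def num_upper'_def by (auto intro!: derivative_eq_intros simp: algebra_simps)

lemma log_deriv_num_lower_deriv:
  assumes "n > 1" "t > 0"
  shows "((\<lambda>t. num_lower' n t / num_lower n t) has_real_derivative - turan_gap n t / (num_lower n t)\<^sup>2) (at t)"
proof -
  define S C s c where "S = sinh (n * t)" "C = cosh (n * t)" "s = sinh t" "c = cosh t"
  have sq: "C\<^sup>2 = 1 + S\<^sup>2" "c\<^sup>2 = 1 + s\<^sup>2" by (auto simp: S_C_s_c_def cosh_square_eq)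
  have "(num_lower' n has_real_derivative n * (n * S - s)) (at t)"
    unfolding num_lower'_def S_C_s_c_def by (auto intro!: derivative_eq_intros simp: algebra_simps)
  from DERIV_divide[OF this num_lower_deriv] num_lower_pos[OF assms]
  have "((\<lambda>t. num_lower' n t / num_lower n t) has_real_derivative
    (n * (n * S - s) * num_lower n t - num_lower' n t * num_lower' n t) / (num_lower n t * num_lower n t)) (at t)" by simp
  also have "n * (n * S - s) * num_lower n t - num_lower' n t * num_lower' n t =
    n * (n * (S\<^sup>2 - C\<^sup>2) + n * (s\<^sup>2 - c\<^sup>2) + 2 * n * (C * c) - (1 + n\<^sup>2) * (s * S))"
    unfolding num_lower_def num_lower'_def S_C_s_c_def[symmetric] by (simp add: algebra_simps power2_eq_square)
  also have "\<dots> = - turan_gap n t"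
    unfolding turan_gap_def S_C_s_c_def[symmetric] sq by (simp add: algebra_simps)
  finally show ?thesis by (simp add: power2_eq_square)
qed

lemma log_deriv_num_upper_deriv:
  assumes "n \<ge> 1" "t > 0"
  shows "((\<lambda>t. num_upper' n t / num_upper n t) has_real_derivative
    ((sinh (n * t))\<^sup>2 + n ^ 3 * (sinh (n * t) * cosh t * sinh t) - n\<^sup>2 * ((cosh t)\<^sup>2 + 2 * cosh (n * t) + 1))
      / (num_upper n t)\<^sup>2) (at t)"
proof -
  define S C s c where "S = sinh (n * t)" "C = cosh (n * t)" "s = sinh t" "c = cosh t"
  have sq: "C\<^sup>2 = 1 + S\<^sup>2" "s\<^sup>2 = c\<^sup>2 - 1" by (auto simp: S_C_s_c_def cosh_square_eq)
  have "(num_upper' n has_real_derivative (n\<^sup>2 + 1) * (S * c) + 2 * n * (C * s) + n * s) (at t)"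
    unfolding num_upper'_def S_C_s_c_def by (auto intro!: derivative_eq_intros simp: algebra_simps power2_eq_square)
  from DERIV_divide[OF this num_upper_deriv] num_upper_pos[OF assms]
  have "((\<lambda>t. num_upper' n t / num_upper n t) has_real_derivative
    (((n\<^sup>2 + 1) * (S * c) + 2 * n * (C * s) + n * s) * num_upper n t - num_upper' n t * num_upper' n t) / (num_upper n t * num_upper n t)) (at t)" by simp
  also have "((n\<^sup>2 + 1) * (S * c) + 2 * n * (C * s) + n * s) * num_upper n t - num_upper' n t * num_upper' n t =
    n\<^sup>2 * c\<^sup>2 * (S\<^sup>2 - C\<^sup>2) + S\<^sup>2 * (c\<^sup>2 - s\<^sup>2) + n ^ 3 * (S * c * s) + 2 * n\<^sup>2 * C * (s\<^sup>2 - c\<^sup>2) + n\<^sup>2 * (s\<^sup>2 - c\<^sup>2)"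
    unfolding num_upper_def num_upper'_def S_C_s_c_def[symmetric] by (simp add: algebra_simps power2_eq_square power3_eq_cube)
  also have "\<dots> = S\<^sup>2 + n ^ 3 * (S * c * s) - n\<^sup>2 * (c\<^sup>2 + 2 * C + 1)"
    unfolding sq by (simp add: algebra_simps)
  finally show ?thesis by (simp add: power2_eq_square S_C_s_c_def)
qed

text \<open>
  The logarithmic derivatives of the frame bounds \<open>sharp_lower\<close> and \<open>sharp_upper\<close>.
\<close>

definition log_lower' :: "real \<Rightarrow> real \<Rightarrow> real" where
  "log_lower' n t = 1 / t + num_lower' n t / num_lower n t - cosh t / sinh t - n * sinh (n * t) / (cosh (n * t) + 1)"

definition log_upper' :: "real \<Rightarrow> real \<Rightarrow> real" where
  "log_upper' n t = 1 / t + num_upper' n t / num_upper n t - cosh t / sinh t - n * sinh (n * t) / (cosh (n * t) - 1)"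

text \<open>
  The sharp frame bounds as functions of \<open>t\<close>, for real \<open>n\<close>; see \<open>frame_bounds_as_functions\<close>.
\<close>

definition sharp_lower :: "real \<Rightarrow> real \<Rightarrow> real" where
  "sharp_lower n t = n * t * num_lower n t / (sinh t * (cosh (n * t) + 1))"

definition sharp_upper :: "real \<Rightarrow> real \<Rightarrow> real" where
  "sharp_upper n t = n * t * num_upper n t / (sinh t * (cosh (n * t) - 1))"

lemma sharp_lower_pos: "n > 1 \<Longrightarrow> t > 0 \<Longrightarrow> sharp_lower n t > 0"
  unfolding sharp_lower_def using num_lower_pos[of n t] by (intro divide_pos_pos mult_pos_pos add_pos_pos) auto

lemma sharp_upper_pos: "n \<ge> 1 \<Longrightarrow> t > 0 \<Longrightarrow> sharp_upper n t > 0"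
  unfolding sharp_upper_def using num_upper_pos[of n t] cosh_gt_1[of "n * t"]
  by (intro divide_pos_pos mult_pos_pos) auto

lemma ln_sharp_lower_deriv:
  assumes "n > 1" "t > 0"
  shows "((\<lambda>t. ln (sharp_lower n t)) has_real_derivative log_lower' n t) (at t)"
proof -
  have M: "num_lower n t > 0" by (rule num_lower_pos[OF assms])
  have C: "cosh (n * t) + 1 > 0" by (simp add: add_pos_pos)
  have "((\<lambda>t. ln n + ln t + ln (num_lower n t) - ln (sinh t) - ln (cosh (n * t) + 1)) has_real_derivative log_lower' n t) (at t)"
    unfolding log_lower'_def using assms M C
    by (auto intro!: derivative_eq_intros num_lower_deriv)
  then show ?thesis
  proof (rule has_field_derivative_transform_within_open[where S="{0<..}"])
    fix y :: real assume "y \<in> {0<..}"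
    then have y: "y > 0" by simp
    have "num_lower n y > 0" "sinh y > 0" "cosh (n * y) + 1 > 0" using num_lower_pos[of n y] assms y by (auto simp: add_pos_pos)
    then show "ln n + ln y + ln (num_lower n y) - ln (sinh y) - ln (cosh (n * y) + 1) = ln (sharp_lower n y)"
      using y assms unfolding sharp_lower_def by (simp add: ln_div ln_mult)
  qed (use assms in auto)
qed

lemma ln_sharp_upper_deriv:
  assumes "n \<ge> 1" "t > 0"
  shows "((\<lambda>t. ln (sharp_upper n t)) has_real_derivative log_upper' n t) (at t)"
proof -
  have M: "num_upper n t > 0" by (rule num_upper_pos[OF assms])
  have C: "cosh (n * t) - 1 > 0" using cosh_gt_1[of "n * t"] assms by simp
  have "((\<lambda>t. ln n + ln t + ln (num_upper n t) - ln (sinh t) - ln (cosh (n * t) - 1)) has_real_derivative log_upper' n t) (at t)"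
    unfolding log_upper'_def using assms M C
    by (auto intro!: derivative_eq_intros num_upper_deriv)
  then show ?thesis
  proof (rule has_field_derivative_transform_within_open[where S="{0<..}"])
    fix y :: real assume "y \<in> {0<..}"
    then have y: "y > 0" by simp
    have "num_upper n y > 0" "sinh y > 0" "cosh (n * y) - 1 > 0" using num_upper_pos[of n y] assms y cosh_gt_1[of "n * y"] by auto
    then show "ln n + ln y + ln (num_upper n y) - ln (sinh y) - ln (cosh (n * y) - 1) = ln (sharp_upper n y)"
      using y assms unfolding sharp_upper_def by (simp add: ln_div ln_mult)
  qed (use assms in auto)
qed

section \<open>Convexity, and the signs at the ends of the interval\<close>

lemma coth_deriv:
  assumes "t > 0"
  shows "((\<lambda>t. cosh t / sinh t) has_real_derivative - 1 / (sinh t)\<^sup>2) (at (t::real))"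
proof -
  have "((\<lambda>t. cosh t / sinh t) has_real_derivative (sinh t * sinh t - cosh t * cosh t) / (sinh t * sinh t)) (at t)"
    using assms by (auto intro!: derivative_eq_intros)
  also have "sinh t * sinh t - cosh t * cosh t = -1" using cosh_square_eq[of t] by (simp add: power2_eq_square)
  finally show ?thesis by (simp add: power2_eq_square)
qed

lemma log_lower'_deriv:
  assumes "n > 1" "t > 0"
  shows "(log_lower' n has_real_derivative
    - (1 / t\<^sup>2 - 1 / (sinh t)\<^sup>2 + turan_gap n t / (num_lower n t)\<^sup>2 + n\<^sup>2 / (cosh (n * t) + 1))) (at t)"
proof -
  have C: "cosh (n * t) + 1 > 0" by (simp add: add_pos_pos)
  have "((\<lambda>t. n * sinh (n * t) / (cosh (n * t) + 1)) has_real_derivative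
    (n * (n * cosh (n * t)) * (cosh (n * t) + 1) - n * sinh (n * t) * (n * sinh (n * t))) / ((cosh (n * t) + 1) * (cosh (n * t) + 1))) (at t)"
    using C by (auto intro!: derivative_eq_intros)
  also have "n * (n * cosh (n * t)) * (cosh (n * t) + 1) - n * sinh (n * t) * (n * sinh (n * t)) = n\<^sup>2 * (cosh (n * t) + 1)"
    using cosh_square_eq[of "n * t"] by (simp add: power2_eq_square algebra_simps)
  finally have 1: "((\<lambda>t. n * sinh (n * t) / (cosh (n * t) + 1)) has_real_derivative n\<^sup>2 / (cosh (n * t) + 1)) (at t)"
    using C by simp
  have 2: "((\<lambda>t. 1 / t) has_real_derivative - 1 / t\<^sup>2) (at t)"
    using assms by (auto intro!: derivative_eq_intros simp: power2_eq_square)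
  have "(log_lower' n has_real_derivative - 1 / t\<^sup>2 + - turan_gap n t / (num_lower n t)\<^sup>2 - - 1 / (sinh t)\<^sup>2 - n\<^sup>2 / (cosh (n * t) + 1)) (at t)"
    unfolding log_lower'_def
    by (intro DERIV_diff DERIV_add 1 2 log_deriv_num_lower_deriv coth_deriv assms)
  then show ?thesis by (simp add: algebra_simps)
qed

text \<open>
  Log-concavity of the lower frame bound: the contributions of \<open>t / sinh t\<close>, of the numerator and of
  \<open>1 / (cosh x + 1)\<close> have the same sign.
\<close>

lemma log_lower'_deriv_neg:
  assumes "n > 1" "t > 0"
  shows "1 / t\<^sup>2 - 1 / (sinh t)\<^sup>2 + turan_gap n t / (num_lower n t)\<^sup>2 + n\<^sup>2 / (cosh (n * t) + 1) > 0"
proof -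
  have "t\<^sup>2 \<le> (sinh t)\<^sup>2" using sinh_ge_self[of t] assms by (intro power_mono) auto
  then have "1 / (sinh t)\<^sup>2 \<le> 1 / t\<^sup>2" using assms by (intro divide_left_mono mult_pos_pos) auto
  moreover have "turan_gap n t / (num_lower n t)\<^sup>2 \<ge> 0" using turan_gap_nonneg[of n t] assms by simp
  moreover have "n\<^sup>2 / (cosh (n * t) + 1) > 0" using assms by (intro divide_pos_pos add_pos_pos) auto
  ultimately show ?thesis by linarith
qed

definition sharp_upper' :: "real \<Rightarrow> real \<Rightarrow> real" where
  "sharp_upper' n t = n * coth_product' (n / 2) 1 t + n\<^sup>2 / 2 * (coth_product' (n / 2) (n / 2) t - 1)"

text \<open>
  Half-angle formulas give \<open>sinh x / (cosh x - 1) = coth (x / 2)\<close> and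
  \<open>2 / (cosh x - 1) = coth\<^sup>2 (x / 2) - 1\<close>. In this form convexity of the upper bound is visible.
\<close>

lemma sharp_upper_decomposition:
  assumes "n \<ge> 1" "t > 0"
  shows "sharp_upper n t = n * coth_product (n / 2) 1 t + n\<^sup>2 / 2 * (coth_product (n / 2) (n / 2) t - t)"
proof -
  define a b s c where "a = cosh (n / 2 * t)" "b = sinh (n / 2 * t)" "s = sinh t" "c = cosh t"
  have nz: "b \<noteq> 0" "s \<noteq> 0" using assms by (auto simp: a_b_s_c_def)
  have nt: "n * t = 2 * (n / 2 * t)" by simp
  have S: "sinh (n * t) = 2 * b * a" unfolding nt sinh_double a_b_s_c_def ..
  have sq: "a\<^sup>2 = b\<^sup>2 + 1" by (simp add: a_b_s_c_def cosh_square_eq)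
  have C: "cosh (n * t) - 1 = 2 * b\<^sup>2"
    unfolding nt cosh_double a_b_s_c_def[symmetric] using sq by simp
  have e1: "coth_product (n / 2) (n / 2) t - t = t / b\<^sup>2"
    unfolding coth_product_def a_b_s_c_def[symmetric] using nz sq
    by (simp add: field_simps power2_eq_square)
  have e2: "coth_product (n / 2) 1 t = t * (a * c) / (b * s)"
    by (simp add: coth_product_def a_b_s_c_def)
  have e3: "sharp_upper n t = n * t * (2 * b * a * c + n * s) / (s * (2 * b\<^sup>2))"
    unfolding sharp_upper_def num_upper_def S C by (simp add: a_b_s_c_def)
  show ?thesis unfolding e1 e2 e3 using nz by (simp add: field_simps power2_eq_square)
qed

lemma sharp_upper_deriv:
  assumes "n \<ge> 1" "t > 0"
  shows "(sharp_upper n has_real_derivative sharp_upper' n t) (at t)"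
proof -
  have "((\<lambda>t. n * coth_product (n / 2) 1 t + n\<^sup>2 / 2 * (coth_product (n / 2) (n / 2) t - t)) has_real_derivative sharp_upper' n t) (at t)"
    unfolding sharp_upper'_def by (intro DERIV_add DERIV_cmult DERIV_diff DERIV_ident coth_product_deriv) (use assms in auto)
  then show ?thesis
    by (rule has_field_derivative_transform_within_open[where S="{0<..}"]) (use assms in \<open>auto simp: sharp_upper_decomposition\<close>)
qed

lemma sharp_upper'_deriv:
  assumes "n \<ge> 1" "t > 0"
  shows "(sharp_upper' n has_real_derivative n * coth_product'' (n / 2) 1 t + n\<^sup>2 / 2 * (coth_product'' (n / 2) (n / 2) t - 0)) (at t)"
  unfolding sharp_upper'_def by (intro DERIV_add DERIV_cmult DERIV_diff DERIV_const coth_product_deriv2) (use assms in auto)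

lemma sharp_upper'_eq:
  assumes "n \<ge> 1" "t > 0"
  shows "sharp_upper' n t = sharp_upper n t * log_upper' n t"
proof -
  have "((\<lambda>t. exp (ln (sharp_upper n t))) has_real_derivative exp (ln (sharp_upper n t)) * log_upper' n t) (at t)"
    by (rule DERIV_fun_exp[OF ln_sharp_upper_deriv[OF assms]])
  then have "((\<lambda>t. exp (ln (sharp_upper n t))) has_real_derivative sharp_upper n t * log_upper' n t) (at t)"
    using sharp_upper_pos[OF assms] by simp
  then have "(sharp_upper n has_real_derivative sharp_upper n t * log_upper' n t) (at t)"
    by (rule has_field_derivative_transform_within_open[where S="{0<..}"]) (use assms sharp_upper_pos in auto)
  then show ?thesis using sharp_upper_deriv[OF assms] by (rule DERIV_unique[symmetric])
qed

lemma log_condition'_eq: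
  assumes "n \<ge> 1" "t > 0"
  shows "log_upper' n t - log_lower' n t =
    num_upper' n t / num_upper n t - num_lower' n t / num_lower n t - 2 * n / sinh (n * t)"
proof -
  have C: "cosh (n * t) > 1" using cosh_gt_1[of "n * t"] assms by simp
  have S: "sinh (n * t) > 0" using assms by simp
  have sq: "sinh (n * t) * sinh (n * t) = (cosh (n * t) + 1) * (cosh (n * t) - 1)"
    using cosh_square_eq[of "n * t"] by (simp add: power2_eq_square algebra_simps)
  have "sinh (n * t) / (cosh (n * t) - 1) = (cosh (n * t) + 1) / sinh (n * t)"
    by (subst frac_eq_eq) (use C S sq in auto)
  moreover have "sinh (n * t) / (cosh (n * t) + 1) = (cosh (n * t) - 1) / sinh (n * t)"
    by (subst frac_eq_eq) (use C S sq[symmetric] in \<open>auto simp: mult.commute\<close>)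
  ultimately have "n * (sinh (n * t) / (cosh (n * t) - 1)) - n * (sinh (n * t) / (cosh (n * t) + 1)) = n * ((cosh (n * t) + 1) / sinh (n * t) - (cosh (n * t) - 1) / sinh (n * t))"
    by (simp only: right_diff_distrib)
  also have "\<dots> = 2 * n / sinh (n * t)" by (simp add: diff_divide_distrib[symmetric])
  finally show ?thesis unfolding log_upper'_def log_lower'_def by simp
qed

text \<open>
  The second derivative of the logarithm of the condition number; its three summands come from the
  numerators of the upper and the lower bound and from \<open>(cosh x + 1) / (cosh x - 1)\<close>.
\<close>

definition log_condition'' :: "real \<Rightarrow> real \<Rightarrow> real" where
  "log_condition'' n t = ((sinh (n * t))\<^sup>2 + n ^ 3 * (sinh (n * t) * cosh t * sinh t) - n\<^sup>2 * ((cosh t)\<^sup>2 + 2 * cosh (n * t) + 1)) / (num_upper n t)\<^sup>2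
    - (- turan_gap n t / (num_lower n t)\<^sup>2) - (- (2 * n\<^sup>2 * cosh (n * t) / (sinh (n * t))\<^sup>2))"

lemma log_condition'_deriv:
  assumes "n > 1" "t > 0"
  shows "((\<lambda>t. log_upper' n t - log_lower' n t) has_real_derivative log_condition'' n t) (at t)"
proof -
  have S: "sinh (n * t) \<noteq> 0" using assms by simp
  have 1: "((\<lambda>t. 2 * n / sinh (n * t)) has_real_derivative - (2 * n\<^sup>2 * cosh (n * t) / (sinh (n * t))\<^sup>2)) (at t)"
    using S by (auto intro!: derivative_eq_intros simp: power2_eq_square)
  have "((\<lambda>t. num_upper' n t / num_upper n t - num_lower' n t / num_lower n t - 2 * n / sinh (n * t)) has_real_derivative log_condition'' n t) (at t)"
    unfolding log_condition''_def
    by (intro DERIV_diff 1 log_deriv_num_upper_deriv log_deriv_num_lower_deriv) (use assms in auto)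
  then show ?thesis
    by (rule has_field_derivative_transform_within_open[where S="{0<..}"]) (use assms in \<open>auto simp: log_condition'_eq\<close>)
qed

text \<open>
  The only summand that may be negative is the one of \<open>num_upper\<close>. It is compensated by the last one: with
  \<open>num_upper n t = S (c + r)\<close>, where \<open>r = n s / S\<close>, both have the denominator \<open>(S (c + r))\<^sup>2\<close>, and the sum
  of the numerators is at least \<open>4 n\<^sup>2 c - 2 n\<^sup>2\<close> because \<open>S \<ge> n s\<close> and \<open>C r \<ge> 1\<close>.
\<close>

lemma log_condition''_pos:
  assumes n: "n > 1" and t: "t > 0"
  shows "log_condition'' n t > 0"
proof -
  define S C s c where "S = sinh (n * t)" "C = cosh (n * t)" "s = sinh t" "c = cosh t"
  define r where "r = n * s / S"
  have S: "S > 0" "s > 0" "c \<ge> 1" "C \<ge> 1" using assms by (auto simp: S_C_s_c_def cosh_real_ge_1)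
  have r: "r > 0" using S n by (simp add: r_def)
  have c2: "c\<^sup>2 = s\<^sup>2 + 1" by (simp add: S_C_s_c_def cosh_square_eq)
  have nS: "n * s \<le> S" using num_lower_pos[OF assms] by (simp add: num_lower_def S_C_s_c_def)
  have "1 * S \<le> c * S" using S by (intro mult_right_mono) auto
  also have "\<dots> \<le> n * C * s" using tanh_scaling[of n t] assms by (simp add: S_C_s_c_def)
  finally have Cr: "1 \<le> C * r" using S by (simp add: r_def pos_le_divide_eq mult_ac)
  have N: "num_upper n t = S * (c + r)" using S by (simp add: num_upper_def S_C_s_c_def[symmetric] r_def distrib_left)
  have "0 < 4 * n\<^sup>2 * c - 2 * n\<^sup>2" using n S by simp
  also have "\<dots> \<le> S\<^sup>2 + n ^ 3 * (S * c * s) - n\<^sup>2 * (c\<^sup>2 + 2 * C + 1) + 2 * n\<^sup>2 * C * (c + r)\<^sup>2"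
  proof -
    have "(n * s)\<^sup>2 \<le> S\<^sup>2" using nS S n by (intro power_mono) auto
    then have "n\<^sup>2 * (c\<^sup>2 - 1) \<le> S\<^sup>2" by (simp add: c2 power_mult_distrib)
    moreover have "0 \<le> n ^ 3 * (S * c * s)" using S n by (intro mult_nonneg_nonneg) auto
    moreover have "2 * n\<^sup>2 * (C + 2 * c) \<le> 2 * n\<^sup>2 * (C * (c + r)\<^sup>2)"
    proof (rule mult_left_mono)
      have "1 + 2 * (c * r) \<le> (c + r)\<^sup>2" using one_le_power[OF S(3), of 2] zero_le_power2[of r] unfolding power2_sum by linarith
      then have "C * (1 + 2 * (c * r)) \<le> C * (c + r)\<^sup>2" using S by (intro mult_left_mono) auto
      moreover have "c * 1 \<le> c * (C * r)" using Cr S by (intro mult_left_mono) auto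
      ultimately show "C + 2 * c \<le> C * (c + r)\<^sup>2" by (simp add: algebra_simps)
    qed simp
    ultimately show ?thesis by (simp add: algebra_simps)
  qed
  finally have P: "0 < S\<^sup>2 + n ^ 3 * (S * c * s) - n\<^sup>2 * (c\<^sup>2 + 2 * C + 1) + 2 * n\<^sup>2 * C * (c + r)\<^sup>2" .
  have "log_condition'' n t = (S\<^sup>2 + n ^ 3 * (S * c * s) - n\<^sup>2 * (c\<^sup>2 + 2 * C + 1) + 2 * n\<^sup>2 * C * (c + r)\<^sup>2) / (S * (c + r))\<^sup>2
    + turan_gap n t / (num_lower n t)\<^sup>2"
  proof -
    have "2 * n\<^sup>2 * C / S\<^sup>2 = 2 * n\<^sup>2 * C * (c + r)\<^sup>2 / (S * (c + r))\<^sup>2" using S r by (simp add: power_mult_distrib)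
    then show ?thesis unfolding log_condition''_def N S_C_s_c_def[symmetric] by (simp add: add_divide_distrib)
  qed
  moreover have "turan_gap n t / (num_lower n t)\<^sup>2 \<ge> 0" using turan_gap_nonneg[of n t] assms by simp
  moreover have "0 < (S * (c + r))\<^sup>2" using S r by simp
  ultimately show ?thesis using P by (metis add_pos_nonneg divide_pos_pos)
qed

text \<open>
  At \<open>x = \<rho>\<close> one has \<open>C = n\<close> and \<open>S\<^sup>2 = n\<^sup>2 - 1\<close>. The logarithmic derivative splits into
  \<open>1 / t - coth t < 0\<close> and the difference of the terms of numerator and denominator, which is negative as
  well.
\<close>

lemma log_upper'_low_neg:
  fixes n \<rho> :: real
  assumes n: "n > 1" and \<rho>: "\<rho> > 0" "cosh \<rho> = n"
  shows "log_upper' n (\<rho> / n) < 0"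
proof -
  define t s c \<sigma> where "t = \<rho> / n" "s = sinh t" "c = cosh t" "\<sigma> = sinh \<rho>"
  have nt: "n * t = \<rho>" using n by (simp add: t_s_c_\<sigma>_def)
  have t: "t > 0" using n \<rho> by (simp add: t_s_c_\<sigma>_def)
  have pos: "s > 0" "c > 0" "\<sigma> > 0" using t \<rho> by (auto simp: t_s_c_\<sigma>_def)
  have \<sigma>2: "\<sigma>\<^sup>2 = n\<^sup>2 - 1" using cosh_square_eq[of \<rho>] \<rho> by (simp add: t_s_c_\<sigma>_def)
  have "1 / t < c / s"
    using sinh_less_mult_cosh[OF t] t pos by (simp add: t_s_c_\<sigma>_def(2,3) field_simps)
  moreover have "num_upper' n t / num_upper n t < n * \<sigma> / (n - 1)"
  proof -
    have N: "num_upper n t > 0" using num_upper_pos[of n t] n t by simp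
    have "0 < \<sigma> * s * (n\<^sup>2 - n + 1)"
    proof -
      have "n * 1 < n * n" using n by (intro mult_strict_left_mono) auto
      then show ?thesis using pos by (simp add: power2_eq_square)
    qed
    also have "\<dots> = n * \<sigma> * num_upper n t - num_upper' n t * (n - 1)"
    proof -
      have "n * \<sigma> * num_upper n t = n * \<sigma>\<^sup>2 * c + n\<^sup>2 * \<sigma> * s"
        unfolding num_upper_def nt t_s_c_\<sigma>_def(2-4)[symmetric] by (simp add: power2_eq_square algebra_simps)
      moreover have "num_upper' n t * (n - 1) = n * (n\<^sup>2 - 1) * c + (n - 1) * \<sigma> * s"
        unfolding num_upper'_def nt t_s_c_\<sigma>_def(2-4)[symmetric] \<rho>(2) by (simp add: power2_eq_square algebra_simps)
      ultimately show ?thesis by (simp add: \<sigma>2 algebra_simps)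
    qed
    finally show ?thesis using N n by (simp add: field_simps)
  qed
  ultimately have "log_upper' n t < 0"
    unfolding log_upper'_def nt \<rho>(2) t_s_c_\<sigma>_def(2-4)[symmetric] by simp
  then show ?thesis by (simp add: t_s_c_\<sigma>_def)
qed

text \<open>
  By \<open>tanh_scaling\<close> the term of the numerator is at least \<open>n coth x\<close>. Since
  \<open>coth x - sinh x / (cosh x + 1) = 1 / sinh x\<close>, it exceeds the term of the denominator by at least \<open>n / sinh x\<close>.
  This bound is at least \<open>1\<close>, and \<open>coth t - 1 / t\<close> is smaller than that.
\<close>

lemma log_lower'_low_pos:
  fixes n \<rho> :: real
  assumes n: "n > 1" and \<rho>: "\<rho> > 0" "cosh \<rho> = n"
  shows "log_lower' n (\<rho> / n) > 0"
proof -
  define t s c \<sigma> where "t = \<rho> / n" "s = sinh t" "c = cosh t" "\<sigma> = sinh \<rho>"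
  have nt: "n * t = \<rho>" using n by (simp add: t_s_c_\<sigma>_def)
  have t: "t > 0" using n \<rho> by (simp add: t_s_c_\<sigma>_def)
  have pos: "s > 0" "c > 0" "\<sigma> > 0" using t \<rho> by (auto simp: t_s_c_\<sigma>_def)
  have \<sigma>2: "\<sigma>\<^sup>2 = n\<^sup>2 - 1" using cosh_square_eq[of \<rho>] \<rho> by (simp add: t_s_c_\<sigma>_def)
  have M: "num_lower n t > 0" by (rule num_lower_pos[OF n t])
  have "n * n / \<sigma> \<le> num_lower' n t / num_lower n t"
  proof -
    have "num_lower' n t * \<sigma> - n * n * num_lower n t = n * (n * n * s - c * \<sigma>)"
      unfolding num_lower_def num_lower'_def nt t_s_c_\<sigma>_def(2-4)[symmetric] \<rho>(2) by (simp add: algebra_simps)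
    also have "\<dots> \<ge> 0" using tanh_scaling[of n t] n t unfolding nt \<rho>(2) t_s_c_\<sigma>_def(2-4)[symmetric] by simp
    finally show ?thesis using M pos by (simp add: field_simps)
  qed
  moreover have "n * \<sigma> / (n + 1) = n * (n - 1) / \<sigma>"
  proof -
    have "\<sigma> * \<sigma> = (n - 1) * (n + 1)" using \<sigma>2 by (simp add: power2_eq_square algebra_simps)
    then show ?thesis using pos n by (simp add: frac_eq_eq mult_ac)
  qed
  moreover have "c / s - 1 / t < n / \<sigma>"
  proof -
    have "cosh t - sinh t = exp (- t)" by (rule cosh_minus_sinh)
    also have "\<dots> < 1" using t by simp
    finally have "t * (c - s) < t * 1" using t by (intro mult_strict_left_mono) (auto simp: t_s_c_\<sigma>_def)
    also have "\<dots> \<le> s" using sinh_ge_self[of t] t by (simp add: t_s_c_\<sigma>_def(2))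
    finally have "c / s - 1 / t < 1" using t pos by (simp add: field_simps)
    also have "1 \<le> n / \<sigma>"
    proof -
      have "\<sigma>\<^sup>2 \<le> n\<^sup>2" using \<sigma>2 by simp
      then have "\<sigma> \<le> n" using n by (auto intro: power2_le_imp_le)
      then show ?thesis using pos by simp
    qed
    finally show ?thesis .
  qed
  moreover have "n * n / \<sigma> - n * (n - 1) / \<sigma> = n / \<sigma>" using pos by (simp add: field_simps)
  ultimately have "log_lower' n t > 0"
    unfolding log_lower'_def nt \<rho>(2) t_s_c_\<sigma>_def(2-4)[symmetric] by linarith
  then show ?thesis by (simp add: t_s_c_\<sigma>_def)
qed

lemma sinh_double_ge_cubic:
  assumes "0 \<le> t"
  shows "t + 2 * t ^ 3 / 3 \<le> sinh t * cosh (t::real)"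
  using sinh_ge_cubic[of "2 * t"] assms by (simp add: sinh_double power_mult_distrib)

lemma cosh_4_arcosh:
  fixes n \<rho> :: real
  assumes "cosh \<rho> = n"
  shows "sinh (4 * \<rho>) = 4 * n * (2 * n\<^sup>2 - 1) * sinh \<rho>" "cosh (4 * \<rho>) - 1 = 8 * n\<^sup>2 * (sinh \<rho>)\<^sup>2"
proof -
  have sq: "(sinh \<rho>)\<^sup>2 = n\<^sup>2 - 1" using cosh_square_eq[of \<rho>] assms by simp
  have c2: "cosh (2 * \<rho>) = 2 * n\<^sup>2 - 1" unfolding cosh_double using sq assms by simp
  have s2: "sinh (2 * \<rho>) = 2 * n * sinh \<rho>" unfolding sinh_double using assms by simp
  have four: "4 * \<rho> = 2 * (2 * \<rho>)" by simp
  show "sinh (4 * \<rho>) = 4 * n * (2 * n\<^sup>2 - 1) * sinh \<rho>"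
    unfolding four sinh_double[of "2 * \<rho>"] s2 c2 by simp
  have "cosh (4 * \<rho>) = 1 + 2 * (sinh (2 * \<rho>))\<^sup>2"
    unfolding four cosh_double[of "2 * \<rho>"] cosh_square_eq[of "2 * \<rho>"] by simp
  then show "cosh (4 * \<rho>) - 1 = 8 * n\<^sup>2 * (sinh \<rho>)\<^sup>2"
    unfolding s2 by (simp add: power_mult_distrib)
qed

lemma arcosh_ge_1:
  fixes \<rho> :: real
  assumes "\<rho> > 0" "cosh \<rho> \<ge> 2"
  shows "\<rho> \<ge> 1"
proof (rule ccontr)
  assume "\<not> \<rho> \<ge> 1"
  then have "cosh \<rho> < cosh 1" using assms by (intro cosh_real_strict_mono) auto
  also have "cosh (1::real) \<le> (3 + 1) / 2"
  proof -
    have "exp (1::real) \<le> 3" "exp (- 1::real) \<le> 1" using e_less_272 by simp_all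
    from add_mono[OF this] show ?thesis unfolding cosh_field_def by (intro divide_right_mono) auto
  qed
  finally show False using assms by simp
qed

text \<open>
  At \<open>x = 4 \<rho>\<close> the hyperbolic functions of \<open>x\<close> are of the order \<open>n\<^sup>4\<close>. So, up to errors of relative size
  \<open>x / S\<close> and \<open>1 / (C - 1)\<close>, only \<open>1 - 2 t / sinh (2 t)\<close> remains of \<open>t * log_upper' n t\<close>, and this is at least
  \<open>2 t\<^sup>2 / (3 + 2 t\<^sup>2)\<close>.
\<close>

lemma log_upper'_high_pos:
  fixes n \<rho> :: real
  assumes n: "n \<ge> 2" and \<rho>: "\<rho> > 0" "cosh \<rho> = n"
  shows "log_upper' n (4 * \<rho> / n) > 0"
proof -
  define x t s c S C \<sigma> where "x = 4 * \<rho>" "t = x / n" "s = sinh t" "c = cosh t" "S = sinh x" "C = cosh x" "\<sigma> = sinh \<rho>"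
  note defs = this
  have nt: "n * t = x" using n by (simp add: defs(2))
  have \<rho>1: "\<rho> \<ge> 1" using arcosh_ge_1[of \<rho>] n \<rho> by simp
  have t: "t > 0" using n \<rho> by (simp add: defs(1,2))
  have x: "x \<ge> 4" "x \<le> 4 * \<sigma>" using \<rho>1 sinh_ge_self[of \<rho>] by (auto simp: defs(1,7))
  have pos: "s > 0" "c > 0" "\<sigma> > 0" "S > 0" using t \<rho> x by (auto simp: defs(3-7))
  have \<sigma>2: "n\<^sup>2 = \<sigma>\<^sup>2 + 1" using cosh_square_eq[of \<rho>] \<rho> by (simp add: defs(7))
  have "2\<^sup>2 \<le> n\<^sup>2" using n by (intro power_mono) auto
  then have \<sigma>3: "\<sigma>\<^sup>2 \<ge> 3" "n\<^sup>2 \<ge> 4" using \<sigma>2 by auto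
  have CS: "C - 1 = 8 * n\<^sup>2 * \<sigma>\<^sup>2" using cosh_4_arcosh(2)[OF \<rho>(2)] by (simp add: defs(1,6,7))
  have "\<sigma>\<^sup>2 \<le> n\<^sup>2" using \<sigma>2 by simp
  then have \<sigma>n: "\<sigma> \<le> n" using n by (auto intro: power2_le_imp_le)
  have S7: "S \<ge> 7 * n\<^sup>2 * \<sigma>\<^sup>2"
  proof -
    have "7 * n * \<sigma> \<le> 7 * n * n" using n \<sigma>n by (intro mult_left_mono) auto
    then have "7 * n * \<sigma> \<le> 4 * (2 * n\<^sup>2 - 1)" using \<sigma>3 by (simp add: power2_eq_square)
    then have "n * \<sigma> * (7 * n * \<sigma>) \<le> n * \<sigma> * (4 * (2 * n\<^sup>2 - 1))" using n pos by (intro mult_left_mono) auto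
    then show ?thesis using cosh_4_arcosh(1)[OF \<rho>(2)] by (simp add: defs(1,5,7) power2_eq_square mult_ac)
  qed
  have SC: "S \<le> C" unfolding defs(5,6) using exp_gt_zero[of "- x"] unfolding cosh_minus_sinh[symmetric] by linarith
  have C: "C - 1 > 0" using CS n pos by simp
  have N: "num_upper n t = S * c + n * s" by (simp add: num_upper_def nt defs(3-6))
  have N': "num_upper' n t = n * C * c + S * s + n * c" by (simp add: num_upper'_def nt defs(3-6))
  have Npos: "num_upper n t > 0" unfolding N using pos n by (simp add: add_pos_pos)
  have c1: "c\<^sup>2 = s\<^sup>2 + 1" by (simp add: defs(3,4) cosh_square_eq)
  \<comment> \<open>the logarithmic derivative, multiplied by \<open>t\<close>\<close>
  have L: "t * log_upper' n t = 1 - t * S / (s * num_upper n t) + x * (C * c / num_upper n t) - x * (S / (C - 1))"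
  proof -
    have "num_upper' n t / num_upper n t - c / s = (n * C * c * s - S) / (s * num_upper n t)"
    proof -
      have "num_upper' n t * s - c * num_upper n t = n * C * c * s - S * (c\<^sup>2 - s\<^sup>2)"
        unfolding N N' by (simp add: algebra_simps power2_eq_square)
      also have "\<dots> = n * C * c * s - S" by (simp add: c1)
      finally show ?thesis using pos Npos by (simp add: diff_frac_eq mult.commute)
    qed
    then have "log_upper' n t = 1 / t + (n * C * c * s - S) / (s * num_upper n t) - n * S / (C - 1)"
      unfolding log_upper'_def nt defs(3-6)[symmetric] by simp
    also have "(n * C * c * s - S) / (s * num_upper n t) = n * (C * c / num_upper n t) - S / (s * num_upper n t)"
      using pos by (simp add: diff_divide_distrib)
    finally have l: "log_upper' n t = 1 / t + (n * (C * c / num_upper n t) - S / (s * num_upper n t)) - n * (S / (C - 1))"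
      by simp
    have gen: "t * (1 / t + (n * A - B) - n * D) = 1 - t * B + n * t * A - n * t * D" for A B D
      using t by (simp add: algebra_simps)
    show ?thesis
      unfolding l using gen[of "C * c / num_upper n t" "S / (s * num_upper n t)" "S / (C - 1)", unfolded nt] by simp
  qed
  have "t * S / (s * num_upper n t) \<le> 3 / (3 + 2 * t\<^sup>2)"
  proof -
    have "t * S / (s * num_upper n t) \<le> t * S / (s * (S * c))"
      unfolding N using pos n t by (intro divide_left_mono mult_left_mono mult_pos_pos add_pos_pos) auto
    also have "\<dots> = t / (s * c)" using pos by simp
    also have "\<dots> \<le> t / (t + 2 * t ^ 3 / 3)"
      using sinh_double_ge_cubic[of t] t pos by (intro divide_left_mono mult_pos_pos add_pos_pos) (auto simp: defs(3,4))
    also have "t + 2 * t ^ 3 / 3 = t * ((3 + 2 * t\<^sup>2) / 3)" by (simp add: power2_eq_square power3_eq_cube algebra_simps)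
    also have "t / \<dots> = 3 / (3 + 2 * t\<^sup>2)" using t by simp
    finally show ?thesis .
  qed
  moreover have "x * (1 - x / S) \<le> x * (C * c / num_upper n t)"
  proof (rule mult_left_mono)
    have "n * s \<le> x * c" using sinh_less_mult_cosh[OF t] n by (simp add: defs(2-4) field_simps)
    then have "n * s * S \<le> x * c * S" using pos by (intro mult_right_mono) auto
    moreover have "0 \<le> x * (n * s)" using x n pos by simp
    ultimately have "(S - x) * (S * c + n * s) \<le> S * (S * c)" by (simp add: algebra_simps)
    then have "(1 - x / S) \<le> S * c / num_upper n t"
      using pos Npos unfolding N[symmetric] by (simp add: field_simps)
    also have "\<dots> \<le> C * c / num_upper n t" using SC pos Npos by (intro divide_right_mono mult_right_mono) auto
    finally show "1 - x / S \<le> C * c / num_upper n t" .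
  qed (use x in simp)
  moreover have "x * (S / (C - 1)) \<le> x * (1 + 1 / (C - 1))"
  proof (rule mult_left_mono)
    have "S / (C - 1) \<le> C / (C - 1)" using SC C by (intro divide_right_mono) auto
    also have "\<dots> = 1 + 1 / (C - 1)" using C by (simp add: field_simps)
    finally show "S / (C - 1) \<le> 1 + 1 / (C - 1)" .
  qed (use x in simp)
  moreover have "3 / (3 + 2 * t\<^sup>2) + x * (x / S) + x / (C - 1) < 1"
  proof -
    have nz: "n\<^sup>2 * \<sigma>\<^sup>2 > 0" using n pos by simp
    have "x * (x / S) \<le> x\<^sup>2 / (7 * (n\<^sup>2 * \<sigma>\<^sup>2))"
      using S7 nz x pos by (simp add: power2_eq_square) (intro divide_left_mono, auto simp: mult_ac)
    moreover have "x / (C - 1) \<le> x\<^sup>2 / (32 * (n\<^sup>2 * \<sigma>\<^sup>2))"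
    proof -
      have "4 * x \<le> x * x" using x by (intro mult_right_mono) auto
      then show ?thesis unfolding CS using nz by (simp add: field_simps power2_eq_square)
    qed
    ultimately have "x * (x / S) + x / (C - 1) \<le> x\<^sup>2 / (7 * (n\<^sup>2 * \<sigma>\<^sup>2)) + x\<^sup>2 / (32 * (n\<^sup>2 * \<sigma>\<^sup>2))" by linarith
    also have "\<dots> = x\<^sup>2 * (39 / 224) / (n\<^sup>2 * \<sigma>\<^sup>2)" by (simp add: field_simps)
    also have "\<dots> < x\<^sup>2 * (1 / 5) / (n\<^sup>2 * \<sigma>\<^sup>2)" using x nz by (intro divide_strict_right_mono mult_strict_left_mono) auto
    also have "\<dots> \<le> x\<^sup>2 * 2 / (3 * n\<^sup>2 + 2 * x\<^sup>2)"
    proof -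
      have "x\<^sup>2 \<le> (4 * \<sigma>)\<^sup>2" using x by (intro power_mono) auto
      then have "x\<^sup>2 \<le> 16 * \<sigma>\<^sup>2" by (simp add: power_mult_distrib)
      moreover have "3 * \<sigma>\<^sup>2 \<le> \<sigma>\<^sup>2 * \<sigma>\<^sup>2" using \<sigma>3 by (intro mult_right_mono) auto
      ultimately have le: "3 * n\<^sup>2 + 2 * x\<^sup>2 \<le> 10 * (n\<^sup>2 * \<sigma>\<^sup>2)"
        using \<sigma>3 unfolding \<sigma>2 by (simp add: algebra_simps)
      have "1 / 5 / (n\<^sup>2 * \<sigma>\<^sup>2) \<le> 2 / (3 * n\<^sup>2 + 2 * x\<^sup>2)"
      proof -
        have "3 * n\<^sup>2 + 2 * x\<^sup>2 > 0" using \<sigma>3 by (intro add_pos_nonneg) auto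
        then have "2 / (10 * (n\<^sup>2 * \<sigma>\<^sup>2)) \<le> 2 / (3 * n\<^sup>2 + 2 * x\<^sup>2)"
          using le nz by (intro divide_left_mono mult_pos_pos) auto
        then show ?thesis by (simp add: mult.commute)
      qed
      then have "x\<^sup>2 * (1 / 5 / (n\<^sup>2 * \<sigma>\<^sup>2)) \<le> x\<^sup>2 * (2 / (3 * n\<^sup>2 + 2 * x\<^sup>2))" by (intro mult_left_mono) auto
      then show ?thesis by simp
    qed
    also have "\<dots> = 1 - 3 / (3 + 2 * t\<^sup>2)"
    proof -
      have "3 * n\<^sup>2 + 2 * x\<^sup>2 = n\<^sup>2 * (3 + 2 * t\<^sup>2)" unfolding nt[symmetric] by (simp add: algebra_simps power_mult_distrib)
      moreover have "x\<^sup>2 = n\<^sup>2 * t\<^sup>2" unfolding nt[symmetric] by (rule power_mult_distrib)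
      ultimately have "x\<^sup>2 * 2 / (3 * n\<^sup>2 + 2 * x\<^sup>2) = n\<^sup>2 * (2 * t\<^sup>2) / (n\<^sup>2 * (3 + 2 * t\<^sup>2))" by simp
      also have "\<dots> = 2 * t\<^sup>2 / (3 + 2 * t\<^sup>2)" using n by simp
      also have "\<dots> = 1 - 3 / (3 + 2 * t\<^sup>2)"
      proof -
        have "3 + 2 * t\<^sup>2 > 0" by (simp add: add_pos_nonneg)
        then show ?thesis by (simp add: eq_diff_eq add_divide_distrib[symmetric])
      qed
      finally show ?thesis .
    qed
    finally show ?thesis by simp
  qed
  ultimately have "0 < t * log_upper' n t" unfolding L by (simp add: algebra_simps)
  then have "0 < log_upper' n t" using t by (simp add: zero_less_mult_iff)
  then show ?thesis by (simp add: defs(1,2))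
qed

lemma sinh_le_4_mult:
  assumes "0 < t" "t \<le> (14 / 5 :: real)"
  shows "sinh t \<le> 4 * t"
proof -
  have "sinh t / t \<le> sinh (14 / 5) / (14 / 5)"
  proof (rule DERIV_nonneg_imp_nondecreasing[OF assms(2)])
    fix z assume "t \<le> z" "z \<le> 14 / 5"
    then have z: "z > 0" using assms by simp
    have "((\<lambda>t. sinh t / t) has_real_derivative (cosh z * z - sinh z * 1) / (z * z)) (at z)"
      using z by (auto intro!: derivative_eq_intros)
    moreover have "0 \<le> (cosh z * z - sinh z * 1) / (z * z)"
      using sinh_less_mult_cosh[OF z] z by (simp add: mult.commute)
    ultimately show "\<exists>y. ((\<lambda>t. sinh t / t) has_real_derivative y) (at z) \<and> 0 \<le> y" by blast
  qed
  also have "\<dots> \<le> 4"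
  proof -
    have "exp (14 / 5 :: real) \<le> exp (3 * 1)" by simp
    also have "exp (3 * 1 :: real) = exp 1 ^ 3" by (simp flip: exp_of_nat_mult)
    also have "\<dots> \<le> (272 / 100) ^ 3" using e_less_272 by (intro power_mono) auto
    finally have "exp (14 / 5 :: real) \<le> 112 / 5" by (simp add: power3_eq_cube)
    moreover have "exp (- (14 / 5) :: real) > 0" by simp
    ultimately show ?thesis unfolding sinh_field_def by (simp add: field_simps add_increasing2)
  qed
  finally show ?thesis using assms by (simp add: field_simps)
qed

text \<open>
  The terms of numerator and denominator nearly cancel, and their difference is at most
  \<open>n\<^sup>2 s / (S - n s)\<close>. It has to be smaller than \<open>coth t - 1 / t\<close>, which is of the order \<open>t\<close>. For
  \<open>n \<ge> 3\<close> the scaled parameter is so small (\<open>t \<le> 14/5\<close>) that \<open>s \<le> 4 t\<close> and crude bounds suffice; for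
  \<open>n = 2\<close> all the functions are known explicitly, since \<open>cosh t = 7\<close>.
\<close>

lemma log_lower'_high_neg:
  fixes n \<rho> :: real
  assumes n: "n = 2 \<or> n \<ge> 3" and \<rho>: "\<rho> > 0" "cosh \<rho> = n"
  shows "log_lower' n (4 * \<rho> / n) < 0"
proof -
  define x t s c S C \<sigma> where "x = 4 * \<rho>" "t = x / n" "s = sinh t" "c = cosh t" "S = sinh x" "C = cosh x" "\<sigma> = sinh \<rho>"
  note defs = this
  have n2: "n \<ge> 2" using n by auto
  have nt: "n * t = x" using n2 by (simp add: defs(2))
  have \<rho>1: "\<rho> \<ge> 1" using arcosh_ge_1[of \<rho>] n2 \<rho> by simp
  have t: "t > 0" using n2 \<rho> by (simp add: defs(1,2))
  have x: "x > 0" "x \<le> 4 * \<sigma>" using \<rho>1 sinh_ge_self[of \<rho>] by (auto simp: defs(1,7))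
  have pos: "s > 0" "c > 0" "\<sigma> > 0" "S > 0" using t \<rho> x by (auto simp: defs(3-7))
  have \<sigma>2: "n\<^sup>2 = \<sigma>\<^sup>2 + 1" using cosh_square_eq[of \<rho>] \<rho> by (simp add: defs(7))
  have C: "C > 0" by (simp add: defs(6))
  have CS: "C - 1 \<le> S"
  proof -
    have "C - S = exp (- x)" unfolding defs(5,6) by (rule cosh_minus_sinh)
    also have "\<dots> \<le> 1" using x by simp
    finally show ?thesis by simp
  qed
  have C2: "C\<^sup>2 = S\<^sup>2 + 1" by (simp add: defs(5,6) cosh_square_eq)
  have M: "num_lower n t = S - n * s" by (simp add: num_lower_def nt defs(3-6))
  have Mpos: "S - n * s > 0" using num_lower_pos[OF _ t, of n] n2 unfolding M by simp
  have M': "num_lower' n t = n * (C - c)" by (simp add: num_lower'_def nt defs(3-6))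
  have c1: "c \<ge> 1" by (simp add: defs(4) cosh_real_ge_1)
  have "n * (C - c) / (S - n * s) - n * S / (C + 1) \<le> n * (n * s) / (S - n * s)"
  proof -
    have "S * S = (C - 1) * (C + 1)" using C2 by (simp add: power2_eq_square algebra_simps)
    then have e: "S / (C + 1) = (C - 1) / S" using pos C by (simp add: frac_eq_eq)
    have "(C - c) * S - (C - 1) * (S - n * s) = n * s * (C - 1) - S * (c - 1)" by (simp add: algebra_simps)
    also have "\<dots> \<le> n * s * S"
    proof -
      have "n * s * (C - 1) \<le> n * s * S" using CS n2 pos by (intro mult_left_mono) auto
      moreover have "0 \<le> S * (c - 1)" using pos c1 by simp
      ultimately show ?thesis by linarith
    qed
    finally have "((C - c) * S - (C - 1) * (S - n * s)) / ((S - n * s) * S) \<le> n * s * S / ((S - n * s) * S)"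
      using Mpos pos by (intro divide_right_mono) auto
    moreover have "((C - c) * S - (C - 1) * (S - n * s)) / ((S - n * s) * S) = (C - c) / (S - n * s) - (C - 1) / S"
      using Mpos pos by (simp add: diff_frac_eq)
    moreover have "n * s * S / ((S - n * s) * S) = n * s / (S - n * s)" using pos by simp
    ultimately have "(C - c) / (S - n * s) - (C - 1) / S \<le> n * s / (S - n * s)" by simp
    then have "n * ((C - c) / (S - n * s) - (C - 1) / S) \<le> n * (n * s / (S - n * s))"
      using n2 by (intro mult_left_mono) auto
    moreover have "n * S / (C + 1) = n * ((C - 1) / S)" using e by (metis times_divide_eq_right)
    ultimately show ?thesis by (simp add: right_diff_distrib)
  qed
  moreover have "n * (n * s) / (S - n * s) < c / s - 1 / t"
  proof -
    have key: "n * n * t * (s * s) < (t * c - s) * (S - n * s)"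
      using n
    proof
      assume n: "n = 2"
      have t2: "t = 2 * \<rho>" by (simp add: defs(1,2) n)
      have c7: "c = 7" using cosh_square_eq[of \<rho>] \<rho>(2) unfolding defs(4) t2 cosh_double n by simp
      have "s * s = 48" using cosh_square_eq[of t] c7 by (simp add: defs(3,4) power2_eq_square)
      then have "s * s < 7 * 7" by simp
      then have s7: "s < 7" using mult_mono[of 7 s 7 s] by (cases "s < 7") auto
      have "S = 14 * s"
      proof -
        have "S = 2 * s * c" unfolding defs(5) nt[symmetric] n sinh_double defs(3,4) ..
        then show ?thesis by (simp add: c7)
      qed
      moreover have "t \<ge> 2" using t2 \<rho>1 by simp
      then have "4 * t * s < 12 * (7 * t - s)" 
      proof -
        have "4 * t * s \<le> 4 * t * 7" using s7 t by (intro mult_left_mono) auto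
        also have "\<dots> < 12 * (7 * t - s)" using s7 \<open>t \<ge> 2\<close> by simp
        finally show ?thesis .
      qed
      then have "s * (4 * t * s) < s * (12 * (7 * t - s))" using pos by (intro mult_strict_left_mono) auto
      ultimately show ?thesis unfolding n c7 by (simp add: algebra_simps)
    next
      assume n3: "n \<ge> 3"
      have "n \<le> cosh (7 / 10 * n)"
      proof -
        have "0 \<le> (n - 3) * (49 * n - 53)" using n3 by (intro mult_nonneg_nonneg) auto
        then have "200 * n \<le> 200 + 49 * (n * n)" by (simp add: algebra_simps)
        then have "n \<le> 1 + (7 / 10 * n)\<^sup>2 / 2" by (simp add: power2_eq_square)
        also have "\<dots> \<le> cosh (7 / 10 * n)" using n3 by (intro cosh_ge_quadratic) simp
        finally show ?thesis .
      qed
      then have "\<rho> \<le> 7 / 10 * n" using \<rho> n3 cosh_real_nonneg_le_iff[of \<rho> "7 / 10 * n"] by simp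
      then have t14: "t \<le> 14 / 5" using n3 by (simp add: defs(1,2) field_simps)
      have s4: "s \<le> 4 * t" unfolding defs(3) by (rule sinh_le_4_mult[OF t t14])
      have tc: "t ^ 3 / 3 \<le> t * c - s" unfolding defs(3,4) using t by (intro cosh_sinh_ge_cubic) simp
      have "9 \<le> n\<^sup>2" using n3 power_mono[of 3 n 2] by simp
      then have "(14 / 5)\<^sup>2 \<le> \<sigma>\<^sup>2" using \<sigma>2 by (simp add: power2_eq_square)
      then have \<sigma>3: "14 / 5 \<le> \<sigma>" using pos by (auto intro: power2_le_imp_le)
      have \<sigma>n: "\<sigma> \<le> n" using \<sigma>2 n3 by (auto intro: power2_le_imp_le)
      have "48 * n\<^sup>2 + 4 * x < S"
      proof -
        have "n * n \<ge> 3 * n" using n3 by (intro mult_right_mono) auto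
        have "48 * n\<^sup>2 + 4 * x \<le> 48 * n\<^sup>2 + 16 * n" using x \<sigma>n by simp
        also have "\<dots> < 4 * n * (2 * n\<^sup>2 - 1) * (14 / 5)"
        proof -
          have "n * (n * n) \<ge> n * (3 * n)" using \<open>n * n \<ge> 3 * n\<close> n3 by (intro mult_left_mono) auto
          moreover have "4 * n * (2 * n\<^sup>2 - 1) * (14 / 5) = 112 / 5 * (n * (n * n)) - 56 / 5 * n"
            by (simp add: algebra_simps power2_eq_square)
          moreover have "n * (3 * n) = 3 * (n * n)" "n\<^sup>2 = n * n" by (simp_all add: power2_eq_square)
          ultimately show ?thesis using \<open>n * n \<ge> 3 * n\<close> n3 by linarith
        qed
        also have "\<dots> \<le> 4 * n * (2 * n\<^sup>2 - 1) * \<sigma>"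
          using \<sigma>3 n3 \<open>9 \<le> n\<^sup>2\<close> by (intro mult_left_mono) auto
        also have "\<dots> = S" using cosh_4_arcosh(1)[OF \<rho>(2)] by (simp add: defs(1,5,7))
        finally show ?thesis .
      qed
      moreover have "n * s \<le> 4 * x" using s4 n3 mult_left_mono[of s "4 * t" n] by (simp add: nt[symmetric])
      ultimately have "48 * n\<^sup>2 < S - n * s" by simp
      then have "t ^ 3 / 3 * (48 * n\<^sup>2) < t ^ 3 / 3 * (S - n * s)" using t by (intro mult_strict_left_mono) auto
      also have "\<dots> \<le> (t * c - s) * (S - n * s)" using tc Mpos by (intro mult_right_mono) auto
      finally have "16 * n\<^sup>2 * t ^ 3 < (t * c - s) * (S - n * s)" by simp
      moreover have "n * n * t * (s * s) \<le> n * n * t * ((4 * t) * (4 * t))"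
        using s4 pos n3 t by (intro mult_left_mono mult_mono) auto
      ultimately show ?thesis by (simp add: power2_eq_square power3_eq_cube mult_ac)
    qed
    have "c / s - 1 / t = (t * c - s) / (t * s)" using pos t by (simp add: diff_frac_eq mult.commute)
    moreover have "n * (n * s) / (S - n * s) < (t * c - s) / (t * s)"
      using key Mpos pos t by (subst frac_less_eq) (auto intro!: divide_neg_pos simp: algebra_simps)
    ultimately show ?thesis by simp
  qed
  ultimately have "log_lower' n t < 0"
    unfolding log_lower'_def M M' nt defs(3-6)[symmetric] by simp
  then show ?thesis by (simp add: defs(1,2))
qed

section \<open>The extremal lattices\<close>

lemma sharp_upper_unique_min:
  assumes n: "n \<ge> 1" and lu: "0 < l" "l < u" "log_upper' n l < 0" "log_upper' n u > 0"
  shows "\<exists>t0\<in>{l<..<u}. \<forall>t>0. t \<noteq> t0 \<longrightarrow> sharp_upper n t0 < sharp_upper n t"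
proof (rule strictly_convex_unique_min[OF sharp_upper_deriv[OF n] sharp_upper'_deriv[OF n]])
  show "0 < n * coth_product'' (n / 2) 1 t + n\<^sup>2 / 2 * (coth_product'' (n / 2) (n / 2) t - 0)" if "0 < t" for t
    using coth_product_deriv2_pos[of "n / 2" 1 t] coth_product_deriv2_pos[of "n / 2" "n / 2" t] n that
    by (intro add_pos_pos mult_pos_pos) auto
  show "sharp_upper' n l < 0" "0 < sharp_upper' n u"
    using lu sharp_upper_pos[of n l] sharp_upper_pos[of n u] n
    by (simp_all add: sharp_upper'_eq mult_pos_neg)
qed (use lu in auto)

lemma sharp_lower_unique_max:
  assumes n: "n > 1" and lu: "0 < l" "l < u" "log_lower' n l > 0" "log_lower' n u < 0"
  shows "\<exists>t0\<in>{l<..<u}. \<forall>t>0. t \<noteq> t0 \<longrightarrow> sharp_lower n t < sharp_lower n t0"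
proof -
  have "\<exists>t0\<in>{l<..<u}. \<forall>t>0. t \<noteq> t0 \<longrightarrow> - ln (sharp_lower n t0) < - ln (sharp_lower n t)"
  proof (rule strictly_convex_unique_min[where f'="\<lambda>t. - log_lower' n t" and
        f''="\<lambda>t. 1 / t\<^sup>2 - 1 / (sinh t)\<^sup>2 + turan_gap n t / (num_lower n t)\<^sup>2 + n\<^sup>2 / (cosh (n * t) + 1)"])
    fix t :: real assume t: "t > 0"
    show "((\<lambda>t. - ln (sharp_lower n t)) has_real_derivative - log_lower' n t) (at t)"
      by (rule DERIV_minus[OF ln_sharp_lower_deriv[OF n t]])
    show "((\<lambda>t. - log_lower' n t) has_real_derivative
      1 / t\<^sup>2 - 1 / (sinh t)\<^sup>2 + turan_gap n t / (num_lower n t)\<^sup>2 + n\<^sup>2 / (cosh (n * t) + 1)) (at t)"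
      using DERIV_minus[OF log_lower'_deriv[OF n t]] by (simp only: minus_minus)
  qed (use lu log_lower'_deriv_neg[OF n] in auto)
  then obtain t0 where t0: "t0 \<in> {l<..<u}" "\<And>t. t > 0 \<Longrightarrow> t \<noteq> t0 \<Longrightarrow> ln (sharp_lower n t) < ln (sharp_lower n t0)"
    by auto
  have "sharp_lower n t < sharp_lower n t0" if "t > 0" "t \<noteq> t0" for t
    using t0(2)[OF that] sharp_lower_pos[OF n that(1)] sharp_lower_pos[OF n, of t0] t0(1) lu by simp
  then show ?thesis using t0(1) by blast
qed

lemma condition_unique_min:
  assumes n: "n > 1" and lu: "0 < l" "l < u" "log_upper' n l < log_lower' n l" "log_lower' n u < log_upper' n u"
  shows "\<exists>t0\<in>{l<..<u}. \<forall>t>0. t \<noteq> t0 \<longrightarrow> sharp_upper n t0 / sharp_lower n t0 < sharp_upper n t / sharp_lower n t"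
proof -
  have "\<exists>t0\<in>{l<..<u}. \<forall>t>0. t \<noteq> t0 \<longrightarrow>
    ln (sharp_upper n t0) - ln (sharp_lower n t0) < ln (sharp_upper n t) - ln (sharp_lower n t)"
  proof (rule strictly_convex_unique_min[where f'="\<lambda>t. log_upper' n t - log_lower' n t" and f''="log_condition'' n"])
    fix t :: real assume t: "t > 0"
    show "((\<lambda>t. ln (sharp_upper n t) - ln (sharp_lower n t)) has_real_derivative log_upper' n t - log_lower' n t) (at t)"
      by (intro DERIV_diff ln_sharp_upper_deriv ln_sharp_lower_deriv) (use n t in auto)
    show "((\<lambda>t. log_upper' n t - log_lower' n t) has_real_derivative log_condition'' n t) (at t)"
      by (rule log_condition'_deriv[OF n t])
  qed (use lu log_condition''_pos[OF n] in auto)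
  then obtain t0 where t0: "t0 \<in> {l<..<u}" "\<And>t. t > 0 \<Longrightarrow> t \<noteq> t0 \<Longrightarrow>
      ln (sharp_upper n t0) - ln (sharp_lower n t0) < ln (sharp_upper n t) - ln (sharp_lower n t)"
    by blast
  have "sharp_upper n t0 / sharp_lower n t0 < sharp_upper n t / sharp_lower n t" if "t > 0" "t \<noteq> t0" for t
  proof -
    have pos: "sharp_upper n t > 0" "sharp_lower n t > 0" "sharp_upper n t0 > 0" "sharp_lower n t0 > 0"
      using sharp_upper_pos[of n] sharp_lower_pos[of n] n that t0(1) lu by auto
    have "ln (sharp_upper n t0 / sharp_lower n t0) < ln (sharp_upper n t / sharp_lower n t)"
      using t0(2)[OF that] pos by (simp add: ln_div)
    then show ?thesis using pos by (subst (asm) ln_less_cancel_iff) auto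
  qed
  then show ?thesis using t0(1) by blast
qed

lemma frame_bounds_as_functions:
  assumes "n \<ge> 1" "a > 0" "\<gamma> > 0"
  shows "lower_frame_bound (two_sided_exp \<gamma>) (rect_lattice a (1 / (real n * a))) = ennreal (sharp_lower (real n) (\<gamma> * a))"
    and "upper_frame_bound (two_sided_exp \<gamma>) (rect_lattice a (1 / (real n * a))) = ennreal (sharp_upper (real n) (\<gamma> * a))"
proof -
  have s: "sinh (\<gamma> * a) \<noteq> 0" using assms by simp
  have "sinh (real n * (\<gamma> * a)) / sinh (\<gamma> * a) - real n = num_lower (real n) (\<gamma> * a) / sinh (\<gamma> * a)"
    using s by (simp add: num_lower_def diff_divide_distrib del: sinh_real_zero_iff)
  then have "real n * (\<gamma> * a) * lower_const n (\<gamma> * a) = sharp_lower (real n) (\<gamma> * a)"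
    unfolding lower_const_def sharp_lower_def by simp
  then show "lower_frame_bound (two_sided_exp \<gamma>) (rect_lattice a (1 / (real n * a))) = ennreal (sharp_lower (real n) (\<gamma> * a))"
    using lower_frame_bound_two_sided_exp[OF assms] by simp
  have "sinh (real n * (\<gamma> * a)) * cosh (\<gamma> * a) / sinh (\<gamma> * a) + real n = num_upper (real n) (\<gamma> * a) / sinh (\<gamma> * a)"
    using s by (simp add: num_upper_def add_divide_distrib del: sinh_real_zero_iff)
  then have "real n * (\<gamma> * a) * upper_const n (\<gamma> * a) = sharp_upper (real n) (\<gamma> * a)"
    unfolding upper_const_def sharp_upper_def by simp
  then show "upper_frame_bound (two_sided_exp \<gamma>) (rect_lattice a (1 / (real n * a))) = ennreal (sharp_upper (real n) (\<gamma> * a))"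
    using upper_frame_bound_two_sided_exp[OF assms] by simp
qed

lemma frame_condition_number_as_function:
  assumes "n \<ge> 2" "a > 0" "\<gamma> > 0"
  shows "frame_condition_number (two_sided_exp \<gamma>) (rect_lattice a (1 / (real n * a))) =
    ennreal (sharp_upper (real n) (\<gamma> * a) / sharp_lower (real n) (\<gamma> * a))"
  unfolding frame_condition_number_def
  using frame_bounds_as_functions[of n a \<gamma>] sharp_upper_pos[of "real n" "\<gamma> * a"] sharp_lower_pos[of "real n" "\<gamma> * a"] assms
  by (simp add: divide_ennreal)

lemma lattice_params_iff: "n \<ge> 1 \<Longrightarrow> (a, b) \<in> lattice_params n \<longleftrightarrow> a > 0 \<and> b = 1 / (real n * a)"
  unfolding lattice_params_def by (auto simp: field_simps)

text \<open>
  The product \<open>a b\<close> is fixed, so the lattices correspond to \<open>a\<close>, and hence to \<open>t = \<gamma> a\<close>. The relation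
  \<open>R\<close> covers minima and maxima together.
\<close>

lemma extremal_lattice:
  assumes n: "n \<ge> 1" and \<gamma>: "\<gamma> > 0" and t0: "t0 > 0"
    and F: "\<And>a. a > 0 \<Longrightarrow> F (rect_lattice a (1 / (real n * a))) = \<phi> (\<gamma> * a)"
    and ext: "\<And>t. t > 0 \<Longrightarrow> t \<noteq> t0 \<Longrightarrow> R (\<phi> t0) (\<phi> t)"
  defines "\<alpha> \<equiv> real n * t0 / \<gamma>"
  shows "(\<alpha> / n, 1 / \<alpha>) \<in> lattice_params n"
    and "\<forall>(a, b)\<in>lattice_params n - {(\<alpha> / n, 1 / \<alpha>)}. R (F (rect_lattice (\<alpha> / n) (1 / \<alpha>))) (F (rect_lattice a b))"
proof -
  have a0: "\<alpha> / n = t0 / \<gamma>" "1 / \<alpha> = 1 / (real n * (t0 / \<gamma>))" using n by (auto simp: \<alpha>_def)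
  have p: "t0 / \<gamma> > 0" using t0 \<gamma> by simp
  show "(\<alpha> / n, 1 / \<alpha>) \<in> lattice_params n" unfolding a0 lattice_params_iff[OF n] using p by simp
  have "R (F (rect_lattice (\<alpha> / n) (1 / \<alpha>))) (F (rect_lattice a b))"
    if "(a, b) \<in> lattice_params n" "(a, b) \<noteq> (\<alpha> / n, 1 / \<alpha>)" for a b
  proof -
    have a: "a > 0" "b = 1 / (real n * a)" using that(1) lattice_params_iff[OF n] by auto
    have "\<gamma> * a \<noteq> t0"
    proof
      assume "\<gamma> * a = t0"
      then have "a = t0 / \<gamma>" using \<gamma> by (simp add: field_simps)
      then show False using that(2) a(2) unfolding a0 by simp
    qed
    then have "R (\<phi> t0) (\<phi> (\<gamma> * a))" using a \<gamma> by (intro ext) auto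
    then show ?thesis unfolding a0 a(2) F[OF p] F[OF a(1)] using \<gamma> by simp
  qed
  then show "\<forall>(a, b)\<in>lattice_params n - {(\<alpha> / n, 1 / \<alpha>)}. R (F (rect_lattice (\<alpha> / n) (1 / \<alpha>))) (F (rect_lattice a b))"
    by auto
qed

lemma log_upper'_1:
  assumes "t > 0"
  shows "log_upper' 1 t = 1 / t - 2 / sinh t"
proof -
  define s c where "s = sinh t" "c = cosh t"
  have s: "s > 0" and c: "c > 1" using assms cosh_gt_1[of t] by (auto simp: s_c_def)
  have sq: "s * s = (c - 1) * (c + 1)" using cosh_square_eq[of t] by (simp add: s_c_def power2_eq_square algebra_simps)
  have "num_upper' 1 t = (2 * c - 1) * (c + 1)"
    unfolding num_upper'_def using sq by (simp add: s_c_def[symmetric] algebra_simps)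
  moreover have "num_upper 1 t = s * (c + 1)" by (simp add: num_upper_def s_c_def algebra_simps)
  ultimately have 1: "num_upper' 1 t / num_upper 1 t = (2 * c - 1) / s" using c by simp
  have 2: "s / (c - 1) = (c + 1) / s" using s c sq by (simp add: frac_eq_eq mult.commute)
  have "log_upper' 1 t = 1 / t + (2 * c - 1) / s - c / s - (c + 1) / s"
    unfolding log_upper'_def 1 using 2 by (simp add: s_c_def)
  also have "\<dots> = 1 / t - 2 / s" by (simp add: diff_divide_distrib add_divide_distrib)
  finally show ?thesis by (simp add: s_c_def)
qed

theorem theorem2p7:
  fixes n :: nat
  assumes "n \<ge> 1"
  shows "\<exists>I :: real set. (\<exists>l u. I = {l<..<u}) \<and> I \<subseteq> {eta n / 2<..<2 * eta n} \<and>
    (\<forall>\<gamma>>0.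
      (n \<ge> 2 \<longrightarrow>
        (\<exists>a0\<in>(\<lambda>x. x / \<gamma>) ` I. (a0 / n, 1 / a0) \<in> lattice_params n \<and>
          (\<forall>(a, b)\<in>lattice_params n - {(a0 / n, 1 / a0)}.
            frame_condition_number (two_sided_exp \<gamma>) (rect_lattice (a0 / n) (1 / a0))
              < frame_condition_number (two_sided_exp \<gamma>) (rect_lattice a b)))) \<and>
      (n \<ge> 2 \<longrightarrow>
        (\<exists>a_max\<in>(\<lambda>x. x / \<gamma>) ` I. (a_max / n, 1 / a_max) \<in> lattice_params n \<and>
          (\<forall>(a, b)\<in>lattice_params n - {(a_max / n, 1 / a_max)}.
            lower_frame_bound (two_sided_exp \<gamma>) (rect_lattice a b)
              < lower_frame_bound (two_sided_exp \<gamma>) (rect_lattice (a_max / n) (1 / a_max))))) \<and>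
      (n = 1 \<longrightarrow>
        (\<forall>(a, b)\<in>lattice_params n. lower_frame_bound (two_sided_exp \<gamma>) (rect_lattice a b) = 0)) \<and>
      (\<exists>a_min>0. (n \<ge> 2 \<longrightarrow> a_min \<in> (\<lambda>x. x / \<gamma>) ` I) \<and>
        (a_min / n, 1 / a_min) \<in> lattice_params n \<and>
        (\<forall>(a, b)\<in>lattice_params n - {(a_min / n, 1 / a_min)}.
          upper_frame_bound (two_sided_exp \<gamma>) (rect_lattice (a_min / n) (1 / a_min))
            < upper_frame_bound (two_sided_exp \<gamma>) (rect_lattice a b))))"
proof (cases "n = 1")
  case True
  have "sinh (1::real) < 2"
  proof -
    have "exp (1::real) < 3" "exp (- 1::real) > 0" using e_less_272 by simp_all
    from diff_strict_mono[OF this] show ?thesis unfolding sinh_field_def by simp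
  qed
  then have "log_upper' 1 1 < 0" by (simp add: log_upper'_1 field_simps)
  moreover have "log_upper' 1 4 > 0"
    using sinh_ge_cubic[of 4] by (simp add: log_upper'_1 field_simps)
  ultimately obtain t0 where t0: "t0 \<in> {1<..<4}" "\<And>t. t > 0 \<Longrightarrow> t \<noteq> t0 \<Longrightarrow> sharp_upper 1 t0 < sharp_upper 1 t"
    using sharp_upper_unique_min[of 1 1 4] by auto
  show ?thesis
  proof (intro exI[of _ "{}"] conjI allI impI)
    show "\<exists>l u. {} = {l<..<u::real}" by (intro exI[of _ 0]) simp
    fix \<gamma> :: real assume \<gamma>: "\<gamma> > 0"
    show "\<forall>(a, b)\<in>lattice_params n. lower_frame_bound (two_sided_exp \<gamma>) (rect_lattice a b) = 0"
      using frame_bounds_as_functions(1)[OF assms _ \<gamma>] lattice_params_iff[OF assms]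
      by (auto simp: True sharp_lower_def num_lower_def)
    define F where "F = upper_frame_bound (two_sided_exp \<gamma>)"
    have F: "F (rect_lattice a (1 / (real n * a))) = ennreal (sharp_upper (real n) (\<gamma> * a))" if "a > 0" for a
      unfolding F_def by (rule frame_bounds_as_functions(2)[OF assms that \<gamma>])
    have "ennreal (sharp_upper (real n) t0) < ennreal (sharp_upper (real n) t)" if "t > 0" "t \<noteq> t0" for t
      using t0(2)[OF that] sharp_upper_pos[of 1 t0] t0(1) by (simp add: True ennreal_less_iff)
    note ext = extremal_lattice[where F=F and \<phi>="\<lambda>t. ennreal (sharp_upper (real n) t)" and R="(<)", OF assms \<gamma> _ F this]
    show "\<exists>a_min>0. (n \<ge> 2 \<longrightarrow> a_min \<in> (\<lambda>x. x / \<gamma>) ` {}) \<and>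
        (a_min / n, 1 / a_min) \<in> lattice_params n \<and>
        (\<forall>(a, b)\<in>lattice_params n - {(a_min / n, 1 / a_min)}.
          upper_frame_bound (two_sided_exp \<gamma>) (rect_lattice (a_min / n) (1 / a_min))
            < upper_frame_bound (two_sided_exp \<gamma>) (rect_lattice a b))"
      by (rule exI[of _ "real n * t0 / \<gamma>"], unfold F_def[symmetric], intro conjI ext)
        (use t0(1) \<gamma> True in auto)
  qed (use True in auto)
next
  case False
  then have n: "n \<ge> 2" using assms by simp
  then have "n = 2 \<or> n \<ge> 3" by linarith
  with n have N: "real n \<ge> 2" "real n > 1" "real n = 2 \<or> real n \<ge> 3" by auto
  \<comment> \<open>\<open>eta n = 2 * \<rho>\<close>, so that \<open>{l<..<u}\<close> is the interval of the theorem divided by \<open>n\<close>\<close>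
  define \<rho> where "\<rho> = arcosh (real n)"
  have \<rho>: "\<rho> > 0" "cosh \<rho> = real n" using N by (auto simp: \<rho>_def cosh_arcosh_real arcosh_real_gt_1_iff)
  define l u where "l = \<rho> / n" and "u = 4 * \<rho> / n"
  have lu: "0 < l" "l < u" using \<rho> N by (auto simp: l_def u_def divide_strict_right_mono)
  have signs: "log_upper' n l < 0" "log_lower' n l > 0" "log_upper' n u > 0" "log_lower' n u < 0"
    unfolding l_def u_def
    using log_upper'_low_neg[OF N(2) \<rho>] log_lower'_low_pos[OF N(2) \<rho>]
      log_upper'_high_pos[OF N(1) \<rho>] log_lower'_high_neg[OF N(3) \<rho>] by auto
  define I where "I = {eta n / 2<..<2 * eta n}"
  have I: "real n * t \<in> I" if "t \<in> {l<..<u}" for t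
    using that N by (simp add: I_def eta_def \<rho>_def[symmetric] l_def u_def field_simps)
  obtain tu where tu: "tu \<in> {l<..<u}" "\<And>t. t > 0 \<Longrightarrow> t \<noteq> tu \<Longrightarrow> sharp_upper n tu < sharp_upper n t"
    using sharp_upper_unique_min[of "real n" l u] signs lu N by auto
  obtain tl where tl: "tl \<in> {l<..<u}" "\<And>t. t > 0 \<Longrightarrow> t \<noteq> tl \<Longrightarrow> sharp_lower n t < sharp_lower n tl"
    using sharp_lower_unique_max[of "real n" l u] signs lu N by auto
  obtain tc where tc: "tc \<in> {l<..<u}" "\<And>t. t > 0 \<Longrightarrow> t \<noteq> tc \<Longrightarrow>
      sharp_upper n tc / sharp_lower n tc < sharp_upper n t / sharp_lower n t"
    using condition_unique_min[of "real n" l u] signs lu N by auto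
  have pos: "tu > 0" "tl > 0" "tc > 0" using tu tl tc lu by auto
  show ?thesis
  proof (rule exI[of _ I], intro conjI allI impI)
    show "\<exists>l u. I = {l<..<u}" by (auto simp: I_def)
    show "I \<subseteq> {eta n / 2<..<2 * eta n}" by (simp add: I_def)
    fix \<gamma> :: real assume \<gamma>: "\<gamma> > 0"
    have img: "real n * t / \<gamma> \<in> (\<lambda>x. x / \<gamma>) ` I" if "t \<in> {l<..<u}" for t using I[OF that] by blast
    show "\<exists>a0\<in>(\<lambda>x. x / \<gamma>) ` I. (a0 / n, 1 / a0) \<in> lattice_params n \<and>
          (\<forall>(a, b)\<in>lattice_params n - {(a0 / n, 1 / a0)}.
            frame_condition_number (two_sided_exp \<gamma>) (rect_lattice (a0 / n) (1 / a0))
              < frame_condition_number (two_sided_exp \<gamma>) (rect_lattice a b))"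
    proof (rule bexI[OF _ img[OF tc(1)]], rule conjI)
      have lt: "ennreal (sharp_upper n tc / sharp_lower n tc) < ennreal (sharp_upper n t / sharp_lower n t)" if "t > 0" "t \<noteq> tc" for t
        using tc(2)[OF that] sharp_upper_pos[of n tc] sharp_lower_pos[of n tc] pos N by (simp add: ennreal_less_iff)
      note ext = extremal_lattice[where F="frame_condition_number (two_sided_exp \<gamma>)" and R="(<)" and
          \<phi>="\<lambda>t. ennreal (sharp_upper n t / sharp_lower n t)", OF assms \<gamma> pos(3) frame_condition_number_as_function[OF n _ \<gamma>] lt]
      show "(real n * tc / \<gamma> / n, 1 / (real n * tc / \<gamma>)) \<in> lattice_params n" by (rule ext(1))
      show "\<forall>(a, b)\<in>lattice_params n - {(real n * tc / \<gamma> / n, 1 / (real n * tc / \<gamma>))}.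
            frame_condition_number (two_sided_exp \<gamma>) (rect_lattice (real n * tc / \<gamma> / n) (1 / (real n * tc / \<gamma>)))
              < frame_condition_number (two_sided_exp \<gamma>) (rect_lattice a b)" by (rule ext(2))
    qed
    show "\<exists>a_max\<in>(\<lambda>x. x / \<gamma>) ` I. (a_max / n, 1 / a_max) \<in> lattice_params n \<and>
          (\<forall>(a, b)\<in>lattice_params n - {(a_max / n, 1 / a_max)}.
            lower_frame_bound (two_sided_exp \<gamma>) (rect_lattice a b)
              < lower_frame_bound (two_sided_exp \<gamma>) (rect_lattice (a_max / n) (1 / a_max)))"
    proof (rule bexI[OF _ img[OF tl(1)]], rule conjI)
      have gt: "ennreal (sharp_lower n tl) > ennreal (sharp_lower n t)" if "t > 0" "t \<noteq> tl" for t
        using tl(2)[OF that] sharp_lower_pos[of n t] that N by (simp add: ennreal_less_iff)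
      note ext = extremal_lattice[where F="lower_frame_bound (two_sided_exp \<gamma>)" and R="(>)" and
          \<phi>="\<lambda>t. ennreal (sharp_lower n t)", OF assms \<gamma> pos(2) frame_bounds_as_functions(1)[OF assms _ \<gamma>] gt]
      show "(real n * tl / \<gamma> / n, 1 / (real n * tl / \<gamma>)) \<in> lattice_params n" by (rule ext(1))
      show "\<forall>(a, b)\<in>lattice_params n - {(real n * tl / \<gamma> / n, 1 / (real n * tl / \<gamma>))}.
            lower_frame_bound (two_sided_exp \<gamma>) (rect_lattice a b)
              < lower_frame_bound (two_sided_exp \<gamma>) (rect_lattice (real n * tl / \<gamma> / n) (1 / (real n * tl / \<gamma>)))" by (rule ext(2))
    qed
    have lt: "ennreal (sharp_upper n tu) < ennreal (sharp_upper n t)" if "t > 0" "t \<noteq> tu" for t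
      using tu(2)[OF that] sharp_upper_pos[of n tu] pos N by (simp add: ennreal_less_iff)
    note ext = extremal_lattice[where F="upper_frame_bound (two_sided_exp \<gamma>)" and R="(<)" and
        \<phi>="\<lambda>t. ennreal (sharp_upper n t)", OF assms \<gamma> pos(1) frame_bounds_as_functions(2)[OF assms _ \<gamma>] lt]
    show "\<exists>a_min>0. (n \<ge> 2 \<longrightarrow> a_min \<in> (\<lambda>x. x / \<gamma>) ` I) \<and>
        (a_min / n, 1 / a_min) \<in> lattice_params n \<and>
        (\<forall>(a, b)\<in>lattice_params n - {(a_min / n, 1 / a_min)}.
          upper_frame_bound (two_sided_exp \<gamma>) (rect_lattice (a_min / n) (1 / a_min))
            < upper_frame_bound (two_sided_exp \<gamma>) (rect_lattice a b))"
    proof (rule exI[of _ "real n * tu / \<gamma>"], intro conjI)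
      show "0 < real n * tu / \<gamma>" using pos N \<gamma> by simp
      show "n \<ge> 2 \<longrightarrow> real n * tu / \<gamma> \<in> (\<lambda>x. x / \<gamma>) ` I" using img[OF tu(1)] by blast
      show "(real n * tu / \<gamma> / n, 1 / (real n * tu / \<gamma>)) \<in> lattice_params n" by (rule ext(1))
      show "\<forall>(a, b)\<in>lattice_params n - {(real n * tu / \<gamma> / n, 1 / (real n * tu / \<gamma>))}.
          upper_frame_bound (two_sided_exp \<gamma>) (rect_lattice (real n * tu / \<gamma> / n) (1 / (real n * tu / \<gamma>)))
            < upper_frame_bound (two_sided_exp \<gamma>) (rect_lattice a b)" by (rule ext(2))
    qed
  qed (use False in auto)
qed

end
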